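(* Let $\Phi^0$ be a homogeneous Poisson point process on $\mathbb{R}^d$. Almost surely the $\mathrm{CHN}^2$ construction is well defined at every level $n\in\mathbb{N}$. For each $n$, under the Palm probability of $\Phi^0$, every connected component of the $f^n$-graph $[G^n,0]$ is of class $\mathcal{F/F}$: it is finite and contains exactly one cycle, which has length $2$.
   Context: Standing assumptions: $\Phi^0$ is a simple point process on $\mathbb{R}^d$ with a.s. pairwise distinct interpoint distances (no ties). For finite sets $S,T\subset\mathbb{R}^d$ let $\delta(S,T)=\min_{x\in S,y\in T}\|x-y\|$. Graph of a point-shift $h$: vertices the points, directed edges $x\to h(x)$. $\mathrm{CHN}^2$ construction. $f^0(x)$ is the Euclidean nearest neighbour of $x$ in $\Phi^0$. Inductively, suppose $f^{k-1}$ is defined and every connected component of its graph is finite and contains exactly one cycle, which has length $2$, i.e. a pair $\{a,b\}$ with $f^{k-1}(a)=b$ and $f^{k-1}(b)=a$. These pairs are denoted $S^{k-1}_i$; their points are the cluster heads of order $k-1$, forming $\Phi^{k-1}_c$. For each pair $S^{k-1}_i$, let $S^{k-1}_j$ ($j\neq i$) be the pair minimizing $\delta(S^{k-1}_i,S^{k-1}_j)$, and let $x_i\in S^{k-1}_i$, $x_j\in S^{k-1}_j$ attain this minimum. Then $x_i$ is called the exit point of order $k-1$ of $S^{k-1}_i$. Set $f^k(x_i)=x_j$ for every exit point of order $k-1$, and $f^k(y)=f^{k-1}(y)$ for all other points $y$. $[G^n,0]$ is the $f^n$-graph built on the Palm version $\Phi^0\cup\{0\}$, rooted at $0$. A component is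 of class $\mathcal{F/F}$ if it and all its foils are finite, where foils are the classes of $x\sim y\iff (f^n)^{(a)}(x)=(f^n)^{(b)}(y)$ for some $a,b\ge 0$ (iterates). *)

theory Defs
  imports "HOL-Probability.Probability"
begin

definition homogeneous_PPP ::
  "'b measure \<Rightarrow> ('b \<Rightarrow> 'a::euclidean_space set) \<Rightarrow> real \<Rightarrow> bool" where
  "homogeneous_PPP M Phi c \<longleftrightarrow>
     prob_space M \<and> c > 0 \<and>
     (\<forall>\<omega>\<in>space M. \<forall>B. bounded B \<longrightarrow> finite (Phi \<omega> \<inter> B)) \<and>
     (\<forall>B\<in>sets lborel. bounded B \<longrightarrow>
        (\<lambda>\<omega>. card (Phi \<omega> \<inter> B)) \<in> measurable M (count_space UNIV) \<and>
        (\<forall>k::nat. measure M {\<omega>\<in>space M. card (Phi \<omega> \<inter> B) = k}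
            = (c * measure lborel B) ^ k / fact k * exp (- (c * measure lborel B)))) \<and>
     (\<forall>(Bs::nat \<Rightarrow> 'a set) n.
        (\<forall>i<n. Bs i \<in> sets lborel \<and> bounded (Bs i)) \<and> disjoint_family_on Bs {..<n} \<longrightarrow>
        prob_space.indep_vars M (\<lambda>_. count_space UNIV)
          (\<lambda>i \<omega>. card (Phi \<omega> \<inter> Bs i)) {..<n})"

definition graph_edges :: "'a set \<Rightarrow> ('a \<Rightarrow> 'a) \<Rightarrow> ('a \<times> 'a) set" where
  "graph_edges P f = {(u, f u) | u. u \<in> P}"

definition component :: "'a set \<Rightarrow> ('a \<Rightarrow> 'a) \<Rightarrow> 'a \<Rightarrow> 'a set" where
  "component P f x = {y \<in> P. (x, y) \<in> (graph_edges P f \<union> (graph_edges P f)\<inverse>)\<^sup>*}"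

definition cycles_in :: "('a \<Rightarrow> 'a) \<Rightarrow> 'a set \<Rightarrow> 'a set set" where
  "cycles_in f K = {range (\<lambda>i. (f ^^ i) z) | z. z \<in> K \<and> (\<exists>m>0. (f ^^ m) z = z)}"

definition unique_cycle_length_2 :: "('a \<Rightarrow> 'a) \<Rightarrow> 'a set \<Rightarrow> bool" where
  "unique_cycle_length_2 f K \<longleftrightarrow> (\<exists>C. cycles_in f K = {C} \<and> card C = 2)"

definition foil :: "'a set \<Rightarrow> ('a \<Rightarrow> 'a) \<Rightarrow> 'a \<Rightarrow> 'a set" where
  "foil P f x = {y \<in> P. \<exists>a b. (f ^^ a) x = (f ^^ b) y}"

definition class_FF :: "'a set \<Rightarrow> ('a \<Rightarrow> 'a) \<Rightarrow> 'a set \<Rightarrow> bool" where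
  "class_FF P f K \<longleftrightarrow> finite K \<and> (\<forall>x\<in>K. finite (foil P f x))"

definition good_level :: "'a set \<Rightarrow> ('a \<Rightarrow> 'a) \<Rightarrow> bool" where
  "good_level P f \<longleftrightarrow> (\<forall>x\<in>P. f x \<in> P) \<and>
     (\<forall>x\<in>P. finite (component P f x) \<and> unique_cycle_length_2 f (component P f x))"

definition is_nn :: "'a::metric_space set \<Rightarrow> 'a \<Rightarrow> 'a \<Rightarrow> bool" where
  "is_nn P x y \<longleftrightarrow> y \<in> P \<and> y \<noteq> x \<and> (\<forall>z\<in>P. z \<noteq> x \<and> z \<noteq> y \<longrightarrow> dist x y < dist x z)"

definition pairs_of :: "'a set \<Rightarrow> ('a \<Rightarrow> 'a) \<Rightarrow> 'a set set" where
  "pairs_of P f = {{a, f a} | a. a \<in> P \<and> f a \<noteq> a \<and> f (f a) = a}"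

text \<open>x is the exit point of its pair S = {x, f x}, and x' (in the closest other pair)
  is its target: (x, x') is the unique pair attaining delta(S, S') minimised over all
  other pairs S'.\<close>
definition exit_edge :: "'a::metric_space set \<Rightarrow> ('a \<Rightarrow> 'a) \<Rightarrow> 'a \<Rightarrow> 'a \<Rightarrow> bool" where
  "exit_edge P f x x' \<longleftrightarrow> x \<in> P \<and> f x \<noteq> x \<and> f (f x) = x \<and>
     (\<exists>S'\<in>pairs_of P f. S' \<noteq> {x, f x} \<and> x' \<in> S') \<and>
     (\<forall>T\<in>pairs_of P f. T \<noteq> {x, f x} \<longrightarrow>
        (\<forall>u\<in>{x, f x}. \<forall>v\<in>T. (u, v) \<noteq> (x, x') \<longrightarrow> dist x x' < dist u v))"

primrec chn :: "'a::metric_space set \<Rightarrow> nat \<Rightarrow> 'a \<Rightarrow> 'a" where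
  "chn P 0 = (\<lambda>x. THE y. is_nn P x y)"
| "chn P (Suc k) = (\<lambda>y. if \<exists>y'. exit_edge P (chn P k) y y'
                         then THE y'. exit_edge P (chn P k) y y' else chn P k y)"

primrec chn_wd :: "'a::metric_space set \<Rightarrow> nat \<Rightarrow> bool" where
  "chn_wd P 0 = (\<forall>x\<in>P. \<exists>y. is_nn P x y)"
| "chn_wd P (Suc k) = (chn_wd P k \<and> good_level P (chn P k) \<and>
     (\<forall>S\<in>pairs_of P (chn P k). \<exists>x\<in>S. \<exists>x'. exit_edge P (chn P k) x x'))"

end

theory Submission
  imports Defs
begin

text \<open>
  One step of the construction sends each cluster (a singleton at the start, later a two-cycle) to
  the nearest other cluster. Along this map the distances decrease, and the diameter of a cluster is
  smaller than its distance to the others; so everything reduces to showing that the components of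
  the map between clusters are finite.

  A long chain of clusters with monotone distances of size at most \<open>m\<close> contains, by the
  pigeonhole principle, a long run of steps whose lengths lie in one narrow interval. The expected
  number of such runs decays geometrically in their length, by a union bound over sequences of small
  grid cells. This excludes infinite forward chains, and backward chains with bounded steps.
  On the other hand, every ball of radius \<open>m\<close> with centre in a region of size polynomial in \<open>m\<close>
  contains, with probability tending to one, a fixed hierarchical pattern of isolated points, which
  forces two clusters of the given level inside the ball. Hence, looking backwards, the first
  step longer than \<open>m\<close> would leave a large ball free of clusters, which is impossible. Both estimates
  hold along a sequence of scales \<open>m\<close> tending to infinity, so backward trees have bounded depth and
  bounded diameter, and local finiteness makes them finite. The argument concerns single
  configurations and is not affected by adding the origin.
\<close>

section \<open>Functional graphs and nearest clusters\<close>

lemma funpow_closed: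
  assumes "\<And>x. x \<in> P \<Longrightarrow> f x \<in> P" "x \<in> P"
  shows "(f ^^ n) x \<in> P"
  using assms by (induction n) auto

lemma funpow_funpow: "(f ^^ a) ((f ^^ b) x) = (f ^^ (a + b)) x"
  by (simp add: funpow_add)

lemma component_eq_foil:
  assumes cl: "\<And>x. x \<in> P \<Longrightarrow> f x \<in> P" and x: "x \<in> P"
  shows "component P f x = foil P f x"
proof -
  let ?E = "graph_edges P f \<union> (graph_edges P f)\<inverse>"
  have 1: "y \<in> P \<and> (\<exists>a b. (f ^^ a) x = (f ^^ b) y)" if "(x, y) \<in> ?E\<^sup>*" for y
    using that
  proof (induction rule: rtrancl_induct)
    case base
    then show ?case using x by auto
  next
    case (step y z)
    then obtain a b where ab: "(f ^^ a) x = (f ^^ b) y" and y: "y \<in> P" by auto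
    from step(2) consider "z = f y" | "y = f z" "z \<in> P"
      by (auto simp: graph_edges_def)
    then show ?case
    proof cases
      case 1
      have "(f ^^ Suc a) x = (f ^^ b) z"
        using ab 1 by (simp add: funpow_swap1)
      then show ?thesis using 1 y cl by blast
    next
      case 2
      have "(f ^^ a) x = (f ^^ Suc b) z"
        using ab 2 by (simp add: funpow_swap1)
      then show ?thesis using 2 by blast
    qed
  qed
  have 2: "(y, (f ^^ n) y) \<in> ?E\<^sup>*" if "y \<in> P" for y n
  proof (induction n)
    case (Suc n)
    have "((f ^^ n) y, (f ^^ Suc n) y) \<in> ?E"
      using funpow_closed[of P f, OF cl that] by (auto simp: graph_edges_def)
    then show ?case using Suc by (meson rtrancl.rtrancl_into_rtrancl)
  qed simp
  have "sym (?E\<^sup>*)"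
    by (intro sym_rtrancl) (auto simp: sym_def)
  then have 3: "((f ^^ n) y, y) \<in> ?E\<^sup>*" if "y \<in> P" for y n
    using 2[OF that] by (auto dest: symD)
  show ?thesis
    unfolding component_def foil_def
    using 1 2[OF x] 3 by (auto intro: rtrancl_trans) (metis rtrancl_trans)
qed

definition reaches_two_cycles :: "'a set \<Rightarrow> ('a \<Rightarrow> 'a) \<Rightarrow> bool" where
  "reaches_two_cycles P f \<longleftrightarrow> (\<forall>x\<in>P. \<exists>n. f (f ((f ^^ n) x)) = (f ^^ n) x)"

lemma funpow_two_cycle:
  assumes "f (f a) = a"
  shows "(f ^^ n) a \<in> {a, f a}" "f (f ((f ^^ n) a)) = (f ^^ n) a"
proof -
  show "(f ^^ n) a \<in> {a, f a}" using assms by (induction n) auto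
  then show "f (f ((f ^^ n) a)) = (f ^^ n) a" using assms by auto
qed

lemma two_cycle_eq: "f (f a) = a \<Longrightarrow> w \<in> {a, f a} \<Longrightarrow> {w, f w} = {a, f a}"
  by auto

lemma periodic_two_cycle:
  assumes "reaches_two_cycles P f" "z \<in> P" "(f ^^ m) z = z" "m > 0"
  shows "f (f z) = z"
proof -
  obtain n where n: "f (f ((f ^^ n) z)) = (f ^^ n) z"
    using assms by (auto simp: reaches_two_cycles_def)
  have "(f ^^ (m * k)) z = z" for k
    using assms(3) by (induction k) (auto simp: funpow_add)
  then have "z = (f ^^ (m * n)) z" by simp
  also have "m * n = (m * n - n) + n" using assms(4) by simp
  also have "(f ^^ \<dots>) z = (f ^^ (m * n - n)) ((f ^^ n) z)" by (simp add: funpow_add)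
  finally have "z = (f ^^ (m * n - n)) ((f ^^ n) z)" .
  with funpow_two_cycle(2)[of f "(f ^^ n) z" "m * n - n", OF n] show ?thesis by simp
qed

lemma range_funpow_two_cycle:
  assumes "f (f z) = z"
  shows "range (\<lambda>i. (f ^^ i) z) = {z, f z}"
proof
  show "range (\<lambda>i. (f ^^ i) z) \<subseteq> {z, f z}" using funpow_two_cycle(1)[of f z, OF assms] by blast
  have "z = (f ^^ 0) z" "f z = (f ^^ 1) z" by auto
  then show "{z, f z} \<subseteq> range (\<lambda>i. (f ^^ i) z)" by blast
qed

lemma unique_cycle_length_2_foil:
  assumes cl: "\<And>x. x \<in> P \<Longrightarrow> f x \<in> P" and ne: "\<And>x. x \<in> P \<Longrightarrow> f x \<noteq> x"
    and re: "reaches_two_cycles P f" and x: "x \<in> P"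
  shows "unique_cycle_length_2 f (foil P f x)"
proof -
  obtain n where n: "f (f ((f ^^ n) x)) = (f ^^ n) x"
    using re x by (auto simp: reaches_two_cycles_def)
  define a where "a = (f ^^ n) x"
  have a: "f (f a) = a" "a \<in> P" using n funpow_closed[of P f, OF cl x] by (auto simp: a_def)
  have "(f ^^ n) x = (f ^^ 0) a" by (simp add: a_def)
  then have "a \<in> foil P f x"
    unfolding foil_def using a(2) by blast
  moreover have "(f ^^ 2) a = a" using a by (simp add: numeral_2_eq_2)
  ultimately have 1: "{a, f a} \<in> cycles_in f (foil P f x)"
    unfolding cycles_in_def using range_funpow_two_cycle[of f a, OF a(1)]
    by (auto intro!: exI[of _ a] exI[of _ 2])
  have 2: "C = {a, f a}" if C: "C \<in> cycles_in f (foil P f x)" for C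
  proof -
    obtain z m where z: "z \<in> foil P f x" "m > 0" "(f ^^ m) z = z" "C = range (\<lambda>i. (f ^^ i) z)"
      using C by (auto simp: cycles_in_def)
    then have zP: "z \<in> P" by (simp add: foil_def)
    have zz: "f (f z) = z" using periodic_two_cycle[OF re zP z(3) z(2)] .
    obtain i j where "(f ^^ i) x = (f ^^ j) z" using z(1) by (auto simp: foil_def)
    then have "(f ^^ n) ((f ^^ i) x) = (f ^^ n) ((f ^^ j) z)" by simp
    then have "(f ^^ i) a = (f ^^ (n + j)) z"
      by (simp add: a_def funpow_funpow add.commute)
    then have "{a, f a} = {z, f z}"
      using two_cycle_eq[of f a "(f ^^ i) a"] two_cycle_eq[of f z "(f ^^ (n + j)) z"]
        funpow_two_cycle(1)[of f z "n + j", OF zz] funpow_two_cycle(1)[of f a i, OF a(1)] a(1) zz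
      by simp
    then show ?thesis using range_funpow_two_cycle[of f z, OF zz] z(4) by simp
  qed
  have "card {a, f a} = 2" using ne[OF a(2)] by (simp add: card_insert_if)
  then show ?thesis
    unfolding unique_cycle_length_2_def using 1 2 by blast
qed

locale nearest_clusters =
  fixes \<S> :: "'a::euclidean_space set set" and \<sigma> :: "'a set \<Rightarrow> 'a set" and ex tg :: "'a set \<Rightarrow> 'a"
  assumes disj: "S \<in> \<S> \<Longrightarrow> T \<in> \<S> \<Longrightarrow> S \<noteq> T \<Longrightarrow> S \<inter> T = {}"
    and ex_in: "S \<in> \<S> \<Longrightarrow> ex S \<in> S"
    and next_in: "S \<in> \<S> \<Longrightarrow> \<sigma> S \<in> \<S>"
    and next_neq: "S \<in> \<S> \<Longrightarrow> \<sigma> S \<noteq> S"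
    and tg_in: "S \<in> \<S> \<Longrightarrow> tg S \<in> \<sigma> S"
    and closest: "S \<in> \<S> \<Longrightarrow> T \<in> \<S> \<Longrightarrow> T \<noteq> S \<Longrightarrow> u \<in> S \<Longrightarrow> v \<in> T \<Longrightarrow>
        (u, v) \<noteq> (ex S, tg S) \<Longrightarrow> dist (ex S) (tg S) < dist u v"
    and diam: "S \<in> \<S> \<Longrightarrow> u \<in> S \<Longrightarrow> v \<in> S \<Longrightarrow> dist u v < dist (ex S) (tg S)"
begin

definition gap :: "'a set \<Rightarrow> real" where "gap S = dist (ex S) (tg S)"

lemma gap_le: "S \<in> \<S> \<Longrightarrow> T \<in> \<S> \<Longrightarrow> T \<noteq> S \<Longrightarrow> u \<in> S \<Longrightarrow> v \<in> T \<Longrightarrow> gap S \<le> dist u v"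
  using closest[of S T u v] by (cases "(u, v) = (ex S, tg S)") (auto simp: gap_def)

lemma gap_next_le: "S \<in> \<S> \<Longrightarrow> gap (\<sigma> S) \<le> gap S"
  using gap_le[of "\<sigma> S" S "tg S" "ex S"] next_in next_neq tg_in ex_in
  by (metis dist_commute gap_def)

lemma mutual:
  assumes "S \<in> \<S>" "gap (\<sigma> S) = gap S"
  shows "ex (\<sigma> S) = tg S" "tg (\<sigma> S) = ex S" "\<sigma> (\<sigma> S) = S"
proof -
  have "(tg S, ex S) = (ex (\<sigma> S), tg (\<sigma> S))"
  proof (rule ccontr)
    assume "(tg S, ex S) \<noteq> (ex (\<sigma> S), tg (\<sigma> S))"
    from closest[OF next_in[OF assms(1)] assms(1) next_neq[OF assms(1), symmetric]
        tg_in[OF assms(1)] ex_in[OF assms(1)] this] assms(2)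
    show False by (simp add: gap_def dist_commute)
  qed
  then show 1: "ex (\<sigma> S) = tg S" "tg (\<sigma> S) = ex S" by auto
  have "ex S \<in> \<sigma> (\<sigma> S)" using 1 tg_in[of "\<sigma> S"] next_in assms by auto
  then show "\<sigma> (\<sigma> S) = S"
    using disj[of "\<sigma> (\<sigma> S)" S] next_in assms ex_in[of S] by blast
qed

lemma mutual_of_two_cycle:
  assumes "S \<in> \<S>" "\<sigma> (\<sigma> S) = S"
  shows "gap (\<sigma> S) = gap S"
  using gap_next_le[of S] gap_next_le[of "\<sigma> S"] next_in assms by auto

lemma gap_pos: "S \<in> \<S> \<Longrightarrow> gap S > 0"
  using diam[of S "ex S" "ex S"] ex_in by (simp add: gap_def)

lemma funpow_next_in: "S \<in> \<S> \<Longrightarrow> (\<sigma> ^^ n) S \<in> \<S>"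
  by (intro funpow_closed[of \<S> \<sigma>] next_in)

end

text \<open>
  A chain of clusters is recorded by two points per cluster: an edge enters or leaves the
  \<open>i\<close>-th cluster at \<open>u i\<close> and at \<open>v i\<close> (possibly equal), and \<open>v i\<close> is joined to \<open>u (Suc i)\<close>.
\<close>

definition increasing_chain ::
    "'a::real_normed_vector set \<Rightarrow> real \<Rightarrow> real \<Rightarrow> nat \<Rightarrow> (nat \<Rightarrow> 'a) \<Rightarrow> (nat \<Rightarrow> 'a) \<Rightarrow> bool" where
  "increasing_chain P m R N u v \<longleftrightarrow>
     (\<forall>i\<le>N. u i \<in> P \<and> v i \<in> P \<and> norm (u i) \<le> R \<and> norm (v i) \<le> R \<and> dist (u i) (v i) \<le> m) \<and>
     (\<forall>i<N. dist (v i) (u (Suc i)) \<le> m) \<and>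
     (\<forall>j<N. \<forall>i\<le>j. dist (v i) (u (Suc i)) \<le> dist (v j) (u (Suc j))) \<and>
     (\<forall>i\<le>N. \<forall>j\<le>N. i \<noteq> j \<longrightarrow> {u i, v i} \<inter> {u j, v j} = {})"

definition good_scale ::
    "'a::euclidean_space set \<Rightarrow> 'a set set \<Rightarrow> real \<Rightarrow> real \<Rightarrow> real \<Rightarrow> nat \<Rightarrow> bool" where
  "good_scale P \<S> r m R N \<longleftrightarrow>
     r \<le> m \<and> 0 < m \<and> r + 2 * m * (N + 2) \<le> R \<and> (\<nexists>u v. increasing_chain P m R N u v) \<and>
     (\<forall>x. norm x \<le> R \<longrightarrow> (\<exists>S\<in>\<S>. \<exists>T\<in>\<S>. S \<noteq> T \<and> S \<subseteq> ball x m \<and> T \<subseteq> ball x m))"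

locale scaled_clusters = nearest_clusters +
  fixes P :: "'a set"
  assumes sub: "S \<in> \<S> \<Longrightarrow> S \<subseteq> P"
    and fin: "\<And>R. finite (P \<inter> cball 0 R)"
    and scales: "\<And>r. \<exists>m R N. good_scale P \<S> r m R N"
begin

lemma no_long_chain:
  assumes g: "good_scale P \<S> r m R N"
    and T: "\<And>i. i \<le> Suc N \<Longrightarrow> T i \<in> \<S>" and nx: "\<And>i. i \<le> N \<Longrightarrow> \<sigma> (T (Suc i)) = T i"
    and dist: "\<And>i j. i \<le> Suc N \<Longrightarrow> j \<le> Suc N \<Longrightarrow> i \<noteq> j \<Longrightarrow> T i \<noteq> T j"
    and gp: "\<And>i. i \<le> N \<Longrightarrow> gap (T (Suc i)) \<le> m"
    and nrm: "\<And>i x. i \<le> N \<Longrightarrow> x \<in> T i \<Longrightarrow> norm x \<le> R"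
  shows False
proof -
  define u v where "u = (\<lambda>i. ex (T i))" and "v = (\<lambda>i. tg (T (Suc i)))"
  have uT: "u i \<in> T i" if "i \<le> N" for i using that T ex_in by (simp add: u_def)
  have vT: "v i \<in> T i" if "i \<le> N" for i using that T[of "Suc i"] tg_in nx[of i] by (auto simp: v_def)
  have d: "dist (v i) (u (Suc i)) = gap (T (Suc i))" for i
    by (simp add: u_def v_def gap_def dist_commute)
  have step: "gap (T i) \<le> gap (T (Suc i))" if "i \<le> N" for i
    using gap_next_le[of "T (Suc i)"] nx[of i] T[of "Suc i"] that by auto
  have mono: "gap (T (Suc i)) \<le> gap (T (Suc j))" if "i \<le> j" "j \<le> N" for i j
    using that
  proof (induction j rule: dec_induct)
    case (step n)
    then show ?case using \<open>\<And>i. i \<le> N \<Longrightarrow> gap (T i) \<le> gap (T (Suc i))\<close>[of "Suc n"] by auto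
  qed simp
  have dm: "gap (T i) \<le> m" if "i \<le> N" for i using step[OF that] gp[OF that] by simp
  have "increasing_chain P m R N u v"
    unfolding increasing_chain_def d
  proof (intro conjI allI impI)
    fix i assume i: "i \<le> N"
    show "u i \<in> P" "v i \<in> P" "norm (u i) \<le> R" "norm (v i) \<le> R"
      using uT[OF i] vT[OF i] sub[OF T[of i]] nrm[OF i] i by auto
    show "dist (u i) (v i) \<le> m"
      using diam[OF T[of i] uT[OF i] vT[OF i]] dm[OF i] i by (auto simp: gap_def)
  next
    fix i j assume "i \<le> N" "j \<le> N" "i \<noteq> j"
    then show "{u i, v i} \<inter> {u j, v j} = {}"
      using disj[OF T[of i] T[of j] dist[of i j]] uT[of i] vT[of i] uT[of j] vT[of j] by auto
  qed (use gp mono in auto)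
  then show False using g by (auto simp: good_scale_def)
qed

lemma reach_two_cycle:
  assumes S: "S \<in> \<S>"
  shows "\<exists>n. \<sigma> (\<sigma> ((\<sigma> ^^ n) S)) = (\<sigma> ^^ n) S"
proof (rule ccontr)
  assume neg: "\<not> ?thesis"
  define U where "U = (\<lambda>n. (\<sigma> ^^ n) S)"
  have U: "U n \<in> \<S>" for n by (simp add: U_def funpow_next_in S)
  have US: "U (Suc n) = \<sigma> (U n)" for n by (simp add: U_def)
  have dec: "gap (U (Suc n)) < gap (U n)" for n
    using gap_next_le[OF U[of n]] mutual(3)[OF U[of n]] neg by (fastforce simp: U_def)
  then have lt: "gap (U j) < gap (U i)" if "i < j" for i j
    using that by (rule lift_Suc_mono_less[of "\<lambda>i. - gap (U i)", simplified])
  obtain m R N where g: "good_scale P \<S> (max (norm (ex S)) (gap S)) m R N" using scales by blast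
  then have m: "norm (ex S) \<le> m" "gap S \<le> m" "max (norm (ex S)) (gap S) + 2 * m * (N + 2) \<le> R" "m > 0"
    by (auto simp: good_scale_def)
  have gm: "gap (U n) \<le> m" for n
    using lt[of 0 n] m by (cases n) (auto simp: U_def)
  have nrm: "norm x \<le> norm (ex S) + 2 * m * n + m" if "x \<in> U n" for x n
    using that
  proof (induction n arbitrary: x)
    case 0
    then show ?case using diam[OF S, of x "ex S"] ex_in[OF S] m norm_triangle_ineq2[of x "ex S"]
      by (auto simp: U_def gap_def dist_norm)
  next
    case (Suc n)
    have "norm (ex (U n)) \<le> norm (ex S) + 2 * m * n + m" using Suc.IH ex_in[OF U] by auto
    moreover have "dist (ex (U n)) (tg (U n)) \<le> m" using gm[of n] by (simp add: gap_def)
    moreover have "dist (tg (U n)) x \<le> m"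
      using diam[OF U[of "Suc n"], of "tg (U n)" x] gm[of "Suc n"] tg_in[OF U[of n]] Suc.prems
      by (auto simp: US gap_def)
    ultimately have "norm x \<le> norm (ex S) + 2 * m * n + m + m + m" by norm
    then show ?case by (simp add: algebra_simps)
  qed
  show False
  proof (rule no_long_chain[OF g, where T = "\<lambda>i. U (Suc N - i)"])
    show "\<sigma> (U (Suc N - Suc i)) = U (Suc N - i)" if "i \<le> N" for i
      using that US[of "N - i"] by (simp add: Suc_diff_le)
    show "U (Suc N - i) \<noteq> U (Suc N - j)" if "i \<le> Suc N" "j \<le> Suc N" "i \<noteq> j" for i j
      using lt[of "Suc N - i" "Suc N - j"] lt[of "Suc N - j" "Suc N - i"] that
      by (metis diff_diff_cancel less_irrefl linorder_neqE_nat)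
    show "norm x \<le> R" if "i \<le> N" "x \<in> U (Suc N - i)" for i x
    proof -
      have "2 * m * (Suc N - i) \<le> 2 * m * (Suc N)" using m(4) by (intro mult_left_mono) auto
      moreover have "norm (ex S) \<le> max (norm (ex S)) (gap S)" by simp
      ultimately show ?thesis using nrm[OF that(2)] m(3,4) by (simp add: algebra_simps)
    qed
  qed (use U gm in auto)
qed

text \<open>
  If the gap of \<open>T\<close> exceeded \<open>m\<close>, the ball of radius \<open>m\<close> that touches the target of \<open>T\<close> and points
  towards its exit point would contain no cluster other than \<open>T\<close>.
\<close>

lemma gap_bound_near:
  assumes g: "good_scale P \<S> r m R N" and T: "T \<in> \<S>" and n: "norm (tg T) + m \<le> R"
  shows "gap T \<le> m"
proof (rule ccontr)
  assume "\<not> gap T \<le> m"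
  then have gm: "m < gap T" by simp
  have m: "m > 0" using g by (simp add: good_scale_def)
  define c where "c = tg T + (m / gap T) *\<^sub>R (ex T - tg T)"
  have nT: "norm (ex T - tg T) = gap T" by (simp add: gap_def dist_norm)
  have "norm (c - tg T) = m" using m gm by (simp add: c_def nT)
  then have "norm c \<le> R" using n norm_triangle_ineq2[of c "tg T"] by simp
  then obtain S S' where S: "S \<in> \<S>" "S' \<in> \<S>" "S \<noteq> S'" "S \<subseteq> ball c m" "S' \<subseteq> ball c m"
    using g unfolding good_scale_def by blast
  then obtain U where U: "U \<in> \<S>" "U \<noteq> T" "U \<subseteq> ball c m" by metis
  have "ex U \<in> ball c m" using U(3) ex_in[OF U(1)] by blast
  then have 1: "dist c (ex U) < m" by simp
  have "ex T - c = (1 - m / gap T) *\<^sub>R (ex T - tg T)"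
    by (simp add: c_def algebra_simps)
  then have "norm (ex T - c) = (1 - m / gap T) * gap T" using m gm by (simp add: nT)
  also have "\<dots> = gap T - m" using m gm by (simp add: field_simps)
  finally have "dist (ex T) c = gap T - m" by (simp add: dist_norm)
  then have "dist (ex T) (ex U) < gap T" using 1 dist_triangle[of "ex T" "ex U" c] by simp
  moreover have "gap T \<le> dist (ex T) (ex U)"
    using gap_le[OF T U(1) U(2) ex_in[OF T] ex_in[OF U(1)]] .
  ultimately show False by simp
qed

lemma finite_class:
  assumes S: "S \<in> \<S>"
  shows "finite {T \<in> \<S>. \<exists>a b. (\<sigma> ^^ a) S = (\<sigma> ^^ b) T}"
proof -
  obtain n where n: "\<sigma> (\<sigma> ((\<sigma> ^^ n) S)) = (\<sigma> ^^ n) S" using reach_two_cycle[OF S] by blast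
  define A where "A = (\<sigma> ^^ n) S"
  have A: "A \<in> \<S>" "\<sigma> (\<sigma> A) = A" using n by (auto simp: A_def funpow_next_in S)
  define r where "r = max (norm (ex A) + gap A) (norm (ex (\<sigma> A)) + gap (\<sigma> A))"
  obtain m R N where g: "good_scale P \<S> r m R N" using scales by blast
  then have m: "r \<le> m" "m > 0" "r + 2 * m * (N + 2) \<le> R" by (auto simp: good_scale_def)
  have r: "norm x \<le> r" if "x \<in> B" "B \<in> {A, \<sigma> A}" for x B
  proof -
    have B: "B \<in> \<S>" using that A next_in by auto
    have "norm x \<le> norm (ex B) + gap B"
      using diam[OF B, of x "ex B"] that ex_in[OF B] norm_triangle_ineq2[of x "ex B"]
      by (auto simp: gap_def dist_norm)
    also have "\<dots> \<le> r" using that by (auto simp: r_def)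
    finally show ?thesis .
  qed
  have "T \<subseteq> P \<inter> cball 0 R" if T: "T \<in> \<S>" and ab: "(\<sigma> ^^ a) S = (\<sigma> ^^ b) T" for T a b
  proof -
    have "(\<sigma> ^^ a) A = (\<sigma> ^^ (n + b)) T"
      using arg_cong[OF ab, of "\<sigma> ^^ n"] by (simp add: A_def funpow_funpow add.commute)
    then have "\<exists>k. (\<sigma> ^^ k) T \<in> {A, \<sigma> A}"
      using funpow_two_cycle(1)[of \<sigma> A a, OF A(2)] by metis
    then obtain k where k: "(\<sigma> ^^ k) T \<in> {A, \<sigma> A}" and kmin: "\<And>j. j < k \<Longrightarrow> (\<sigma> ^^ j) T \<notin> {A, \<sigma> A}"
      using exists_least_iff[of "\<lambda>k. (\<sigma> ^^ k) T \<in> {A, \<sigma> A}"] by blast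
    define U where "U = (\<lambda>i. (\<sigma> ^^ (k - i)) T)"
    have U: "U i \<in> \<S>" for i by (simp add: U_def funpow_next_in T)
    have US: "\<sigma> (U (Suc i)) = U i" if "i < k" for i
    proof -
      have "k - i = Suc (k - Suc i)" using that by simp
      then show ?thesis by (simp add: U_def)
    qed
    have bd: "(\<forall>x\<in>U i. norm x \<le> r + 2 * m * i) \<and> (i > 0 \<longrightarrow> gap (U i) \<le> m)" if "i \<le> k" "i \<le> Suc N" for i
      using that
    proof (induction i)
      case 0
      then show ?case using r[of _ "U 0"] k by (auto simp: U_def)
    next
      case (Suc i)
      have t: "tg (U (Suc i)) \<in> U i" using tg_in[OF U[of "Suc i"]] US[of i] Suc.prems by simp
      then have nt: "norm (tg (U (Suc i))) \<le> r + 2 * m * i" using Suc by auto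
      have "2 * m * i \<le> 2 * m * N" using m Suc.prems by (intro mult_left_mono) auto
      moreover have "2 * m * (N + 2) = 2 * m * N + 4 * m" by (simp add: algebra_simps)
      ultimately have "norm (tg (U (Suc i))) + m \<le> R" using m nt by linarith
      then have gp: "gap (U (Suc i)) \<le> m" by (rule gap_bound_near[OF g U])
      have "norm x \<le> r + 2 * m * i + m + m" if x: "x \<in> U (Suc i)" for x
      proof -
        have "dist x (ex (U (Suc i))) \<le> m"
          using diam[OF U x ex_in[OF U]] gp by (simp add: gap_def)
        moreover have "dist (ex (U (Suc i))) (tg (U (Suc i))) \<le> m" using gp by (simp add: gap_def)
        ultimately show ?thesis using nt by norm
      qed
      then show ?case using gp by (auto simp: algebra_simps)
    qed
    have in_R: "norm x \<le> R" if "i \<le> k" "i \<le> Suc N" "x \<in> U i" for x i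
    proof -
      have "2 * m * i \<le> 2 * m * Suc N" using m that by (intro mult_left_mono) auto
      moreover have "2 * m * (N + 2) = 2 * m * Suc N + 2 * m" by (simp add: algebra_simps)
      moreover have "norm x \<le> r + 2 * m * i" using bd[OF that(1,2)] that(3) by blast
      ultimately show ?thesis using m by linarith
    qed
    have inj: "U i \<noteq> U j" if "i < j" "j \<le> k" for i j
    proof
      assume e: "U i = U j"
      have k_eq: "(\<sigma> ^^ i) (U i) = U 0" if "i \<le> k" for i
        using that by (simp add: U_def funpow_funpow)
      have "(\<sigma> ^^ i) (U j) = (\<sigma> ^^ (k - (j - i))) T"
        using that by (simp add: U_def funpow_funpow add.commute)
      moreover have "(\<sigma> ^^ i) (U j) = U 0" using k_eq[of i] e that by simp
      moreover have "k - (j - i) < k" using that by simp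
      ultimately show False using k kmin[of "k - (j - i)"] by (simp add: U_def del: diff_diff_right)
    qed
    have "k \<le> N"
    proof (rule ccontr)
      assume kN: "\<not> k \<le> N"
      show False
      proof (rule no_long_chain[OF g, of U])
        show "U i \<noteq> U j" if "i \<le> Suc N" "j \<le> Suc N" "i \<noteq> j" for i j
          using inj[of i j] inj[of j i] that kN by (cases "i < j") auto
        show "gap (U (Suc i)) \<le> m" if "i \<le> N" for i using bd[of "Suc i"] that kN by auto
        show "norm x \<le> R" if "i \<le> N" "x \<in> U i" for i x using in_R[of i x] that kN by auto
        show "\<sigma> (U (Suc i)) = U i" if "i \<le> N" for i using US[of i] that kN by auto
      qed (rule U)
    qed
    then show ?thesis using in_R[of k] sub[OF T] by (auto simp: U_def)
  qed
  then have "{T \<in> \<S>. \<exists>a b. (\<sigma> ^^ a) S = (\<sigma> ^^ b) T} \<subseteq> Pow (P \<inter> cball 0 R)" by blast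
  then show ?thesis using fin[of R] by (meson finite_Pow_iff finite_subset)
qed

end

section \<open>One step of the construction\<close>

text \<open>
  Fixed points are allowed here, so that the identity has the singletons as clusters and the
  nearest-neighbour map becomes the rewiring of the identity, on a par with all later levels.
\<close>

definition clusters :: "'a set \<Rightarrow> ('a \<Rightarrow> 'a) \<Rightarrow> 'a set set" where
  "clusters P f = {{a, f a} | a. a \<in> P \<and> f (f a) = a}"

definition exit_of :: "'a::metric_space set set \<Rightarrow> 'a \<Rightarrow> 'a \<Rightarrow> bool" where
  "exit_of \<S> x x' \<longleftrightarrow> (\<exists>S\<in>\<S>. x \<in> S \<and> (\<exists>T\<in>\<S>. T \<noteq> S \<and> x' \<in> T) \<and>
     (\<forall>T\<in>\<S>. T \<noteq> S \<longrightarrow> (\<forall>u\<in>S. \<forall>v\<in>T. (u, v) \<noteq> (x, x') \<longrightarrow> dist x x' < dist u v)))"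

definition rewire :: "'a::metric_space set set \<Rightarrow> ('a \<Rightarrow> 'a) \<Rightarrow> 'a \<Rightarrow> 'a" where
  "rewire \<S> f y = (if \<exists>y'. exit_of \<S> y y' then THE y'. exit_of \<S> y y' else f y)"

definition tame :: "'a::metric_space set \<Rightarrow> ('a \<Rightarrow> 'a) \<Rightarrow> bool" where
  "tame P f \<longleftrightarrow> (\<forall>x\<in>P. f x \<in> P) \<and> reaches_two_cycles P f \<and> (\<forall>x\<in>P. finite (foil P f x)) \<and>
     (\<forall>S\<in>clusters P f. \<forall>T\<in>clusters P f. S \<noteq> T \<longrightarrow>
        (\<forall>a\<in>S. \<forall>b\<in>S. \<forall>u\<in>S. \<forall>v\<in>T. dist a b < dist u v))"

definition no_ties :: "'a::metric_space set \<Rightarrow> bool" where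
  "no_ties P \<longleftrightarrow> (\<forall>u\<in>P. \<forall>v\<in>P. \<forall>x\<in>P. \<forall>y\<in>P. u \<noteq> v \<and> dist u v = dist x y \<longrightarrow> {u, v} = {x, y})"

lemma clusters_member:
  assumes "S \<in> clusters P f" "x \<in> S"
  shows "f (f x) = x" "S = {x, f x}"
proof -
  obtain a where a: "f (f a) = a" "S = {a, f a}" using assms(1) by (auto simp: clusters_def)
  then show "S = {x, f x}" using two_cycle_eq[of f a x] assms(2) by simp
  show "f (f x) = x" using a assms(2) by (metis insertE singletonD)
qed

lemma clusters_disjoint:
  assumes "S \<in> clusters P f" "T \<in> clusters P f" "S \<noteq> T"
  shows "S \<inter> T = {}"
proof (rule ccontr)
  assume "S \<inter> T \<noteq> {}"
  then obtain x where "x \<in> S" "x \<in> T" by blast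
  then show False using clusters_member(2)[OF assms(1)] clusters_member(2)[OF assms(2)] assms(3) by metis
qed

locale rewiring =
  fixes P :: "'a::euclidean_space set" and f :: "'a \<Rightarrow> 'a"
  assumes tame: "tame P f" and no_ties: "no_ties P" and finP: "\<And>R. finite (P \<inter> cball 0 R)"
    and scalesP: "\<And>r. \<exists>m R N. good_scale P (clusters P f) r m R N"
begin

abbreviation "\<S> \<equiv> clusters P f"

lemma closed: "x \<in> P \<Longrightarrow> f x \<in> P" using tame by (simp add: tame_def)

lemma cluster_sub: "S \<in> \<S> \<Longrightarrow> S \<subseteq> P" using closed by (auto simp: clusters_def)

lemma exit_exists:
  assumes S: "S \<in> \<S>"
  shows "\<exists>x\<in>S. \<exists>x'. exit_of \<S> x x'"
proof -
  obtain m R N where g: "good_scale P \<S> 0 m R N" using scalesP by blast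
  then have "norm (0::'a) \<le> R" by (auto simp: good_scale_def intro: order_trans[rotated])
  then obtain T1 T2 where "T1 \<in> \<S>" "T2 \<in> \<S>" "T1 \<noteq> T2" using g unfolding good_scale_def by blast
  then obtain T0 where T0: "T0 \<in> \<S>" "T0 \<noteq> S" by metis
  obtain u0 v0 where uv0: "u0 \<in> S" "v0 \<in> T0" using S T0 by (auto simp: clusters_def)
  define D where "D = {(u, v). u \<in> S \<and> v \<in> \<Union>(\<S> - {S}) \<and> dist u v \<le> dist u0 v0}"
  have finS: "finite S" using S by (auto simp: clusters_def)
  have "finite (P \<inter> cball u d)" for u d
    by (rule finite_subset[OF _ finP[of "norm u + d"]]) (auto simp: dist_norm, norm)
  then have "finite (S \<times> (\<Union>u\<in>S. P \<inter> cball u (dist u0 v0)))" using finS by blast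
  moreover have "D \<subseteq> S \<times> (\<Union>u\<in>S. P \<inter> cball u (dist u0 v0))"
    using cluster_sub by (fastforce simp: D_def)
  ultimately have finD: "finite D" by (rule rev_finite_subset)
  have neD: "D \<noteq> {}" using uv0 T0 by (auto simp: D_def)
  obtain p where p: "p \<in> D" "\<And>q. q \<in> D \<Longrightarrow> dist (fst p) (snd p) \<le> dist (fst q) (snd q)"
    using arg_min_if_finite[OF finD neD, of "\<lambda>q. dist (fst q) (snd q)"]
    by (metis (no_types, lifting) linorder_not_le)
  obtain x x' where pp: "p = (x, x')" by (cases p)
  have x: "x \<in> S" using p pp by (auto simp: D_def)
  obtain T where T: "T \<in> \<S>" "T \<noteq> S" "x' \<in> T" using p pp by (auto simp: D_def)
  have min: "dist x x' \<le> dist u v" if "u \<in> S" "v \<in> T'" "T' \<in> \<S>" "T' \<noteq> S" for u v T'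
  proof (cases "dist u v \<le> dist u0 v0")
    case True
    then have "(u, v) \<in> D" using that by (auto simp: D_def)
    then show ?thesis using p(2) pp by fastforce
  next
    case False
    then show ?thesis using p(1) pp by (auto simp: D_def)
  qed
  have "dist x x' < dist u v"
    if uv: "u \<in> S" "v \<in> T'" "T' \<in> \<S>" "T' \<noteq> S" "(u, v) \<noteq> (x, x')" for u v T'
  proof (rule ccontr)
    assume "\<not> dist x x' < dist u v"
    then have e: "dist u v = dist x x'" using min[OF uv(1-4)] by simp
    have "S \<inter> T' = {}" using clusters_disjoint[OF S uv(3)] uv(4) by blast
    then have nuv: "u \<noteq> v" "x \<noteq> v" using uv x by auto
    have "u \<in> P" "v \<in> P" "x \<in> P" "x' \<in> P" using cluster_sub uv x T S by blast+
    then have "{u, v} = {x, x'}" using no_ties e nuv(1) unfolding no_ties_def by blast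
    then show False using uv(5) nuv by (auto simp: doubleton_eq_iff)
  qed
  then show ?thesis unfolding exit_of_def using S x T by blast
qed

lemma exit_ofD:
  assumes "exit_of \<S> x x'" "S \<in> \<S>" "x \<in> S"
  shows "\<exists>T\<in>\<S>. T \<noteq> S \<and> x' \<in> T"
    "T \<in> \<S> \<Longrightarrow> T \<noteq> S \<Longrightarrow> u \<in> S \<Longrightarrow> v \<in> T \<Longrightarrow> (u, v) \<noteq> (x, x') \<Longrightarrow> dist x x' < dist u v"
proof -
  obtain S' where S': "S' \<in> \<S>" "x \<in> S'" "\<exists>T\<in>\<S>. T \<noteq> S' \<and> x' \<in> T"
    "\<forall>T\<in>\<S>. T \<noteq> S' \<longrightarrow> (\<forall>u\<in>S'. \<forall>v\<in>T. (u, v) \<noteq> (x, x') \<longrightarrow> dist x x' < dist u v)"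
    using assms(1) unfolding exit_of_def by blast
  then have "S' = S" using clusters_disjoint[of S' P f S] assms by blast
  then show "\<exists>T\<in>\<S>. T \<noteq> S \<and> x' \<in> T"
    "T \<in> \<S> \<Longrightarrow> T \<noteq> S \<Longrightarrow> u \<in> S \<Longrightarrow> v \<in> T \<Longrightarrow> (u, v) \<noteq> (x, x') \<Longrightarrow> dist x x' < dist u v"
    using S' by blast+
qed

lemma exit_unique:
  assumes "exit_of \<S> x x'" "exit_of \<S> y y'" "S \<in> \<S>" "x \<in> S" "y \<in> S"
  shows "x = y \<and> x' = y'"
proof (rule ccontr)
  assume "\<not> ?thesis"
  then have ne: "(y, y') \<noteq> (x, x')" "(x, x') \<noteq> (y, y')" by auto
  obtain T where "T \<in> \<S>" "T \<noteq> S" "x' \<in> T" using exit_ofD(1)[OF assms(1,3,4)] by blast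
  then have "dist y y' < dist x x'" using exit_ofD(2)[OF assms(2,3,5) _ _ assms(4) _ ne(2)] by blast
  moreover obtain T where "T \<in> \<S>" "T \<noteq> S" "y' \<in> T" using exit_ofD(1)[OF assms(2,3,5)] by blast
  then have "dist x x' < dist y y'" using exit_ofD(2)[OF assms(1,3,4) _ _ assms(5) _ ne(1)] by blast
  ultimately show False by simp
qed

definition exit_pair :: "'a set \<Rightarrow> 'a \<times> 'a" where
  "exit_pair S = (SOME p. fst p \<in> S \<and> exit_of \<S> (fst p) (snd p))"
definition ex :: "'a set \<Rightarrow> 'a" where "ex S = fst (exit_pair S)"
definition tg :: "'a set \<Rightarrow> 'a" where "tg S = snd (exit_pair S)"
definition next_cluster :: "'a set \<Rightarrow> 'a set" where
  "next_cluster S = (SOME T. T \<in> \<S> \<and> T \<noteq> S \<and> tg S \<in> T)"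

lemma ex_tg: "S \<in> \<S> \<Longrightarrow> ex S \<in> S \<and> exit_of \<S> (ex S) (tg S)"
proof -
  assume "S \<in> \<S>"
  then have "\<exists>p. fst p \<in> S \<and> exit_of \<S> (fst p) (snd p)" using exit_exists by fastforce
  from someI_ex[OF this] show ?thesis unfolding ex_def tg_def exit_pair_def .
qed

lemma next_cluster: "S \<in> \<S> \<Longrightarrow> next_cluster S \<in> \<S> \<and> next_cluster S \<noteq> S \<and> tg S \<in> next_cluster S"
proof -
  assume S: "S \<in> \<S>"
  then have "\<exists>T. T \<in> \<S> \<and> T \<noteq> S \<and> tg S \<in> T" using exit_ofD(1)[of "ex S" "tg S" S] ex_tg[OF S] by blast
  from someI_ex[OF this] show ?thesis unfolding next_cluster_def .
qed

sublocale scaled_clusters \<S> next_cluster ex tg P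
proof
  fix S u v assume S: "S \<in> \<S>" "u \<in> S" "v \<in> S"
  then show "dist u v < dist (ex S) (tg S)"
    using tame next_cluster[OF S(1)] ex_tg[OF S(1)] unfolding tame_def by metis
next
  fix S T u v assume "S \<in> \<S>" "T \<in> \<S>" "T \<noteq> S" "u \<in> S" "v \<in> T" "(u, v) \<noteq> (ex S, tg S)"
  then show "dist (ex S) (tg S) < dist u v" using exit_ofD(2)[of "ex S" "tg S" S T u v] ex_tg[of S] by blast
qed (simp_all add: clusters_disjoint ex_tg next_cluster cluster_sub finP scalesP)

abbreviation "g \<equiv> rewire \<S> f"

lemma exit_of_ex:
  assumes "exit_of \<S> y y'"
  shows "\<exists>S\<in>\<S>. y = ex S \<and> y' = tg S"
proof -
  obtain S where "S \<in> \<S>" "y \<in> S" using assms by (auto simp: exit_of_def)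
  then show ?thesis using exit_unique[OF assms] ex_tg by blast
qed

lemma rewire_ex: "S \<in> \<S> \<Longrightarrow> g (ex S) = tg S"
proof -
  assume S: "S \<in> \<S>"
  have "(THE y'. exit_of \<S> (ex S) y') = tg S"
    using ex_tg[OF S] exit_unique[OF _ _ S] by blast
  then show ?thesis using ex_tg[OF S] unfolding rewire_def by auto
qed

lemma rewire_other: "(\<And>S. S \<in> \<S> \<Longrightarrow> y \<noteq> ex S) \<Longrightarrow> g y = f y"
  using exit_of_ex[of y] by (auto simp: rewire_def)

lemma rewire_closed: "y \<in> P \<Longrightarrow> g y \<in> P"
  using closed rewire_other[of y] rewire_ex next_cluster cluster_sub by (cases "\<exists>S\<in>\<S>. y = ex S") (metis subsetD)+

lemma cluster_closed: "S \<in> \<S> \<Longrightarrow> x \<in> S \<Longrightarrow> (f ^^ n) x \<in> S"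
proof -
  assume S: "S \<in> \<S>" "x \<in> S"
  show ?thesis
    unfolding clusters_member(2)[OF S]
    by (rule funpow_two_cycle(1)[of f x n, OF clusters_member(1)[OF S]])
qed

definition home :: "'a \<Rightarrow> 'a set" where "home y = (THE S. S \<in> \<S> \<and> (\<exists>n. (f ^^ n) y \<in> S))"

lemma home_eq:
  assumes "S \<in> \<S>" "(f ^^ n) y \<in> S"
  shows "home y = S"
  unfolding home_def
proof (rule the_equality)
  fix T assume "T \<in> \<S> \<and> (\<exists>n. (f ^^ n) y \<in> T)"
  then obtain k where T: "T \<in> \<S>" "(f ^^ k) y \<in> T" by blast
  have "(f ^^ (k + n)) y \<in> S" using cluster_closed[OF assms, of k] by (simp add: funpow_funpow)
  moreover have "(f ^^ (k + n)) y \<in> T"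
    using cluster_closed[OF T, of n] by (simp add: funpow_funpow add.commute)
  ultimately show "T = S" using clusters_disjoint[OF T(1) assms(1)] by blast
qed (use assms in blast)

lemma home:
  assumes "y \<in> P"
  shows "home y \<in> \<S>" "\<exists>n. (f ^^ n) y \<in> home y"
proof -
  obtain n where n: "f (f ((f ^^ n) y)) = (f ^^ n) y"
    using tame assms by (auto simp: tame_def reaches_two_cycles_def)
  define S where "S = {(f ^^ n) y, f ((f ^^ n) y)}"
  have S: "S \<in> \<S>" using n funpow_closed[of P f y n] closed assms by (auto simp: clusters_def S_def)
  have "home y = S" by (rule home_eq[OF S, of n]) (simp add: S_def)
  then show "home y \<in> \<S>" "\<exists>n. (f ^^ n) y \<in> home y" using S by (auto simp: S_def)
qed

lemma home_member: "S \<in> \<S> \<Longrightarrow> y \<in> S \<Longrightarrow> home y = S"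
  using home_eq[of S 0 y] by simp

lemma home_f: "y \<in> P \<Longrightarrow> home (f y) = home y"
proof -
  assume y: "y \<in> P"
  then obtain n where n: "(f ^^ n) y \<in> home y" using home by blast
  have "(f ^^ n) (f y) = (f ^^ 1) ((f ^^ n) y)" by (simp add: funpow_swap1)
  then show ?thesis using home_eq[OF home(1)[OF y], of n] cluster_closed[OF home(1)[OF y] n, of 1] by simp
qed

lemma home_rewire: "y \<in> P \<Longrightarrow> home (g y) \<in> {home y, next_cluster (home y)}"
proof -
  assume y: "y \<in> P"
  show ?thesis
  proof (cases "\<exists>S\<in>\<S>. y = ex S")
    case True
    then obtain S where S: "S \<in> \<S>" "y = ex S" by blast
    have "home y = S" using home_member[OF S(1)] ex_tg[OF S(1)] S(2) by blast
    moreover have "home (g y) = next_cluster S"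
      unfolding S(2) rewire_ex[OF S(1)] using home_member next_cluster[OF S(1)] by blast
    ultimately show ?thesis by simp
  next
    case False
    then show ?thesis using rewire_other[of y] home_f[OF y] by auto
  qed
qed

lemma home_rewire_funpow: "y \<in> P \<Longrightarrow> \<exists>i. home ((g ^^ n) y) = (next_cluster ^^ i) (home y)"
proof (induction n)
  case 0
  have "home ((g ^^ 0) y) = (next_cluster ^^ 0) (home y)" by simp
  then show ?case by blast
next
  case (Suc n)
  then obtain i where i: "home ((g ^^ n) y) = (next_cluster ^^ i) (home y)" by blast
  have "home ((g ^^ Suc n) y) = (next_cluster ^^ i) (home y) \<or>
      home ((g ^^ Suc n) y) = (next_cluster ^^ Suc i) (home y)"
    using home_rewire[OF funpow_closed[of P g, OF rewire_closed Suc.prems], of n] i by auto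
  then show ?case by blast
qed

lemma finite_foil_rewire:
  assumes x: "x \<in> P"
  shows "finite (foil P g x)"
proof -
  let ?C = "{T \<in> \<S>. \<exists>a b. (next_cluster ^^ a) (home x) = (next_cluster ^^ b) T}"
  have "foil P g x \<subseteq> (\<Union>S\<in>?C. foil P f (ex S))"
  proof
    fix y assume "y \<in> foil P g x"
    then obtain a b where y: "y \<in> P" and ab: "(g ^^ a) x = (g ^^ b) y" by (auto simp: foil_def)
    obtain i j where "home ((g ^^ a) x) = (next_cluster ^^ i) (home x)"
      "home ((g ^^ b) y) = (next_cluster ^^ j) (home y)"
      using home_rewire_funpow[OF x] home_rewire_funpow[OF y] by blast
    then have "(next_cluster ^^ i) (home x) = (next_cluster ^^ j) (home y)" using ab by simp
    then have 1: "home y \<in> ?C" using home[OF y] by blast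
    obtain n where n: "(f ^^ n) y \<in> home y" using home[OF y] by blast
    have "home y = {ex (home y), f (ex (home y))}"
      using clusters_member(2)[OF home(1)[OF y], of "ex (home y)"] ex_in home[OF y] by blast
    then have "(f ^^ n) y = (f ^^ 0) (ex (home y)) \<or> (f ^^ n) y = (f ^^ 1) (ex (home y))"
      using n by auto
    then obtain a where "(f ^^ a) (ex (home y)) = (f ^^ n) y" by metis
    then have "y \<in> foil P f (ex (home y))" unfolding foil_def using y by blast
    then show "y \<in> (\<Union>S\<in>?C. foil P f (ex S))" using 1 by blast
  qed
  moreover have "finite (foil P f (ex S))" if "S \<in> ?C" for S
    using that tame ex_in[of S] cluster_sub[of S] by (auto simp: tame_def)
  ultimately show ?thesis
    using finite_class[OF home(1)[OF x]] by (meson finite_UN_I finite_subset)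
qed

lemma reach_ex:
  assumes y: "y \<in> P"
  shows "\<exists>n. (g ^^ n) y = ex (home y)"
proof -
  obtain n where n: "(f ^^ n) y \<in> home y" and nmin: "\<And>j. j < n \<Longrightarrow> (f ^^ j) y \<notin> home y"
    using exists_least_iff[of "\<lambda>n. (f ^^ n) y \<in> home y"] home(2)[OF y] by blast
  have eq: "(g ^^ j) y = (f ^^ j) y" if "j \<le> n" for j
    using that
  proof (induction j)
    case (Suc j)
    have "(f ^^ j) y \<noteq> ex S" if S: "S \<in> \<S>" for S
    proof
      assume e: "(f ^^ j) y = ex S"
      then have "home y = S" using home_eq[OF S, of j] ex_in[OF S] by simp
      then show False using nmin[of j] Suc.prems e ex_in[OF S] by simp
    qed
    then show ?case using Suc rewire_other by simp
  qed simp
  let ?S = "home y"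
  have S: "?S \<in> \<S>" using home[OF y] by blast
  have SS: "?S = {ex ?S, f (ex ?S)}" "f (f (ex ?S)) = ex ?S"
    using clusters_member[OF S ex_in[OF S]] by auto
  show ?thesis
  proof (cases "(f ^^ n) y = ex ?S")
    case True
    then show ?thesis using eq[of n] by auto
  next
    case False
    have "(f ^^ n) y \<in> {ex ?S, f (ex ?S)}" using SS(1) n by simp
    with False have fn: "(f ^^ n) y = f (ex ?S)" by simp
    have "f (ex ?S) \<noteq> ex T" if T: "T \<in> \<S>" for T
    proof
      assume e: "f (ex ?S) = ex T"
      then have "ex T \<in> ?S" using cluster_closed[OF S ex_in[OF S], of 1] by simp
      then have "T = ?S" using ex_in[OF T] disj[OF T S] by blast
      then show False using False fn e by simp
    qed
    then have "(g ^^ Suc n) y = ex ?S" using eq[of n] fn rewire_other SS(2) by simp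
    then show ?thesis by blast
  qed
qed

lemma reach_ex_next: "S \<in> \<S> \<Longrightarrow> \<exists>n. (g ^^ n) (ex S) = ex ((next_cluster ^^ k) S)"
proof (induction k)
  case 0
  have "(g ^^ 0) (ex S) = ex ((next_cluster ^^ 0) S)" by simp
  then show ?case by blast
next
  case (Suc k)
  define T where "T = (next_cluster ^^ k) S"
  have T: "T \<in> \<S>" using Suc funpow_next_in by (simp add: T_def)
  obtain n where n: "(g ^^ n) (ex S) = ex T" using Suc by (auto simp: T_def)
  have "tg T \<in> P" using T next_cluster[OF T] cluster_sub by blast
  moreover have "home (tg T) = next_cluster T" using home_member next_cluster[OF T] by blast
  ultimately obtain j where j: "(g ^^ j) (tg T) = ex (next_cluster T)" using reach_ex by metis
  have "(g ^^ (j + (1 + n))) (ex S) = (g ^^ j) ((g ^^ 1) ((g ^^ n) (ex S)))" by (simp only: funpow_funpow)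
  also have "\<dots> = ex (next_cluster T)" using n j rewire_ex[OF T] by simp
  finally have "(g ^^ (j + (1 + n))) (ex S) = ex (next_cluster T)" .
  moreover have "next_cluster T = (next_cluster ^^ Suc k) S" by (simp add: T_def)
  ultimately show ?case by metis
qed

lemma reaches_two_cycles_rewire: "reaches_two_cycles P g"
  unfolding reaches_two_cycles_def
proof
  fix x assume x: "x \<in> P"
  define S where "S = home x"
  have S: "S \<in> \<S>" using home x by (simp add: S_def)
  obtain a where a: "(g ^^ a) x = ex S" using reach_ex[OF x] by (auto simp: S_def)
  obtain k where k: "next_cluster (next_cluster ((next_cluster ^^ k) S)) = (next_cluster ^^ k) S"
    using reach_two_cycle[OF S] by blast
  define A where "A = (next_cluster ^^ k) S"
  have A: "A \<in> \<S>" using funpow_next_in[OF S] by (simp add: A_def)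
  obtain b where b: "(g ^^ b) (ex S) = ex A" using reach_ex_next[OF S] by (auto simp: A_def)
  have gp: "gap (next_cluster A) = gap A" using mutual_of_two_cycle[OF A] k by (simp add: A_def)
  have "g (g (ex A)) = ex A"
    using rewire_ex[OF A] mutual[OF A gp] rewire_ex[OF next_in[OF A]] by simp
  moreover have "(g ^^ (b + a)) x = ex A" using a b by (simp add: funpow_add)
  ultimately show "\<exists>n. g (g ((g ^^ n) x)) = (g ^^ n) x" by metis
qed

lemma rewire_two_cycle:
  assumes a: "a \<in> P" "g (g a) = a"
  shows "\<exists>S\<in>\<S>. {a, g a} = {ex S, ex (next_cluster S)} \<and> next_cluster (next_cluster S) = S \<and>
      dist a (g a) = gap S \<and> gap (next_cluster S) = gap S"
proof -
  define S T where "S = home a" and "T = next_cluster S"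
  have S: "S \<in> \<S>" using home a by (simp add: S_def)
  have T: "T \<in> \<S>" "T \<noteq> S" "tg S \<in> T" using next_cluster[OF S] by (auto simp: T_def)
  obtain n where "(g ^^ n) a = ex S" using reach_ex a by (auto simp: S_def)
  then have eS: "ex S \<in> {a, g a}" using funpow_two_cycle(1)[of g a n, OF a(2)] by simp
  have gS2: "{a, g a} = {ex S, g (ex S)}" using two_cycle_eq[of g a "ex S", OF a(2) eS] by simp
  have gS1: "g (g (ex S)) = ex S" using eS a(2) by (elim insertE) simp_all
  note gS = gS1 gS2
  obtain k where "(g ^^ k) (ex S) = ex T" using reach_ex_next[OF S, of 1] by (auto simp: T_def)
  then have "ex T \<in> {ex S, g (ex S)}" using funpow_two_cycle(1)[of g "ex S" k, OF gS(1)] by simp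
  moreover have "ex T \<noteq> ex S" using disj[OF S T(1) T(2)[symmetric]] ex_in[OF S] ex_in[OF T(1)] by (metis disjoint_iff)
  ultimately have eT: "ex T = tg S" using rewire_ex[OF S] by simp
  then have tT: "tg T = ex S" using gS(1) rewire_ex[OF S] rewire_ex[OF T(1)] by simp
  have gp: "gap T = gap S" using eT tT by (simp add: gap_def dist_commute)
  have "next_cluster T = S" using mutual(3)[OF S] gp by (simp add: T_def)
  moreover have "dist a (g a) = gap S"
    using gS(2) rewire_ex[OF S] by (auto simp: gap_def dist_commute doubleton_eq_iff)
  moreover have "{a, g a} = {ex S, ex T}" using gS(2) rewire_ex[OF S] eT by simp
  ultimately have "{a, g a} = {ex S, ex T} \<and> next_cluster T = S \<and> dist a (g a) = gap S \<and> gap T = gap S"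
    using gp by (intro conjI)
  then show ?thesis unfolding T_def by (rule bexI[OF _ S])
qed

lemma rewire_neq: "y \<in> P \<Longrightarrow> g y \<noteq> y"
proof
  assume y: "y \<in> P" "g y = y"
  then obtain S where "S \<in> \<S>" "dist y (g y) = gap S" using rewire_two_cycle[of y] by auto
  then show False using gap_pos[of S] y by simp
qed

lemma tame_rewire: "tame P g"
  unfolding tame_def
proof (intro conjI ballI impI)
  fix X Y p q u v
  assume X: "X \<in> clusters P g" and Y: "Y \<in> clusters P g" and XY: "X \<noteq> Y"
    and pq: "p \<in> X" "q \<in> X" and uv: "u \<in> X" "v \<in> Y"
  obtain a where a: "a \<in> P" "g (g a) = a" "X = {a, g a}" using X by (auto simp: clusters_def)
  obtain b where b: "b \<in> P" "g (g b) = b" "Y = {b, g b}" using Y by (auto simp: clusters_def)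
  obtain S where S: "S \<in> \<S>" "X = {ex S, ex (next_cluster S)}" "next_cluster (next_cluster S) = S"
    "dist a (g a) = gap S" "gap (next_cluster S) = gap S"
    using rewire_two_cycle[OF a(1,2)] a(3) by auto
  obtain T where T: "T \<in> \<S>" "Y = {ex T, ex (next_cluster T)}"
    using rewire_two_cycle[OF b(1,2)] b(3) by auto
  obtain S' where S': "S' \<in> {S, next_cluster S}" "u = ex S'" using uv S by blast
  obtain T' where T': "T' \<in> {T, next_cluster T}" "v = ex T'" using uv T by blast
  have in': "S' \<in> \<S>" "T' \<in> \<S>" using S S' T T' next_in by auto
  have nv: "v \<notin> X" using clusters_disjoint[OF X Y XY] uv(2) by blast
  then have ne: "T' \<noteq> S" "T' \<noteq> next_cluster S" using S(2) T'(2) by auto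
  have T'_ne: "T' \<noteq> S'" using ne S'(1) by fast
  have "next_cluster S' \<in> {S, next_cluster S}" using S' S(3) by auto
  then have "T' \<noteq> next_cluster S'" using ne by fast
  then have "T' \<inter> next_cluster S' = {}" by (rule disj[OF in'(2) next_in[OF in'(1)]])
  then have "v \<noteq> tg S'" using tg_in[OF in'(1)] T'(2) ex_in[OF in'(2)] by (metis disjoint_iff)
  then have "dist (ex S') (tg S') < dist u v"
    using closest[OF in' T'_ne, of u v] S'(2) T'(2) ex_in[OF in'(1)] ex_in[OF in'(2)] by simp
  moreover have "gap S' = gap S" using S'(1) S(5) by (metis insertE singletonD)
  moreover have "dist p q \<le> gap S"
    using pq a(3) S(4) gap_pos[OF S(1)] by (auto simp: dist_commute)
  ultimately show "dist p q < dist u v" by (simp add: gap_def)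
next
  show "reaches_two_cycles P g" by (rule reaches_two_cycles_rewire)
next
  fix x assume "x \<in> P"
  then show "g x \<in> P" by (rule rewire_closed)
next
  fix x assume "x \<in> P"
  then show "finite (foil P g x)" by (rule finite_foil_rewire)
qed

end

section \<open>Isolated patterns and all levels of the construction\<close>

definition axis :: "'a::euclidean_space" where "axis = (SOME b. b \<in> Basis)"

lemma norm_axis [simp]: "norm (axis :: 'a::euclidean_space) = 1"
  unfolding axis_def by (rule norm_Basis, rule some_in_eq[THEN iffD2]) (rule nonempty_Basis)

primrec centers :: "nat \<Rightarrow> 'a::euclidean_space set" where
  "centers 0 = {0}"
| "centers (Suc k) = centers k \<union> (\<lambda>q. q + (3 * 20 ^ k) *\<^sub>R axis) ` centers k"

definition pattern :: "nat \<Rightarrow> 'a::euclidean_space \<Rightarrow> 'a set \<Rightarrow> bool" where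
  "pattern k z P \<longleftrightarrow> (\<forall>q\<in>centers k. card (P \<inter> ball (z + q) 1) = 1) \<and>
     P \<inter> (ball z (20 ^ k) - (\<Union>q\<in>centers k. ball (z + q) 1)) = {}"

lemma finite_centers: "finite (centers k)" by (induction k) auto

lemma zero_in_centers: "0 \<in> centers k" by (induction k) auto

lemma norm_centers: "q \<in> centers k \<Longrightarrow> norm q + 1 \<le> 20 ^ k"
proof (induction k arbitrary: q)
  case (Suc k)
  have p: "(1::real) \<le> 20 ^ k" "(20::real) ^ Suc k = 20 * 20 ^ k" by simp_all
  from Suc.prems consider "q \<in> centers k" | q' where "q' \<in> centers k" "q = q' + (3 * 20 ^ k) *\<^sub>R axis" by auto
  then show ?case
  proof cases
    case 1
    then show ?thesis using Suc.IH[OF 1] p by linarith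
  next
    case 2
    then have "norm q \<le> norm q' + 3 * 20 ^ k" using norm_triangle_ineq[of q' "(3 * 20 ^ k) *\<^sub>R axis"] by simp
    then show ?thesis using Suc.IH[OF 2(1)] p by linarith
  qed
qed simp

lemma ball_centers_subset:
  assumes "q \<in> centers k"
  shows "ball (z + q) 1 \<subseteq> ball z (20 ^ k)"
proof
  fix x assume "x \<in> ball (z + q) 1"
  then have "norm (x - (z + q)) < 1" by (simp add: dist_norm norm_minus_commute)
  moreover have "norm (x - z) \<le> norm (x - (z + q)) + norm q"
    using norm_triangle_ineq[of "x - (z + q)" q] by simp
  ultimately show "x \<in> ball z (20 ^ k)" using norm_centers[OF assms] by (simp add: dist_norm norm_minus_commute)
qed

lemma disjoint_shifted_balls:
  fixes z :: "'a::euclidean_space"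
  shows "ball z r \<inter> ball (z + (3 * r) *\<^sub>R axis) r = {}"
proof (rule ccontr)
  assume "\<not> ?thesis"
  then obtain x where x: "dist z x < r" "dist (z + (3 * r) *\<^sub>R axis) x < r" by auto
  have "dist z (z + (3 * r) *\<^sub>R axis) = \<bar>3 * r\<bar>" by (simp add: dist_norm)
  then show False using x dist_triangle2[of z "z + (3 * r) *\<^sub>R axis" x] by (simp add: abs_if split: if_splits)
qed

lemma disjoint_centers:
  "q \<in> centers k \<Longrightarrow> q' \<in> centers k \<Longrightarrow> q \<noteq> q' \<Longrightarrow> ball (z + q) 1 \<inter> ball (z + q') 1 = {}"
proof (induction k arbitrary: q q' z)
  case (Suc k)
  let ?w = "(3 * 20 ^ k) *\<^sub>R axis :: 'a"
  have *: "ball (z + a) 1 \<inter> ball (z + (b + ?w)) 1 = {}" if "a \<in> centers k" "b \<in> centers k" for a b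
    using ball_centers_subset[OF that(1), of z] ball_centers_subset[OF that(2), of "z + ?w"]
      disjoint_shifted_balls[of z "20 ^ k"] by (auto simp: algebra_simps)
  from Suc.prems consider "q \<in> centers k" "q' \<in> centers k"
    | b where "q \<in> centers k" "b \<in> centers k" "q' = b + ?w"
    | a where "a \<in> centers k" "q = a + ?w" "q' \<in> centers k"
    | a b where "a \<in> centers k" "q = a + ?w" "b \<in> centers k" "q' = b + ?w" "a \<noteq> b" by auto
  then show ?case
  proof cases
    case 1
    then show ?thesis using Suc by blast
  next
    case 2
    then show ?thesis using *[of q b] by simp
  next
    case 3
    then show ?thesis using *[of q' a] by (simp add: Int_commute)
  next
    case 4
    then show ?thesis using Suc.IH[of a b "z + ?w"] by (simp add: algebra_simps)
  qed
qed simp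

lemma pattern_SucD:
  assumes "pattern (Suc k) z P"
  defines "w \<equiv> z + (3 * 20 ^ k) *\<^sub>R axis"
  shows "pattern k z P" "pattern k w P"
    "P \<inter> ball z (20 ^ Suc k) \<subseteq> ball z (20 ^ k) \<union> ball w (20 ^ k)"
    "ball z (20 ^ k) \<subseteq> ball z (20 ^ Suc k)" "ball w (20 ^ k) \<subseteq> ball z (20 ^ Suc k)"
    "ball z (20 ^ k) \<inter> ball w (20 ^ k) = {}"
proof -
  have p: "(1::real) \<le> 20 ^ k" by simp
  show d: "ball z (20 ^ k) \<inter> ball w (20 ^ k) = {}" unfolding w_def by (rule disjoint_shifted_balls)
  show b1: "ball z (20 ^ k) \<subseteq> ball z (20 ^ Suc k)" by (intro subset_ball) (use p in simp)
  have "dist z w = 3 * 20 ^ k" by (simp add: w_def dist_norm)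
  then show b2: "ball w (20 ^ k) \<subseteq> ball z (20 ^ Suc k)"
  proof (intro subsetI)
    fix x assume "dist z w = 3 * 20 ^ k" "x \<in> ball w (20 ^ k)"
    moreover have "(20::real) ^ Suc k = 20 * 20 ^ k" by simp
    ultimately have "dist z x < 20 ^ Suc k" using dist_triangle[of z x w] p unfolding mem_ball by linarith
    then show "x \<in> ball z (20 ^ Suc k)" by simp
  qed
  have wq: "w + q = z + (q + (3 * 20 ^ k) *\<^sub>R axis)" for q by (simp add: w_def)
  have c1: "ball (z + q) 1 \<subseteq> ball z (20 ^ k)" "ball (w + q) 1 \<subseteq> ball w (20 ^ k)" if "q \<in> centers k" for q
    using ball_centers_subset[OF that] by auto
  have U: "(\<Union>q\<in>centers (Suc k). ball (z + q) 1) =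
      (\<Union>q\<in>centers k. ball (z + q) 1) \<union> (\<Union>q\<in>centers k. ball (w + q) 1)"
    by (simp add: wq image_Un)
  have A: "P \<inter> ball z (20 ^ Suc k) \<subseteq> (\<Union>q\<in>centers k. ball (z + q) 1) \<union> (\<Union>q\<in>centers k. ball (w + q) 1)"
    using assms(1) unfolding pattern_def U by blast
  then show "P \<inter> ball z (20 ^ Suc k) \<subseteq> ball z (20 ^ k) \<union> ball w (20 ^ k)"
    using c1 by blast
  have "P \<inter> (ball z (20 ^ k) - (\<Union>q\<in>centers k. ball (z + q) 1)) = {}"
    using A b1 d c1(2) by blast
  then show "pattern k z P" using assms(1) unfolding pattern_def by auto
  have "P \<inter> (ball w (20 ^ k) - (\<Union>q\<in>centers k. ball (w + q) 1)) = {}"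
    using A b2 d c1(1) by blast
  moreover have "card (P \<inter> ball (w + q) 1) = 1" if "q \<in> centers k" for q
    using assms(1) that unfolding pattern_def wq by auto
  ultimately show "pattern k w P" unfolding pattern_def by auto
qed

lemma pattern_nonempty: "pattern k z P \<Longrightarrow> P \<inter> ball z (20 ^ k) \<noteq> {}"
proof -
  assume "pattern k z P"
  then have "card (P \<inter> ball (z + 0) 1) = 1" using zero_in_centers unfolding pattern_def by blast
  then have "P \<inter> ball (z + 0) 1 \<noteq> {}" by (metis card.empty zero_neq_one)
  then show ?thesis using ball_centers_subset[OF zero_in_centers[of k], of z] by blast
qed

lemma exit_ofE:
  assumes "exit_of \<S> x x'"
  obtains S T where "S \<in> \<S>" "x \<in> S" "T \<in> \<S>" "T \<noteq> S" "x' \<in> T"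
    "\<forall>T\<in>\<S>. T \<noteq> S \<longrightarrow> (\<forall>u\<in>S. \<forall>v\<in>T. (u, v) \<noteq> (x, x') \<longrightarrow> dist x x' < dist u v)"
  using assms unfolding exit_of_def by (elim bexE conjE) (rule that)

lemma cluster_in_invariant_set:
  assumes t: "tame P f" and Q: "Q \<subseteq> P" "Q \<noteq> {}" "\<And>y. y \<in> Q \<Longrightarrow> f y \<in> Q"
  shows "\<exists>T\<in>clusters P f. T \<subseteq> Q"
proof -
  obtain y where y: "y \<in> Q" using Q by blast
  have "reaches_two_cycles P f" using t by (simp add: tame_def)
  then obtain n where n: "f (f ((f ^^ n) y)) = (f ^^ n) y"
    using y Q(1) unfolding reaches_two_cycles_def by blast
  have "(f ^^ n) y \<in> Q" by (rule funpow_closed[of Q f, OF Q(3) y])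
  then show ?thesis
    using n Q by (intro bexI[of _ "{(f ^^ n) y, f ((f ^^ n) y)}"]) (auto simp: clusters_def)
qed

text \<open>
  A pattern is a binary hierarchy of isolated groups of points: the diameter of a group is smaller
  than its distance to the other points. Hence no rewiring up to its order leaves it.
\<close>

lemma pattern_invariant:
  assumes G0: "\<And>y. y \<in> P \<Longrightarrow> G 0 y = y"
    and GS: "\<And>j. j < K \<Longrightarrow> G (Suc j) = rewire (clusters P (G j)) (G j)"
    and tame: "\<And>j. j < K \<Longrightarrow> tame P (G j)"
    and un: "\<And>j y y'. j < K \<Longrightarrow> exit_of (clusters P (G j)) y y' \<Longrightarrow> G (Suc j) y = y'"
    and "pattern K z P"
  shows "\<forall>j\<le>K. \<forall>y\<in>P \<inter> ball z (20 ^ K). G j y \<in> P \<inter> ball z (20 ^ K)"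
  using assms
proof (induction K arbitrary: z)
  case 0
  then show ?case by simp
next
  case (Suc K)
  define w where "w = z + (3 * 20 ^ K) *\<^sub>R axis"
  note pat = pattern_SucD[OF Suc.prems(5), folded w_def]
  define A B Q where "A = P \<inter> ball z (20 ^ K)" and "B = P \<inter> ball w (20 ^ K)"
    and "Q = P \<inter> ball z (20 ^ Suc K)"
  have Q: "Q = A \<union> B" using pat by (auto simp: A_def B_def Q_def)
  have IH: "\<forall>j\<le>K. \<forall>y\<in>A. G j y \<in> A" "\<forall>j\<le>K. \<forall>y\<in>B. G j y \<in> B"
    unfolding A_def B_def
    by (rule Suc.IH; use Suc.prems pat in simp)+
  let ?S = "clusters P (G K)"
  have tK: "tame P (G K)" using Suc.prems by simp
  obtain TA where TA: "TA \<in> ?S" "TA \<subseteq> A"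
    using cluster_in_invariant_set[OF tK, of A] IH(1) pattern_nonempty[OF pat(1)] by (auto simp: A_def)
  obtain TB where TB: "TB \<in> ?S" "TB \<subseteq> B"
    using cluster_in_invariant_set[OF tK, of B] IH(2) pattern_nonempty[OF pat(2)] by (auto simp: B_def)
  have dw: "dist z w = 3 * 20 ^ K" by (simp add: w_def dist_norm)
  have nearz: "dist z u < 4 * 20 ^ K" if "u \<in> Q" for u
  proof -
    have "(0::real) < 20 ^ K" by simp
    moreover have "dist z u < 20 ^ K \<or> dist w u < 20 ^ K" using that by (auto simp: Q A_def B_def)
    ultimately show ?thesis using dw dist_triangle[of z u w] by linarith
  qed
  have "G (Suc K) y \<in> Q" if y: "y \<in> Q" for y
  proof (cases "\<exists>y'. exit_of ?S y y'")
    case False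
    then have "G (Suc K) y = G K y" unfolding Suc.prems(2)[OF lessI] rewire_def by (simp only: if_False)
    then show ?thesis using IH y Q by auto
  next
    case True
    then obtain y' where y': "exit_of ?S y y'" by blast
    then obtain S T where S: "S \<in> ?S" "y \<in> S" and T: "T \<in> ?S" "T \<noteq> S" "y' \<in> T"
      and min: "\<forall>T\<in>?S. T \<noteq> S \<longrightarrow> (\<forall>u\<in>S. \<forall>v\<in>T. (u, v) \<noteq> (y, y') \<longrightarrow> dist y y' < dist u v)"
      by (rule exit_ofE)
    have "S = {y, G K y}" using clusters_member(2)[OF S] .
    then have "S \<subseteq> A \<or> S \<subseteq> B" using y IH unfolding Q by auto
    moreover have "A \<inter> B = {}" using pat(6) unfolding A_def B_def by blast
    ultimately have "\<not> S \<subseteq> A \<or> \<not> S \<subseteq> B" "TA \<subseteq> Q" "TB \<subseteq> Q" "TA \<noteq> TB"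
      using S(2) TA TB(2) unfolding Q by (auto simp: clusters_def)
    then obtain T' where T': "T' \<in> ?S" "T' \<noteq> S" "T' \<subseteq> Q" using TA(1) TB(1) by metis
    obtain v where v: "v \<in> T'" using T'(1) by (auto simp: clusters_def)
    have "dist y y' \<le> dist y v" using min[rule_format, OF T'(1,2) S(2) v] by (cases "(y, v) = (y, y')") auto
    also have "dist y v < 8 * 20 ^ K"
      using nearz[OF y] nearz[of v] v T'(3) dist_triangle3[of y v z] by auto
    finally have "dist z y' < 12 * 20 ^ K" using nearz[OF y] dist_triangle[of z y' y] by linarith
    also have "\<dots> < 20 ^ Suc K" by simp
    finally have "y' \<in> ball z (20 ^ Suc K)" by simp
    moreover have "y' \<in> P" using T tK by (auto simp: clusters_def tame_def)
    ultimately show ?thesis using Suc.prems(4)[OF _ y'] by (simp add: Q_def)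
  qed
  moreover have "G j y \<in> Q" if "j \<le> K" "y \<in> Q" for j y using IH that Q by blast
  ultimately have "\<forall>j\<le>Suc K. \<forall>y\<in>Q. G j y \<in> Q" by (simp add: le_Suc_eq)
  then show ?case unfolding Q_def .
qed

lemma two_clusters_in_pattern:
  assumes G0: "\<And>y. y \<in> P \<Longrightarrow> G 0 y = y"
    and GS: "\<And>j. j < K \<Longrightarrow> G (Suc j) = rewire (clusters P (G j)) (G j)"
    and tame: "\<And>j. j \<le> K \<Longrightarrow> tame P (G j)"
    and un: "\<And>j y y'. j < K \<Longrightarrow> exit_of (clusters P (G j)) y y' \<Longrightarrow> G (Suc j) y = y'"
    and pat: "pattern (Suc K) z P"
  shows "\<exists>S\<in>clusters P (G K). \<exists>T\<in>clusters P (G K). S \<noteq> T \<and> S \<subseteq> ball z (20 ^ Suc K) \<and> T \<subseteq> ball z (20 ^ Suc K)"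
proof -
  define w where "w = z + (3 * 20 ^ K) *\<^sub>R axis"
  note pat' = pattern_SucD[OF pat, folded w_def]
  have inv: "\<exists>T\<in>clusters P (G K). T \<subseteq> P \<inter> ball x (20 ^ K)" if "pattern K x P" for x
  proof (rule cluster_in_invariant_set[OF tame[of K]])
    have "\<forall>j\<le>K. \<forall>y\<in>P \<inter> ball x (20 ^ K). G j y \<in> P \<inter> ball x (20 ^ K)"
    proof (rule pattern_invariant[of P G K])
      show "tame P (G j)" if "j < K" for j using tame that by simp
    qed (rule G0 GS un that; assumption)+
    then show "G K y \<in> P \<inter> ball x (20 ^ K)" if "y \<in> P \<inter> ball x (20 ^ K)" for y using that by blast
    show "P \<inter> ball x (20 ^ K) \<noteq> {}" by (rule pattern_nonempty[OF that])
  qed auto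
  obtain S where S: "S \<in> clusters P (G K)" "S \<subseteq> P \<inter> ball z (20 ^ K)" using inv[OF pat'(1)] by blast
  obtain T where T: "T \<in> clusters P (G K)" "T \<subseteq> P \<inter> ball w (20 ^ K)" using inv[OF pat'(2)] by blast
  have "S \<noteq> {}" using S(1) by (auto simp: clusters_def)
  then have "S \<noteq> T" using S(2) T(2) pat'(6) by blast
  then show ?thesis using S T pat'(4,5) by blast
qed

text \<open>
  Off \<open>P\<close> the values are chosen such that \<open>chn P 0\<close> is equal, as a total function, to the rewiring
  of \<open>level P 0\<close>.
\<close>

definition level :: "'a::metric_space set \<Rightarrow> nat \<Rightarrow> 'a \<Rightarrow> 'a" where
  "level P k = (case k of 0 \<Rightarrow> (\<lambda>x. if x \<in> P then x else chn P 0 x) | Suc j \<Rightarrow> chn P j)"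

lemma level_simps: "level P 0 x = (if x \<in> P then x else chn P 0 x)" "level P (Suc k) = chn P k"
  by (simp_all add: level_def)

lemma clusters_level_0: "clusters P (level P 0) = (\<lambda>a. {a}) ` P"
  by (auto simp: clusters_def level_simps)

lemma exit_of_singletons: "exit_of ((\<lambda>a. {a}) ` P) x y \<longleftrightarrow> x \<in> P \<and> is_nn P x y"
proof
  assume "exit_of ((\<lambda>a. {a}) ` P) x y"
  then obtain S where S: "S \<in> (\<lambda>a. {a}) ` P" "x \<in> S" "\<exists>T\<in>(\<lambda>a. {a}) ` P. T \<noteq> S \<and> y \<in> T"
    "\<forall>T\<in>(\<lambda>a. {a}) ` P. T \<noteq> S \<longrightarrow> (\<forall>u\<in>S. \<forall>v\<in>T. (u, v) \<noteq> (x, y) \<longrightarrow> dist x y < dist u v)"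
    unfolding exit_of_def by blast
  have x: "S = {x}" "x \<in> P" using S(1,2) by auto
  have "y \<in> P" "y \<noteq> x" using S(3) x by auto
  moreover have "dist x y < dist x z" if "z \<in> P" "z \<noteq> x" "z \<noteq> y" for z
    using S(4)[rule_format, of "{z}" x z] that x by simp
  ultimately show "x \<in> P \<and> is_nn P x y" using x by (simp add: is_nn_def)
next
  assume "x \<in> P \<and> is_nn P x y"
  then show "exit_of ((\<lambda>a. {a}) ` P) x y"
    unfolding exit_of_def by (intro bexI[of _ "{x}"] conjI bexI[of _ "{y}"]) (auto simp: is_nn_def)
qed

lemma tame_level_0: "tame P (level P 0)"
proof -
  have it: "(level P 0 ^^ n) x = x" if "x \<in> P" for n x
    using that by (induction n) (auto simp: level_simps)
  have "foil P (level P 0) x = {x}" if "x \<in> P" for x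
    using it that by (auto simp: foil_def)
  moreover have "reaches_two_cycles P (level P 0)"
    unfolding reaches_two_cycles_def using it by (auto simp: level_simps)
  ultimately show ?thesis unfolding tame_def clusters_level_0 by (auto simp: level_simps)
qed

lemma pairs_of_eq_clusters:
  assumes "\<And>x. x \<in> P \<Longrightarrow> f x \<noteq> x"
  shows "pairs_of P f = clusters P f"
  using assms unfolding pairs_of_def clusters_def by blast

lemma exit_edge_iff_exit_of:
  assumes cl: "\<And>x. x \<in> P \<Longrightarrow> f x \<in> P" and ne: "\<And>x. x \<in> P \<Longrightarrow> f x \<noteq> x"
  shows "exit_edge P f x x' \<longleftrightarrow> exit_of (clusters P f) x x'"
proof
  have pc: "pairs_of P f = clusters P f" by (rule pairs_of_eq_clusters) (rule ne)
  assume e: "exit_edge P f x x'"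
  then have "{x, f x} \<in> clusters P f" by (auto simp: exit_edge_def clusters_def)
  then show "exit_of (clusters P f) x x'"
    using e unfolding exit_of_def exit_edge_def pc by (intro bexI[of _ "{x, f x}"]) auto
next
  have pc: "pairs_of P f = clusters P f" by (rule pairs_of_eq_clusters) (rule ne)
  assume "exit_of (clusters P f) x x'"
  then obtain S where S: "S \<in> clusters P f" "x \<in> S" "\<exists>T\<in>clusters P f. T \<noteq> S \<and> x' \<in> T"
    "\<forall>T\<in>clusters P f. T \<noteq> S \<longrightarrow> (\<forall>u\<in>S. \<forall>v\<in>T. (u, v) \<noteq> (x, x') \<longrightarrow> dist x x' < dist u v)"
    unfolding exit_of_def by blast
  note m = clusters_member[OF S(1,2)]
  have "x \<in> P" using S(1,2) cl by (auto simp: clusters_def)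
  then show "exit_edge P f x x'"
    unfolding exit_edge_def pc m(2)[symmetric]
    using m(1) ne S by blast
qed

theorem chn_well_defined:
  fixes P :: "'a::euclidean_space set"
  assumes fin: "\<And>R. finite (P \<inter> cball 0 R)" and no_ties: "no_ties P"
    and scales: "\<And>K r. \<exists>m R N. r \<le> m \<and> 0 < m \<and> r + 2 * m * (real N + 2) \<le> R \<and>
        (\<nexists>u v. increasing_chain P m R N u v) \<and>
        (\<forall>x. norm x \<le> R \<longrightarrow> (\<exists>z. ball z (20 ^ Suc K) \<subseteq> ball x m \<and> pattern (Suc K) z P))"
  shows "chn_wd P n \<and> (\<forall>x\<in>P. class_FF P (chn P n) (component P (chn P n) x) \<and>
      unique_cycle_length_2 (chn P n) (component P (chn P n) x))"
proof -
  let ?S = "\<lambda>k. clusters P (level P k)"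
  define ok where "ok k \<longleftrightarrow> rewiring P (level P k) \<and> level P (Suc k) = rewire (?S k) (level P k)" for k
  have step: "ok k" if t: "tame P (level P k)" and ne: "k > 0 \<Longrightarrow> \<forall>x\<in>P. level P k x \<noteq> x"
    and prev: "\<And>j. j < k \<Longrightarrow> ok j" for k
  proof -
    have good: "\<exists>m R N. good_scale P (?S k) r m R N" for r
    proof -
      obtain m R N where m: "r \<le> m" "0 < m" "r + 2 * m * (real N + 2) \<le> R"
        "\<nexists>u v. increasing_chain P m R N u v"
        and pt: "\<And>x. norm x \<le> R \<Longrightarrow> \<exists>z. ball z (20 ^ Suc k) \<subseteq> ball x m \<and> pattern (Suc k) z P"
        using scales[of r k] by auto
      have "\<exists>S\<in>?S k. \<exists>T\<in>?S k. S \<noteq> T \<and> S \<subseteq> ball x m \<and> T \<subseteq> ball x m" if "norm x \<le> R" for x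
      proof -
        obtain z where z: "ball z (20 ^ Suc k) \<subseteq> ball x m" "pattern (Suc k) z P" using pt[OF \<open>norm x \<le> R\<close>] by blast
        have "\<exists>S\<in>?S k. \<exists>T\<in>?S k. S \<noteq> T \<and> S \<subseteq> ball z (20 ^ Suc k) \<and> T \<subseteq> ball z (20 ^ Suc k)"
        proof (rule two_clusters_in_pattern[OF _ _ _ _ z(2)])
          show "level P 0 y = y" if "y \<in> P" for y using that by (simp add: level_simps)
          show "level P (Suc j) = rewire (?S j) (level P j)" if "j < k" for j using prev[OF that] by (simp add: ok_def)
          show "tame P (level P j)" if "j \<le> k" for j
            using that t prev[of j] by (cases "j = k") (auto simp: ok_def rewiring_def)
          show "level P (Suc j) y = y'" if "j < k" "exit_of (?S j) y y'" for j y y'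
          proof -
            interpret rewiring P "level P j" using prev[OF that(1)] by (simp add: ok_def)
            show ?thesis using exit_of_ex[OF that(2)] rewire_ex prev[OF that(1)] by (auto simp: ok_def)
          qed
        qed
        then show ?thesis using z(1) by (meson subset_trans)
      qed
      then have "good_scale P (?S k) r m R N" using m by (simp add: good_scale_def add.commute)
      then show ?thesis by blast
    qed
    interpret rewiring P "level P k" by unfold_locales (use t no_ties fin good in auto)
    have "level P (Suc k) = rewire (?S k) (level P k)"
    proof (cases k)
      case 0
      have "chn P 0 x = rewire (?S 0) (level P 0) x" for x
      proof (cases "x \<in> P")
        case True
        then have "{x} \<in> ?S 0" by (simp add: clusters_level_0)
        then have "\<exists>y. exit_of (?S 0) x y" using exit_exists[of "{x}"] 0 by simp
        moreover have "exit_of (?S 0) x = is_nn P x"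
          using True by (intro ext) (simp add: clusters_level_0 exit_of_singletons)
        ultimately show ?thesis by (simp add: rewire_def)
      next
        case False
        then show ?thesis by (simp add: rewire_def clusters_level_0 exit_of_singletons level_simps)
      qed
      then show ?thesis using 0 by (auto simp: level_simps)
    next
      case (Suc j)
      have "exit_edge P (chn P j) = exit_of (clusters P (chn P j))"
        by (intro ext exit_edge_iff_exit_of) (use closed ne Suc in \<open>auto simp: level_simps\<close>)
      then have "chn P (Suc j) y = rewire (clusters P (chn P j)) (chn P j) y" for y
        by (auto simp: rewire_def)
      then show ?thesis unfolding Suc level_simps by (rule ext)
    qed
    then show ?thesis unfolding ok_def using rewiring_axioms by blast
  qed
  have okk: "ok k" for k
  proof (induction k rule: less_induct)
    case (less k)
    show ?case
    proof (rule step[OF _ _ less.IH])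
      show "tame P (level P k)"
      proof (cases k)
        case (Suc j)
        then interpret rewiring P "level P j" using less.IH[of j] by (simp add: ok_def)
        show ?thesis using tame_rewire less.IH[of j] Suc by (simp add: ok_def)
      qed (simp add: tame_level_0)
      show "\<forall>x\<in>P. level P k x \<noteq> x" if "k > 0"
      proof -
        obtain j where Suc: "k = Suc j" using \<open>k > 0\<close> by (cases k) auto
        then interpret rewiring P "level P j" using less.IH[of j] by (simp add: ok_def)
        show ?thesis using rewire_neq less.IH[of j] Suc by (simp add: ok_def)
      qed
    qed
  qed
  have lev: "rewiring P (level P k)" "level P (Suc k) = rewire (?S k) (level P k)" for k
    using okk[of k] by (auto simp: ok_def)
  have tm: "tame P (chn P k)" for k
    using lev(1)[of "Suc k"] by (simp add: rewiring_def level_simps)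
  have ne: "chn P k x \<noteq> x" if "x \<in> P" for k x
    using rewiring.rewire_neq[OF lev(1)[of k] that] lev(2)[of k] by (simp add: level_simps)
  have cl: "chn P k x \<in> P" if "x \<in> P" for k x using tm[of k] that by (simp add: tame_def)
  have comp: "component P (chn P k) x = foil P (chn P k) x" if "x \<in> P" for k x
    using component_eq_foil[of P "chn P k" x] cl that by blast
  have ff: "finite (foil P (chn P k) x)" if "x \<in> P" for k x using tm[of k] that by (simp add: tame_def)
  have uc: "unique_cycle_length_2 (chn P k) (component P (chn P k) x)" if "x \<in> P" for k x
    unfolding comp[OF that] by (rule unique_cycle_length_2_foil) (use cl ne tm that in \<open>auto simp: tame_def\<close>)
  have gl: "good_level P (chn P k)" for k
    unfolding good_level_def using cl uc comp ff by auto
  have exits: "\<exists>x\<in>S. \<exists>x'. exit_edge P (chn P k) x x'" if S: "S \<in> pairs_of P (chn P k)" for S k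
  proof -
    have "pairs_of P (chn P k) = clusters P (chn P k)" by (rule pairs_of_eq_clusters) (rule ne)
    then have "S \<in> ?S (Suc k)" using S by (simp add: level_simps)
    moreover have "exit_edge P (chn P k) x x' \<longleftrightarrow> exit_of (?S (Suc k)) x x'" for x x'
      unfolding level_simps by (rule exit_edge_iff_exit_of) (use cl ne in auto)
    ultimately show ?thesis using rewiring.exit_exists[OF lev(1)[of "Suc k"]] by simp
  qed
  have wd: "chn_wd P k" for k
  proof (induction k)
    case 0
    have "\<exists>y. is_nn P x y" if x: "x \<in> P" for x
      using rewiring.exit_exists[OF lev(1)[of 0], of "{x}"] x
      by (auto simp: clusters_level_0 exit_of_singletons)
    then show ?case by simp
  next
    case (Suc k)
    then show ?case using gl exits by simp
  qed
  have "class_FF P (chn P n) (component P (chn P n) x)" if "x \<in> P" for x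
    unfolding class_FF_def comp[OF that] using ff that by (auto simp: foil_def)
  then show ?thesis using wd uc by blast
qed

section \<open>Outer probability and Poisson counts\<close>

context prob_space begin

text \<open>Outer probabilities: the events of interest are not known to be measurable.\<close>

definition outer_le :: "'a set \<Rightarrow> real \<Rightarrow> bool" where
  "outer_le A e \<longleftrightarrow> (\<exists>B\<in>events. A \<inter> space M \<subseteq> B \<and> prob B \<le> e)"

lemma outer_le_mono: "outer_le A e \<Longrightarrow> A' \<inter> space M \<subseteq> A \<Longrightarrow> e \<le> e' \<Longrightarrow> outer_le A' e'"
  unfolding outer_le_def by (meson Int_lower2 Int_subset_iff order_trans)

lemma outer_le_UN:
  assumes "finite I" "\<And>i. i \<in> I \<Longrightarrow> outer_le (A i) (e i)"
  shows "outer_le (\<Union>i\<in>I. A i) (\<Sum>i\<in>I. e i)"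
proof -
  have "\<forall>i\<in>I. \<exists>B. B \<in> events \<and> A i \<inter> space M \<subseteq> B \<and> prob B \<le> e i"
    using assms(2) unfolding outer_le_def by blast
  then obtain B where B: "\<And>i. i \<in> I \<Longrightarrow> B i \<in> events \<and> A i \<inter> space M \<subseteq> B i \<and> prob (B i) \<le> e i"
    by metis
  have "prob (\<Union>i\<in>I. B i) \<le> (\<Sum>i\<in>I. prob (B i))"
    by (rule measure_UNION_le) (use assms(1) B in auto)
  also have "\<dots> \<le> (\<Sum>i\<in>I. e i)" by (rule sum_mono) (use B in auto)
  finally show ?thesis
    unfolding outer_le_def using B assms(1) by (intro bexI[of _ "\<Union>i\<in>I. B i"]) auto
qed

lemma outer_le_Un:
  assumes "outer_le A a" "outer_le B b"
  shows "outer_le (A \<union> B) (a + b)"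
proof -
  have "outer_le (\<Union>t\<in>{True, False}. if t then A else B) (\<Sum>t\<in>{True, False}. if t then a else b)"
    by (rule outer_le_UN) (use assms in auto)
  then show ?thesis by (simp add: Un_commute)
qed

lemma outer_le_liminf:
  assumes "\<And>s::nat. s \<ge> k \<Longrightarrow> outer_le (E s) e"
    and "\<And>\<omega>. \<omega> \<in> A \<Longrightarrow> \<omega> \<in> space M \<Longrightarrow> eventually (\<lambda>s. \<omega> \<in> E s) sequentially"
  shows "outer_le A e"
proof -
  have "\<forall>s. \<exists>B. s \<ge> k \<longrightarrow> B \<in> events \<and> E s \<inter> space M \<subseteq> B \<and> prob B \<le> e"
    using assms(1) unfolding outer_le_def by blast
  then obtain B where B: "\<And>s. s \<ge> k \<Longrightarrow> B s \<in> events \<and> E s \<inter> space M \<subseteq> B s \<and> prob (B s) \<le> e"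
    by metis
  define C where "C n = (\<Inter>s\<in>{k + n..}. B s)" for n
  have C: "C n \<in> events" for n
    unfolding C_def by (rule sets.countable_INT') (use B in auto)
  have "incseq C" unfolding incseq_def C_def by (auto intro!: INT_anti_mono)
  then have lim: "(\<lambda>n. prob (C n)) \<longlonglongrightarrow> prob (\<Union>n. C n)"
    by (intro finite_Lim_measure_incseq) (use C in auto)
  have "prob (C n) \<le> e" for n
  proof -
    have "prob (C n) \<le> prob (B (k + n))"
      by (rule finite_measure_mono) (use B in \<open>auto simp: C_def\<close>)
    then show ?thesis using B[of "k + n"] by simp
  qed
  then have "prob (\<Union>n. C n) \<le> e" using LIMSEQ_le_const2[OF lim] by blast
  moreover have "A \<inter> space M \<subseteq> (\<Union>n. C n)"
  proof
    fix \<omega> assume w: "\<omega> \<in> A \<inter> space M"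
    then obtain n where n: "\<And>s. s \<ge> n \<Longrightarrow> \<omega> \<in> E s" using assms(2) unfolding eventually_sequentially by blast
    have "\<omega> \<in> B s" if "k + n \<le> s" for s using n[of s] B[of s] w that by auto
    then have "\<omega> \<in> C n" by (simp add: C_def)
    then show "\<omega> \<in> (\<Union>n. C n)" by blast
  qed
  ultimately show ?thesis unfolding outer_le_def using C by (intro bexI[of _ "\<Union>n. C n"]) auto
qed

lemma AE_not_outer_null:
  assumes "\<And>e. e > 0 \<Longrightarrow> outer_le A e"
  shows "AE \<omega> in M. \<omega> \<notin> A"
proof -
  have "\<forall>n. \<exists>B. B \<in> events \<and> A \<inter> space M \<subseteq> B \<and> prob B \<le> 1 / Suc n"
    using assms[of "1 / real (Suc n)" for n] unfolding outer_le_def by fastforce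
  then obtain B where B: "\<And>n. B n \<in> events \<and> A \<inter> space M \<subseteq> B n \<and> prob (B n) \<le> 1 / real (Suc n)"
    by metis
  define D where "D = (\<Inter>n. B n)"
  have D: "D \<in> events" unfolding D_def by (rule sets.countable_INT) (use B in auto)
  have "prob D \<le> 1 / real (Suc n)" for n
    using finite_measure_mono[of D "B n"] B[of n] by (force simp: D_def)
  then have "prob D \<le> 0"
    by (intro LIMSEQ_le_const[OF LIMSEQ_inverse_real_of_nat]) (auto simp: inverse_eq_divide)
  then have "D \<in> null_sets M" using D by (simp add: emeasure_eq_measure null_sets_def measure_le_0_iff)
  moreover have "{\<omega> \<in> space M. \<not> \<omega> \<notin> A} \<subseteq> D" using B by (auto simp: D_def)
  ultimately show ?thesis by (rule AE_I')
qed

lemma AE_frequently_not: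
  assumes "\<And>s::nat. outer_le (E s) (e s)" "e \<longlonglongrightarrow> 0"
  shows "AE \<omega> in M. \<forall>n. \<exists>s\<ge>n. \<omega> \<notin> E s"
proof -
  have "AE \<omega> in M. \<omega> \<notin> {\<omega>. \<exists>n. \<forall>s\<ge>n. \<omega> \<in> E s}"
  proof (rule AE_not_outer_null)
    fix d :: real assume "d > 0"
    then obtain s0 where "\<And>s. s \<ge> s0 \<Longrightarrow> e s < d"
      using order_tendstoD(2)[OF assms(2), of d] unfolding eventually_sequentially by blast
    then have "outer_le (E s) d" if "s \<ge> s0" for s
      using that outer_le_mono[OF assms(1)[of s], of "E s" d] by (simp add: less_imp_le)
    then show "outer_le {\<omega>. \<exists>n. \<forall>s\<ge>n. \<omega> \<in> E s} d"
      by (rule outer_le_liminf) (auto simp: eventually_sequentially)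
  qed
  then show ?thesis by eventually_elim blast
qed

end

locale poisson_process = prob_space M for M :: "'b measure" +
  fixes Phi :: "'b \<Rightarrow> 'a::euclidean_space set" and c :: real
  assumes ppp: "homogeneous_PPP M Phi c"
begin

lemma c_pos: "c > 0" using ppp by (simp add: homogeneous_PPP_def)

lemma locally_finite: "\<omega> \<in> space M \<Longrightarrow> bounded B \<Longrightarrow> finite (Phi \<omega> \<inter> B)"
  using ppp by (simp add: homogeneous_PPP_def)

lemma count_measurable [measurable]:
  "B \<in> sets lborel \<Longrightarrow> bounded B \<Longrightarrow> (\<lambda>\<omega>. card (Phi \<omega> \<inter> B)) \<in> measurable M (count_space UNIV)"
  using ppp by (simp add: homogeneous_PPP_def)

lemma prob_count:
  "B \<in> sets lborel \<Longrightarrow> bounded B \<Longrightarrow> prob {\<omega>\<in>space M. card (Phi \<omega> \<inter> B) = k}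
     = (c * measure lborel B) ^ k / fact k * exp (- (c * measure lborel B))"
  using ppp unfolding homogeneous_PPP_def by blast

lemma indep_counts_nat:
  fixes Bs :: "nat \<Rightarrow> 'a set"
  shows "(\<And>i. i < n \<Longrightarrow> Bs i \<in> sets lborel \<and> bounded (Bs i)) \<Longrightarrow> disjoint_family_on Bs {..<n} \<Longrightarrow>
     indep_vars (\<lambda>_. count_space UNIV) (\<lambda>i \<omega>. card (Phi \<omega> \<inter> Bs i)) {..<n}"
  using ppp unfolding homogeneous_PPP_def by blast

lemma indep_counts:
  assumes fin: "finite I" and B: "\<And>i. i \<in> I \<Longrightarrow> B i \<in> sets lborel \<and> bounded (B i)"
    and dis: "disjoint_family_on B I"
  shows "indep_vars (\<lambda>_. count_space UNIV) (\<lambda>i \<omega>. card (Phi \<omega> \<inter> B i)) I"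
proof -
  obtain h where h: "bij_betw h {0..<card I} I" using ex_bij_betw_nat_finite[OF fin] by blast
  define n where "n = card I"
  have h': "bij_betw h {..<n} I" using h by (simp add: n_def atLeast0LessThan)
  define k where "k = inv_into {..<n} h"
  have k: "bij_betw k I {..<n}" unfolding k_def by (rule bij_betw_inv_into[OF h'])
  have hk: "h (k i) = i" if "i \<in> I" for i
    unfolding k_def using bij_betw_inv_into_right[OF h' that] .
  have hI: "h j \<in> I" if "j < n" for j using h' that by (auto simp: bij_betw_def)
  have "indep_vars (\<lambda>_. count_space UNIV) (\<lambda>j \<omega>. card (Phi \<omega> \<inter> B (h j))) {..<n}"
  proof (rule indep_counts_nat)
    show "disjoint_family_on (\<lambda>j. B (h j)) {..<n}"
      using dis h' unfolding disjoint_family_on_def bij_betw_def inj_on_def by blast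
  qed (use B hI in auto)
  then have "indep_vars (\<lambda>i. PiM {k i} (\<lambda>_. count_space UNIV))
      (\<lambda>i \<omega>. restrict (\<lambda>j. card (Phi \<omega> \<inter> B (h j))) {k i}) I"
  proof (rule indep_vars_restrict)
    show "disjoint_family_on (\<lambda>i. {k i}) I"
      using k unfolding disjoint_family_on_def bij_betw_def inj_on_def by auto
  qed (use k in \<open>auto simp: bij_betw_def\<close>)
  then have "indep_vars (\<lambda>_. count_space UNIV)
      (\<lambda>i \<omega>. (\<lambda>f. f (k i)) (restrict (\<lambda>j. card (Phi \<omega> \<inter> B (h j))) {k i})) I"
    by (rule indep_vars_compose2) (auto intro: measurable_component_singleton)
  then show ?thesis
    by (subst (asm) indep_vars_cong[of I I _ "\<lambda>i \<omega>. card (Phi \<omega> \<inter> B i)" _ "\<lambda>_. count_space UNIV"]) (auto simp: hk)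
qed

lemma prob_counts_eq:
  assumes fin: "finite I" and B: "\<And>i. i \<in> I \<Longrightarrow> B i \<in> sets lborel \<and> bounded (B i)"
    and dis: "disjoint_family_on B I"
  shows "prob {\<omega>\<in>space M. \<forall>i\<in>I. card (Phi \<omega> \<inter> B i) \<in> N i} =
      (\<Prod>i\<in>I. prob {\<omega>\<in>space M. card (Phi \<omega> \<inter> B i) \<in> N i})"
proof (cases "I = {}")
  case True
  then show ?thesis by (simp add: prob_space)
next
  case False
  have "prob (\<Inter>i\<in>I. (\<lambda>\<omega>. card (Phi \<omega> \<inter> B i)) -` N i \<inter> space M) =
      (\<Prod>i\<in>I. prob ((\<lambda>\<omega>. card (Phi \<omega> \<inter> B i)) -` N i \<inter> space M))"
    by (rule indep_varsD_finite[OF indep_counts[OF assms]]) (use False fin in auto)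
  moreover have "(\<Inter>i\<in>I. (\<lambda>\<omega>. card (Phi \<omega> \<inter> B i)) -` N i \<inter> space M) =
      {\<omega>\<in>space M. \<forall>i\<in>I. card (Phi \<omega> \<inter> B i) \<in> N i}" using False by auto
  moreover have "(\<lambda>\<omega>. card (Phi \<omega> \<inter> B i)) -` N i \<inter> space M = {\<omega>\<in>space M. card (Phi \<omega> \<inter> B i) \<in> N i}" for i
    by auto
  ultimately show ?thesis by simp
qed

lemma prob_nonempty_le:
  assumes B: "B \<in> sets lborel" "bounded B"
  shows "prob {\<omega>\<in>space M. card (Phi \<omega> \<inter> B) \<in> - {0}} \<le> c * measure lborel B"
proof -
  have "prob {\<omega>\<in>space M. card (Phi \<omega> \<inter> B) \<in> - {0}} = 1 - prob {\<omega>\<in>space M. card (Phi \<omega> \<inter> B) = 0}"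
  proof -
    have "{\<omega>\<in>space M. card (Phi \<omega> \<inter> B) = 0} \<in> events" using count_measurable[OF B] by measurable
    moreover have "{\<omega>\<in>space M. card (Phi \<omega> \<inter> B) \<in> - {0}} = space M - {\<omega>\<in>space M. card (Phi \<omega> \<inter> B) = 0}" by auto
    ultimately show ?thesis using prob_compl by simp
  qed
  also have "\<dots> = 1 - exp (- (c * measure lborel B))" using prob_count[OF B, of 0] by simp
  also have "\<dots> \<le> c * measure lborel B" using exp_ge_add_one_self[of "- (c * measure lborel B)"] by simp
  finally show ?thesis .
qed

lemma outer_le_all_nonempty:
  assumes fin: "finite I" and B: "\<And>i. i \<in> I \<Longrightarrow> B i \<in> sets lborel \<and> bounded (B i)"
    and dis: "disjoint_family_on B I"
  shows "outer_le {\<omega>. \<forall>i\<in>I. Phi \<omega> \<inter> B i \<noteq> {}} (\<Prod>i\<in>I. c * measure lborel (B i))"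
  unfolding outer_le_def
proof (intro bexI conjI)
  let ?A = "{\<omega>\<in>space M. \<forall>i\<in>I. card (Phi \<omega> \<inter> B i) \<in> - {0}}"
  show "{\<omega>. \<forall>i\<in>I. Phi \<omega> \<inter> B i \<noteq> {}} \<inter> space M \<subseteq> ?A"
    using locally_finite B by (auto simp: card_eq_0_iff)
  have "prob ?A = (\<Prod>i\<in>I. prob {\<omega>\<in>space M. card (Phi \<omega> \<inter> B i) \<in> - {0}})"
    by (rule prob_counts_eq[OF assms])
  also have "\<dots> \<le> (\<Prod>i\<in>I. c * measure lborel (B i))"
    by (rule prod_mono) (use prob_nonempty_le B in auto)
  finally show "prob ?A \<le> (\<Prod>i\<in>I. c * measure lborel (B i))" .
  have "{\<omega>\<in>space M. card (Phi \<omega> \<inter> B i) \<in> - {0}} \<in> events" if "i \<in> I" for i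
    using measurable_sets[OF count_measurable[of "B i"], of "- {0}"] B[OF that]
    by (simp add: vimage_def Int_def conj_commute)
  then show "?A \<in> events" using fin by (intro sets.sets_Collect_finite_All) auto
qed

end

section \<open>Grid cells\<close>

definition grid :: "real \<Rightarrow> 'a::euclidean_space \<Rightarrow> 'a" where
  "grid h x = (\<Sum>b\<in>Basis. (h * of_int \<lfloor>(x \<bullet> b) / h\<rfloor>) *\<^sub>R b)"

lemma grid_inner: "b \<in> Basis \<Longrightarrow> grid h x \<bullet> b = h * of_int \<lfloor>(x \<bullet> b) / h\<rfloor>"
  by (simp add: grid_def)

lemma grid_0 [simp]: "grid h 0 = 0" by (simp add: grid_def)

lemma dist_grid:
  fixes x :: "'a::euclidean_space"
  assumes "h > 0"
  shows "dist (grid h x) x \<le> real DIM('a) * h"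
proof -
  have "\<bar>(grid h x - x) \<bullet> b\<bar> \<le> h" if "b \<in> Basis" for b
  proof -
    have "(x \<bullet> b) / h = of_int \<lfloor>(x \<bullet> b) / h\<rfloor> + frac ((x \<bullet> b) / h)" by (simp add: frac_def)
    then have "x \<bullet> b = h * of_int \<lfloor>(x \<bullet> b) / h\<rfloor> + h * frac ((x \<bullet> b) / h)"
      using assms by (simp add: field_simps)
    then have "(grid h x - x) \<bullet> b = - (h * frac ((x \<bullet> b) / h))"
      using grid_inner[OF that, of h x] by (simp add: inner_diff_left)
    moreover have "h * frac ((x \<bullet> b) / h) \<le> h * 1"
      using assms frac_lt_1[of "(x \<bullet> b) / h"] by (intro mult_left_mono) auto
    moreover have "0 \<le> h * frac ((x \<bullet> b) / h)" using assms frac_ge_0 by simp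
    ultimately show ?thesis by simp
  qed
  then have "(\<Sum>b\<in>Basis. \<bar>(grid h x - x) \<bullet> b\<bar>) \<le> (\<Sum>b\<in>(Basis :: 'a set). h)" by (rule sum_mono)
  then show ?thesis using norm_le_l1[of "grid h x - x"] by (simp add: dist_norm)
qed

lemma grid_measurable [measurable]: "grid h \<in> borel_measurable borel"
  unfolding grid_def by measurable

lemma grid_points:
  fixes R :: real
  assumes h: "h > 0" and N: "R \<le> h * real N"
  shows "finite (range (grid h) \<inter> cball (0::'a::euclidean_space) R)"
    "card (range (grid h) \<inter> cball (0::'a) R) \<le> (2 * N + 1) ^ DIM('a)"
proof -
  let ?F = "\<lambda>k. \<Sum>b\<in>(Basis::'a set). (h * of_int (k b)) *\<^sub>R b"
  let ?K = "(Basis::'a set) \<rightarrow>\<^sub>E {- int N..int N}"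
  have sub: "range (grid h) \<inter> cball (0::'a) R \<subseteq> ?F ` ?K"
  proof
    fix z assume "z \<in> range (grid h) \<inter> cball (0::'a) R"
    then obtain x where x: "z = grid h x" "norm z \<le> R" by auto
    define k where "k = (\<lambda>b\<in>(Basis::'a set). \<lfloor>(x \<bullet> b) / h\<rfloor>)"
    have "k \<in> ?K"
    proof
      fix b :: 'a assume b: "b \<in> Basis"
      have "\<bar>z \<bullet> b\<bar> \<le> R" using Basis_le_norm[OF b, of z] x(2) by linarith
      then have "h * \<bar>of_int \<lfloor>(x \<bullet> b) / h\<rfloor>\<bar> \<le> R"
        using h by (simp add: x(1) grid_inner[OF b] abs_mult)
      then have "h * \<bar>of_int \<lfloor>(x \<bullet> b) / h\<rfloor>\<bar> \<le> h * real N" using N by linarith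
      then have "\<bar>of_int \<lfloor>(x \<bullet> b) / h\<rfloor>\<bar> \<le> real N" using h by simp
      then have "\<bar>\<lfloor>(x \<bullet> b) / h\<rfloor>\<bar> \<le> int N" by linarith
      then show "k b \<in> {- int N..int N}" using b by (auto simp: k_def)
    qed (simp add: k_def)
    moreover have "z = ?F k" unfolding x(1) grid_def by (intro sum.cong) (auto simp: k_def)
    ultimately show "z \<in> ?F ` ?K" by blast
  qed
  have finK: "finite ?K" by (intro finite_PiE) auto
  then show "finite (range (grid h) \<inter> cball (0::'a) R)" using sub by (meson finite_imageI finite_subset)
  have "card (range (grid h) \<inter> cball (0::'a) R) \<le> card ?K"
    using finK sub by (meson card_image_le card_mono finite_imageI le_trans)
  also have "card ?K = (2 * N + 1) ^ DIM('a)"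
  proof -
    have "nat (2 * int N + 1) = Suc (2 * N)" by linarith
    then show ?thesis by (simp add: card_PiE)
  qed
  finally show "card (range (grid h) \<inter> cball (0::'a) R) \<le> (2 * N + 1) ^ DIM('a)" .
qed

lemma finite_grid:
  assumes "h > 0"
  shows "finite (range (grid h) \<inter> cball (0::'a::euclidean_space) R)"
proof (rule grid_points(1)[OF assms, of R "nat \<lceil>R / h\<rceil>"])
  have "R / h \<le> real (nat \<lceil>R / h\<rceil>)" by linarith
  then show "R \<le> h * real (nat \<lceil>R / h\<rceil>)" using assms by (simp add: field_simps)
qed

definition cell :: "real \<Rightarrow> 'a::euclidean_space \<Rightarrow> 'a set" where "cell h z = grid h -` {z}"

lemma cell_sets: "cell h z \<in> sets lborel"
proof -
  have "grid h -` {z} \<inter> space borel \<in> sets borel" by (rule measurable_sets[OF grid_measurable]) auto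
  then show ?thesis by (simp add: cell_def)
qed

lemma cell_subset:
  fixes z :: "'a::euclidean_space"
  assumes "h > 0"
  shows "cell h z \<subseteq> cball z (real DIM('a) * h)"
  using dist_grid[OF assms] by (auto simp: cell_def)

lemma cell_bounded: "h > 0 \<Longrightarrow> bounded (cell h z)"
  using cell_subset bounded_subset bounded_cball by metis

lemma disjoint_cells: "disjoint_family_on (cell h) Z"
  by (auto simp: disjoint_family_on_def cell_def)

lemma sum_cells_le:
  assumes "finite Z" "C \<in> sets lborel" "bounded C" "\<And>z. z \<in> Z \<Longrightarrow> cell h z \<subseteq> C" "h > 0"
  shows "(\<Sum>z\<in>Z. measure lborel (cell h z)) \<le> measure lborel C"
proof -
  have f: "B \<in> fmeasurable lborel" if "B \<in> sets lborel" "bounded B" for B :: "'a set"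
    using that emeasure_bounded_finite by (auto simp: fmeasurable_def)
  have "(\<Sum>z\<in>Z. measure lborel (cell h z)) = measure lborel (\<Union>z\<in>Z. cell h z)"
    by (rule measure_finite_Union[symmetric])
      (use assms disjoint_cells cell_sets emeasure_bounded_finite[OF cell_bounded] in \<open>auto simp: less_top\<close>)
  also have "\<dots> \<le> measure lborel C"
  proof (rule measure_mono_fmeasurable)
    show "(\<Union>z\<in>Z. cell h z) \<in> sets lborel" by (rule sets.finite_UN) (use assms cell_sets in auto)
  qed (use assms f in auto)
  finally show ?thesis .
qed

lemma power_diff_le:
  fixes a b B :: real
  assumes "0 \<le> a" "a \<le> b" "b \<le> B" "1 \<le> B"
  shows "b ^ n - a ^ n \<le> n * B ^ n * (b - a)"
proof (induction n)
  case (Suc n)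
  have B: "1 \<le> B ^ n" using assms by simp
  have 1: "b * (b ^ n - a ^ n) \<le> B * (n * B ^ n * (b - a))"
  proof (rule order_trans)
    show "b * (b ^ n - a ^ n) \<le> b * (n * B ^ n * (b - a))" using Suc assms by (intro mult_left_mono) auto
    show "b * (n * B ^ n * (b - a)) \<le> B * (n * B ^ n * (b - a))" using assms by (intro mult_right_mono) auto
  qed
  have "a ^ n \<le> B ^ n" using assms by (intro power_mono) auto
  also have "B ^ n \<le> B * B ^ n" using assms B by simp
  finally have 2: "a ^ n * (b - a) \<le> B * B ^ n * (b - a)" using assms by (intro mult_right_mono) auto
  have "b ^ Suc n - a ^ Suc n = b * (b ^ n - a ^ n) + a ^ n * (b - a)" by (simp add: algebra_simps)
  also have "\<dots> \<le> B * (n * B ^ n * (b - a)) + B * B ^ n * (b - a)" using 1 2 by linarith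
  also have "\<dots> = Suc n * B ^ Suc n * (b - a)" by (simp add: algebra_simps)
  finally show ?case .
qed simp

lemma measure_shell_le:
  fixes p :: "'a::euclidean_space" and a b B :: real
  assumes "a \<le> b" "0 \<le> b" "b \<le> B" "1 \<le> B"
  shows "measure lborel {x. a \<le> dist p x \<and> dist p x \<le> b}
      \<le> unit_ball_vol (DIM('a)) * (DIM('a) * B ^ DIM('a) * (b - a))"
proof -
  define a' where "a' = max 0 a"
  have a': "0 \<le> a'" "a' \<le> b" "a \<le> a'" using assms by (auto simp: a'_def)
  have "{x. a \<le> dist p x \<and> dist p x \<le> b} = cball p b - ball p a'"
    by (auto simp: a'_def not_less less_max_iff_disj)
  then have "measure lborel {x. a \<le> dist p x \<and> dist p x \<le> b} = measure lborel (cball p b) - measure lborel (ball p a')"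
    using a' emeasure_bounded_finite[OF bounded_cball, of p b]
    by (simp add: measurable_measure_Diff fmeasurable_def subset_iff)
  also have "\<dots> = unit_ball_vol (DIM('a)) * (b ^ DIM('a) - a' ^ DIM('a))"
    using assms a' by (simp add: content_cball content_ball algebra_simps)
  also have "\<dots> \<le> unit_ball_vol (DIM('a)) * (DIM('a) * B ^ DIM('a) * (b - a'))"
    using assms a' by (intro mult_left_mono power_diff_le) auto
  also have "\<dots> \<le> unit_ball_vol (DIM('a)) * (DIM('a) * B ^ DIM('a) * (b - a))"
    using assms a' by (intro mult_left_mono) auto
  finally show ?thesis .
qed

lemma sets_shell: "{x. a \<le> dist p x \<and> dist p x \<le> b} \<in> sets lborel"
proof -
  have "{x. a \<le> dist p x \<and> dist p x \<le> b} = cball p b - ball p a" by auto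
  then show ?thesis by simp
qed

context poisson_process begin

definition wt :: "real \<Rightarrow> 'a \<Rightarrow> real" where "wt h z = c * measure lborel (cell h z)"

definition occ :: "real \<Rightarrow> 'b \<Rightarrow> 'a set" where "occ h \<omega> = grid h ` Phi \<omega>"

lemma wt_nonneg: "wt h z \<ge> 0" using c_pos by (simp add: wt_def)

lemma outer_le_occ:
  assumes "finite Z" "h > 0"
  shows "outer_le {\<omega>. Z \<subseteq> occ h \<omega>} (\<Prod>z\<in>Z. wt h z)"
proof (rule outer_le_mono)
  show "outer_le {\<omega>. \<forall>z\<in>Z. Phi \<omega> \<inter> cell h z \<noteq> {}} (\<Prod>z\<in>Z. wt h z)"
    unfolding wt_def by (rule outer_le_all_nonempty) (use assms cell_sets cell_bounded disjoint_cells in auto)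
  show "{\<omega>. Z \<subseteq> occ h \<omega>} \<inter> space M \<subseteq> {\<omega>. \<forall>z\<in>Z. Phi \<omega> \<inter> cell h z \<noteq> {}}"
    by (force simp: occ_def cell_def)
qed simp

lemma sum_wt_shell:
  assumes "finite Z" "h > 0" "\<And>z. z \<in> Z \<Longrightarrow> a \<le> dist p z \<and> dist p z \<le> b"
    and "a \<le> b" "0 \<le> b" "b + real DIM('a) * h \<le> B" "1 \<le> B"
  shows "(\<Sum>z\<in>Z. wt h z) \<le> c * unit_ball_vol (DIM('a)) * DIM('a) * B ^ DIM('a) * (b - a + 2 * real DIM('a) * h)"
proof -
  let ?e = "real DIM('a) * h"
  let ?C = "{x. a - ?e \<le> dist p x \<and> dist p x \<le> b + ?e}"
  have e: "?e \<ge> 0" using assms by simp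
  have "cell h z \<subseteq> ?C" if "z \<in> Z" for z
  proof
    fix x assume "x \<in> cell h z"
    then have "dist z x \<le> ?e" using cell_subset[OF assms(2), of z] by auto
    then show "x \<in> ?C" using assms(3)[OF that] dist_triangle[of p x z] dist_triangle2[of p z x]
      by (auto simp: dist_commute)
  qed
  moreover have "bounded ?C" by (rule bounded_subset[OF bounded_cball[of p "b + ?e"]]) auto
  ultimately have "(\<Sum>z\<in>Z. measure lborel (cell h z)) \<le> measure lborel ?C"
    by (intro sum_cells_le) (use assms sets_shell in auto)
  also have "\<dots> \<le> unit_ball_vol (DIM('a)) * (DIM('a) * B ^ DIM('a) * (b + ?e - (a - ?e)))"
    by (rule measure_shell_le) (use assms(4-7) e in linarith)+
  finally have "c * (\<Sum>z\<in>Z. measure lborel (cell h z)) \<le> c * (unit_ball_vol (DIM('a)) * (DIM('a) * B ^ DIM('a) * (b + ?e - (a - ?e))))"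
    using c_pos by (intro mult_left_mono) auto
  then show ?thesis by (simp add: wt_def sum_distrib_left algebra_simps)
qed

lemma sum_wt_ball:
  assumes "finite Z" "h > 0" "\<And>z. z \<in> Z \<Longrightarrow> dist p z \<le> b" "0 \<le> b" "b + real DIM('a) * h \<le> B"
  shows "(\<Sum>z\<in>Z. wt h z) \<le> c * unit_ball_vol (DIM('a)) * B ^ DIM('a)"
proof -
  let ?e = "real DIM('a) * h"
  have e: "?e \<ge> 0" using assms by simp
  have "cell h z \<subseteq> cball p B" if "z \<in> Z" for z
  proof
    fix x assume "x \<in> cell h z"
    then have "dist z x \<le> ?e" using cell_subset[OF assms(2), of z] by auto
    then show "x \<in> cball p B" using assms(3)[OF that] assms(5) dist_triangle[of p x z] by auto
  qed
  then have "(\<Sum>z\<in>Z. measure lborel (cell h z)) \<le> measure lborel (cball p B)"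
    by (intro sum_cells_le) (use assms in auto)
  also have "\<dots> = unit_ball_vol (DIM('a)) * B ^ DIM('a)" using assms e by (intro content_cball) linarith
  finally have "c * (\<Sum>z\<in>Z. measure lborel (cell h z)) \<le> c * (unit_ball_vol (DIM('a)) * B ^ DIM('a))"
    using c_pos by (intro mult_left_mono) auto
  then show ?thesis by (simp add: wt_def sum_distrib_left algebra_simps)
qed

end

section \<open>Absence of ties\<close>

definition mesh :: "nat \<Rightarrow> real" where "mesh n = inverse (real (Suc n))"

lemma mesh_pos: "mesh n > 0" by (simp add: mesh_def)

lemma mesh_tendsto: "(\<lambda>n. C * mesh n) \<longlonglongrightarrow> 0"
  using tendsto_mult_right_zero[OF LIMSEQ_inverse_real_of_nat] by (simp add: mesh_def)

lemma eventually_mesh: "e > 0 \<Longrightarrow> eventually (\<lambda>n. C * mesh n < e) sequentially"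
  using order_tendstoD(2)[OF mesh_tendsto] by blast

lemma grid_neq:
  fixes x y :: "'a::euclidean_space"
  assumes "h > 0" "2 * real DIM('a) * h < dist x y"
  shows "grid h x \<noteq> grid h y"
  using dist_grid[OF assms(1), of x] dist_grid[OF assms(1), of y] assms(2)
    dist_triangle3[of x y "grid h x"] by auto

lemma dist_grid_diff:
  fixes x y :: "'a::euclidean_space"
  assumes "h > 0"
  shows "\<bar>dist (grid h x) (grid h y) - dist x y\<bar> \<le> 2 * real DIM('a) * h"
proof -
  have "dist (grid h x) (grid h y) \<le> dist (grid h x) x + dist x y + dist y (grid h y)"
    using dist_triangle[of "grid h x" "grid h y" x] dist_triangle[of x "grid h y" y] by linarith
  moreover have "dist x y \<le> dist x (grid h x) + dist (grid h x) (grid h y) + dist (grid h y) y"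
    using dist_triangle[of x y "grid h x"] dist_triangle[of "grid h x" y "grid h y"] by linarith
  ultimately show ?thesis
    using dist_grid[OF assms, of x] dist_grid[OF assms, of y] by (simp add: dist_commute)
qed

lemma norm_grid_le:
  fixes x :: "'a::euclidean_space"
  assumes "h > 0"
  shows "norm (grid h x) \<le> norm x + real DIM('a) * h"
  using dist_grid[OF assms, of x] norm_triangle_ineq2[of "grid h x" x] by (simp add: dist_norm)

context poisson_process begin

definition lat :: "real \<Rightarrow> real \<Rightarrow> 'a set" where "lat h R = range (grid h) \<inter> cball 0 R"

lemma finite_lat: "h > 0 \<Longrightarrow> finite (lat h R)" unfolding lat_def by (rule finite_grid)

lemma sum_wt_lat:
  assumes "h > 0" "0 \<le> R" "real DIM('a) * h \<le> 1"
  shows "(\<Sum>z\<in>lat h R. wt h z) \<le> c * unit_ball_vol (DIM('a)) * (R + 1) ^ DIM('a)"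
  by (rule sum_wt_ball[where p = 0 and b = R]) (use assms finite_lat in \<open>auto simp: lat_def\<close>)

definition tie_set :: "real \<Rightarrow> 'b set" where
  "tie_set R = {\<omega>. \<exists>v\<in>Phi \<omega>. \<exists>u\<in>Phi \<omega> \<union> {0}. \<exists>x\<in>Phi \<omega> \<union> {0}. \<exists>y\<in>Phi \<omega> \<union> {0}.
     v \<notin> {u, x, y} \<and> norm v \<le> R \<and> norm u \<le> R \<and> norm x \<le> R \<and> norm y \<le> R \<and> dist u v = dist x y}"

definition grid_tie :: "real \<Rightarrow> real \<Rightarrow> 'b set" where
  "grid_tie h R = (\<Union>Z\<in>{Z \<in> Pow (lat h (R + 1)). card Z \<le> 3}.
     \<Union>(u, x, y)\<in>insert 0 Z \<times> insert 0 Z \<times> insert 0 Z.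
     \<Union>v\<in>{v \<in> lat h (R + 1) - Z. dist x y - 4 * real DIM('a) * h \<le> dist u v \<and> dist u v \<le> dist x y + 4 * real DIM('a) * h}.
       {\<omega>. insert v Z \<subseteq> occ h \<omega>})"

lemma outer_le_grid_tie:
  assumes h: "h > 0" "real DIM('a) * h \<le> 1" and R: "R \<ge> 0"
  shows "outer_le (grid_tie h R) (exp (c * unit_ball_vol (DIM('a)) * (R + 2) ^ DIM('a)) *
     (64 * (c * unit_ball_vol (DIM('a)) * DIM('a) * (2 * R + 7) ^ DIM('a) * (10 * DIM('a)))) * h)"
proof -
  let ?L = "lat h (R + 1)" and ?d = "real DIM('a)"
  let ?ZZ = "{Z \<in> Pow ?L. card Z \<le> 3}"
  let ?V = "\<lambda>Z u x y. {v \<in> ?L - Z. dist x y - 4 * ?d * h \<le> dist u v \<and> dist u v \<le> dist x y + 4 * ?d * h}"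
  define s where "s = c * unit_ball_vol (DIM('a)) * DIM('a) * (2 * R + 7) ^ DIM('a) * (10 * ?d * h)"
  have fL: "finite ?L" using finite_lat h by blast
  have s: "s \<ge> 0" using c_pos h R by (simp add: s_def)
  have W: "0 \<le> (\<Prod>z\<in>Z. wt h z)" for Z by (intro prod_nonneg) (simp add: wt_nonneg)
  have one: "outer_le (\<Union>v\<in>?V Z u x y. {\<omega>. insert v Z \<subseteq> occ h \<omega>}) ((\<Prod>z\<in>Z. wt h z) * s)"
    if Z: "Z \<in> ?ZZ" and t: "u \<in> insert 0 Z" "x \<in> insert 0 Z" "y \<in> insert 0 Z" for Z u x y
  proof -
    have fZ: "finite Z" using Z fL finite_subset by auto
    have "outer_le (\<Union>v\<in>?V Z u x y. {\<omega>. insert v Z \<subseteq> occ h \<omega>}) (\<Sum>v\<in>?V Z u x y. (\<Prod>z\<in>Z. wt h z) * wt h v)"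
    proof (rule outer_le_UN)
      show "outer_le {\<omega>. insert v Z \<subseteq> occ h \<omega>} ((\<Prod>z\<in>Z. wt h z) * wt h v)" if "v \<in> ?V Z u x y" for v
        using outer_le_occ[of "insert v Z" h] fZ that h by (simp add: mult.commute)
    qed (use fL in auto)
    moreover have "(\<Sum>v\<in>?V Z u x y. wt h v) \<le> s"
    proof -
      have nb: "norm w \<le> R + 1" if "w \<in> insert 0 Z" for w using that Z R by (auto simp: lat_def)
      have "dist x y \<le> 2 * R + 2" using nb[OF t(2)] nb[OF t(3)] norm_triangle_ineq4[of x y] by (simp add: dist_norm)
      then have "dist x y + 4 * ?d * h + ?d * h \<le> 2 * R + 7" using h by linarith
      then have "(\<Sum>v\<in>?V Z u x y. wt h v) \<le> c * unit_ball_vol (DIM('a)) * DIM('a) * (2 * R + 7) ^ DIM('a) *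
          ((dist x y + 4 * ?d * h) - (dist x y - 4 * ?d * h) + 2 * ?d * h)"
        by (intro sum_wt_shell[where p = u]) (use h R fL in \<open>auto intro: add_nonneg_nonneg\<close>)
      then show ?thesis by (simp add: s_def algebra_simps)
    qed
    ultimately show ?thesis
      using W by (elim outer_le_mono) (auto simp: sum_distrib_left[symmetric] intro: mult_left_mono)
  qed
  have two: "outer_le (\<Union>(u, x, y)\<in>insert 0 Z \<times> insert 0 Z \<times> insert 0 Z.
      \<Union>v\<in>?V Z u x y. {\<omega>. insert v Z \<subseteq> occ h \<omega>}) ((\<Prod>z\<in>Z. wt h z) * (64 * s))" if Z: "Z \<in> ?ZZ" for Z
  proof -
    define I where "I = insert 0 Z"
    let ?T = "I \<times> I \<times> I"
    have fZ: "finite Z" using Z fL finite_subset by auto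
    have cZ: "card I \<le> 4" "finite I" using card_insert_le_m1[of 4 Z 0] Z fZ by (auto simp: I_def)
    have "card ?T = card I * (card I * card I)"
      by (simp add: card_cartesian_product)
    also have "\<dots> \<le> 4 * (4 * 4)" using cZ by (intro mult_le_mono) auto
    finally have cT: "real (card ?T) \<le> 64" by linarith
    have "outer_le (\<Union>(u, x, y)\<in>?T. \<Union>v\<in>?V Z u x y. {\<omega>. insert v Z \<subseteq> occ h \<omega>}) (\<Sum>t\<in>?T. (\<Prod>z\<in>Z. wt h z) * s)"
      by (rule outer_le_UN) (use cZ(2) one[OF Z, folded I_def] in auto)
    moreover have "(\<Sum>t\<in>?T. (\<Prod>z\<in>Z. wt h z) * s) \<le> (\<Prod>z\<in>Z. wt h z) * (64 * s)"
      using mult_right_mono[OF cT, of "(\<Prod>z\<in>Z. wt h z) * s"] W s by (simp add: mult_ac)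
    ultimately show ?thesis unfolding I_def[symmetric] by (elim outer_le_mono) auto
  qed
  have "outer_le (grid_tie h R) (\<Sum>Z\<in>?ZZ. (\<Prod>z\<in>Z. wt h z) * (64 * s))"
    unfolding grid_tie_def by (rule outer_le_UN[OF _ two]) (use fL in auto)
  moreover have "(\<Sum>Z\<in>?ZZ. (\<Prod>z\<in>Z. wt h z)) \<le> exp (c * unit_ball_vol (DIM('a)) * (R + 2) ^ DIM('a))"
  proof -
    have "(\<Sum>Z\<in>?ZZ. (\<Prod>z\<in>Z. wt h z)) \<le> (\<Sum>Z\<in>Pow ?L. (\<Prod>z\<in>Z. wt h z))"
      by (rule sum_mono2) (use fL W in auto)
    also have "\<dots> = (\<Prod>z\<in>?L. wt h z + 1)" using prod_add[OF fL, of "wt h" "\<lambda>_. 1"] by simp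
    also have "\<dots> \<le> (\<Prod>z\<in>?L. exp (wt h z))"
      by (rule prod_mono) (use wt_nonneg exp_ge_add_one_self in \<open>auto simp: add.commute add_nonneg_nonneg\<close>)
    also have "\<dots> = exp (\<Sum>z\<in>?L. wt h z)" by (rule exp_sum[OF fL, symmetric])
    also have "\<dots> \<le> exp (c * unit_ball_vol (DIM('a)) * (R + 2) ^ DIM('a))"
      using sum_wt_lat[of h "R + 1"] h R by (simp add: add.assoc)
    finally show ?thesis .
  qed
  then have "(\<Sum>Z\<in>?ZZ. (\<Prod>z\<in>Z. wt h z) * (64 * s)) \<le> exp (c * unit_ball_vol (DIM('a)) * (R + 2) ^ DIM('a)) * (64 * s)"
    unfolding sum_distrib_right[symmetric] using s by (intro mult_right_mono) auto
  ultimately show ?thesis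
    by (elim outer_le_mono) (simp_all add: s_def mult_ac)
qed

lemma tie_set_eventually_grid:
  assumes "\<omega> \<in> tie_set R"
  shows "eventually (\<lambda>n. \<omega> \<in> grid_tie (mesh n) R) sequentially"
proof -
  let ?d = "real DIM('a)"
  obtain v u x y where v: "v \<in> Phi \<omega>" and t: "u \<in> Phi \<omega> \<union> {0}" "x \<in> Phi \<omega> \<union> {0}" "y \<in> Phi \<omega> \<union> {0}"
    and nv: "v \<notin> {u, x, y}" and nm: "norm v \<le> R" "norm u \<le> R" "norm x \<le> R" "norm y \<le> R"
    and e: "dist u v = dist x y"
    using assms unfolding tie_set_def by blast
  define r where "r = min (dist v u) (min (dist v x) (dist v y))"
  have r: "r > 0" using nv by (auto simp: r_def)
  have "eventually (\<lambda>n. 2 * ?d * mesh n < r \<and> ?d * mesh n < 1) sequentially"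
    by (intro eventually_conj eventually_mesh r) auto
  then show ?thesis
  proof eventually_elim
    fix n assume n: "2 * ?d * mesh n < r \<and> ?d * mesh n < 1"
    let ?h = "mesh n"
    note h = mesh_pos[of n]
    define Z where "Z = grid ?h ` ({u, x, y} - {0})"
    have inL: "grid ?h w \<in> lat ?h (R + 1)" if "norm w \<le> R" for w
      using norm_grid_le[OF h, of w] n that by (auto simp: lat_def)
    have ZL: "Z \<subseteq> lat ?h (R + 1)" using inL nm by (auto simp: Z_def)
    have "card ({u, x, y} - {0}) \<le> card {u, x, y}" by (intro card_mono) auto
    also have "\<dots> \<le> 3" by (auto simp: card_insert_if)
    finally have cZ: "card Z \<le> 3" unfolding Z_def by (meson card_image_le finite.emptyI finite.insertI finite_Diff order_trans)
    have vZ: "grid ?h v \<notin> Z"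
    proof
      assume "grid ?h v \<in> Z"
      then obtain w where w: "w \<in> {u, x, y}" "grid ?h v = grid ?h w" by (auto simp: Z_def)
      have "2 * ?d * ?h < dist v w" using n w(1) by (auto simp: r_def)
      then show False using grid_neq[OF h] w(2) by blast
    qed
    have T: "grid ?h w \<in> insert 0 Z" if "w \<in> {u, x, y}" for w
      using that by (cases "w = 0") (auto simp: Z_def)
    have "\<bar>dist (grid ?h u) (grid ?h v) - dist (grid ?h x) (grid ?h y)\<bar> \<le> 4 * ?d * ?h"
      using dist_grid_diff[OF h, of u v] dist_grid_diff[OF h, of x y] e by linarith
    then have sh: "dist (grid ?h x) (grid ?h y) - 4 * ?d * ?h \<le> dist (grid ?h u) (grid ?h v)"
      "dist (grid ?h u) (grid ?h v) \<le> dist (grid ?h x) (grid ?h y) + 4 * ?d * ?h" by linarith+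
    have oc: "insert (grid ?h v) Z \<subseteq> occ ?h \<omega>" using v t by (auto simp: Z_def occ_def)
    show "\<omega> \<in> grid_tie ?h R"
      unfolding grid_tie_def
    proof (intro UN_I)
      show "Z \<in> {Z \<in> Pow (lat ?h (R + 1)). card Z \<le> 3}" using ZL cZ by simp
      show "(grid ?h u, grid ?h x, grid ?h y) \<in> insert 0 Z \<times> insert 0 Z \<times> insert 0 Z" using T by auto
      show "\<omega> \<in> (case (grid ?h u, grid ?h x, grid ?h y) of (u, x, y) \<Rightarrow>
          \<Union>v\<in>{v \<in> lat ?h (R + 1) - Z. dist x y - 4 * ?d * ?h \<le> dist u v \<and> dist u v \<le> dist x y + 4 * ?d * ?h}.
            {\<omega>. insert v Z \<subseteq> occ ?h \<omega>})"
        using sh oc vZ inL[OF nm(1)] by auto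
    qed
  qed
qed

lemma AE_no_tie_set: "AE \<omega> in M. \<omega> \<notin> tie_set (real R)"
proof (rule AE_not_outer_null)
  fix e :: real assume e: "e > 0"
  define C where "C = exp (c * unit_ball_vol (DIM('a)) * (real R + 2) ^ DIM('a)) *
     (64 * (c * unit_ball_vol (DIM('a)) * DIM('a) * (2 * real R + 7) ^ DIM('a) * (10 * DIM('a))))"
  have "eventually (\<lambda>n. C * mesh n < e \<and> real DIM('a) * mesh n < 1) sequentially"
    by (intro eventually_conj eventually_mesh e) auto
  then obtain s0 where s0: "\<And>n. n \<ge> s0 \<Longrightarrow> C * mesh n < e \<and> real DIM('a) * mesh n < 1"
    unfolding eventually_sequentially by blast
  show "outer_le (tie_set (real R)) e"
  proof (rule outer_le_liminf[where k = s0 and E = "\<lambda>n. grid_tie (mesh n) (real R)"])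
    fix n assume "s0 \<le> n"
    then show "outer_le (grid_tie (mesh n) (real R)) e"
      using outer_le_mono[OF outer_le_grid_tie[OF mesh_pos, of n "real R"], of "grid_tie (mesh n) (real R)" e] s0[of n]
      by (auto simp: C_def)
  qed (rule tie_set_eventually_grid)
qed

lemma AE_no_ties: "AE \<omega> in M. no_ties (Phi \<omega> \<union> {0})"
proof -
  have "AE \<omega> in M. \<forall>R::nat. \<omega> \<notin> tie_set (real R)" using AE_no_tie_set by (simp add: AE_all_countable)
  then show ?thesis
  proof eventually_elim
    fix \<omega> assume nt: "\<forall>R::nat. \<omega> \<notin> tie_set (real R)"
    let ?P = "Phi \<omega> \<union> {0}"
    have key: False if "p \<in> ?P" "p \<noteq> 0" "p' \<in> ?P" "q \<in> ?P" "q' \<in> ?P" "dist p' p = dist q q'" "p \<notin> {p', q, q'}" for p p' q q'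
    proof -
      obtain R :: nat where R: "norm p + norm p' + norm q + norm q' \<le> real R" using real_arch_simple by blast
      have "norm p \<le> real R" "norm p' \<le> real R" "norm q \<le> real R" "norm q' \<le> real R"
        using R norm_ge_zero[of p] norm_ge_zero[of p'] norm_ge_zero[of q] norm_ge_zero[of q'] by linarith+
      then have "\<omega> \<in> tie_set (real R)" unfolding tie_set_def using that by blast
      then show False using nt by blast
    qed
    show "no_ties ?P"
      unfolding no_ties_def
    proof (intro ballI impI, rule ccontr)
      fix u v x y assume P: "u \<in> ?P" "v \<in> ?P" "x \<in> ?P" "y \<in> ?P" and uv: "u \<noteq> v \<and> dist u v = dist x y"
        and ne: "{u, v} \<noteq> {x, y}"
      have xy: "x \<noteq> y" using uv by auto
      have a: "w = 0 \<or> w \<in> {x, y}" if "w \<in> {u, v}" for w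
        using that key[of u v x y] key[of v u x y] P uv by (auto simp: dist_commute)
      have b: "w = 0 \<or> w \<in> {u, v}" if "w \<in> {x, y}" for w
        using that key[of x y u v] key[of y x u v] P uv xy by (auto simp: dist_commute)
      show False using a[of u] a[of v] b[of x] b[of y] ne uv xy by auto
    qed
  qed
qed

end

section \<open>Absence of long chains\<close>

context poisson_process begin

definition run_set :: "real \<Rightarrow> real \<Rightarrow> real \<Rightarrow> nat \<Rightarrow> real \<Rightarrow> 'b set" where
  "run_set m a b l R = {\<omega>. \<exists>u v.
     (\<forall>i\<le>l. u i \<in> Phi \<omega> \<and> v i \<in> Phi \<omega> \<and> norm (u i) \<le> R \<and> norm (v i) \<le> R \<and> dist (u i) (v i) \<le> m) \<and>
     (\<forall>i<l. a \<le> dist (v i) (u (Suc i)) \<and> dist (v i) (u (Suc i)) \<le> b) \<and>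
     (\<forall>i\<le>l. \<forall>j\<le>l. i \<noteq> j \<longrightarrow> {u i, v i} \<inter> {u j, v j} = {})}"

primrec cell_path :: "real \<Rightarrow> 'a set \<Rightarrow> real \<Rightarrow> real \<Rightarrow> real \<Rightarrow> 'b \<Rightarrow> nat \<Rightarrow> 'a \<Rightarrow> 'a set \<Rightarrow> bool" where
  "cell_path h L a b m \<omega> 0 = (\<lambda>z X. True)"
| "cell_path h L a b m \<omega> (Suc l) = (\<lambda>z X. \<exists>x\<in>{x \<in> L - X. a \<le> dist z x \<and> dist z x \<le> b}. x \<in> occ h \<omega> \<and>
     (cell_path h L a b m \<omega> l x (insert x X) \<or>
      (\<exists>y\<in>{y \<in> L - insert x X. dist x y \<le> m}. y \<in> occ h \<omega> \<and> cell_path h L a b m \<omega> l y (insert y (insert x X)))))"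

text \<open>
  \<open>X\<close> collects the cells already visited, so that each new cell contributes an independent factor.
\<close>

lemma outer_le_cell_path:
  assumes L: "finite L" "h > 0"
    and al: "\<And>z. (\<Sum>x\<in>{x \<in> L. a \<le> dist z x \<and> dist z x \<le> b}. wt h x) \<le> \<alpha>"
    and be: "\<And>x. (\<Sum>y\<in>{y \<in> L. dist x y \<le> m}. wt h y) \<le> \<beta>"
    and X: "finite X"
  shows "outer_le {\<omega>. X \<subseteq> occ h \<omega> \<and> cell_path h L a b m \<omega> l z X} ((\<Prod>x\<in>X. wt h x) * (\<alpha> * (1 + \<beta>)) ^ l)"
  using X
proof (induction l arbitrary: z X)
  case 0
  then show ?case using outer_le_occ[OF 0 L(2)] by simp
next
  case (Suc l)
  have pos: "0 \<le> \<alpha>" "0 \<le> \<beta>"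
    using al[of z] be[of z] sum_nonneg[of _ "wt h"] wt_nonneg by (meson order_trans)+
  define lam where "lam = \<alpha> * (1 + \<beta>)"
  have lam: "0 \<le> lam" using pos by (simp add: lam_def)
  define W where "W = (\<Prod>x\<in>X. wt h x)"
  have W: "0 \<le> W" unfolding W_def by (intro prod_nonneg) (simp add: wt_nonneg)
  define A where "A = {x \<in> L - X. a \<le> dist z x \<and> dist z x \<le> b}"
  define B where "B x = {y \<in> L - insert x X. dist x y \<le> m}" for x
  define E where "E Y y = {\<omega>. Y \<subseteq> occ h \<omega> \<and> cell_path h L a b m \<omega> l y Y}" for Y y
  have fin: "finite A" "finite (B x)" for x using L by (auto simp: A_def B_def)
  have sA: "(\<Sum>x\<in>A. wt h x) \<le> \<alpha>"
    by (rule order_trans[OF sum_mono2 al[of z]]) (use L wt_nonneg in \<open>auto simp: A_def\<close>)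
  have sB: "(\<Sum>y\<in>B x. wt h y) \<le> \<beta>" for x
    by (rule order_trans[OF sum_mono2 be[of x]]) (use L wt_nonneg in \<open>auto simp: B_def\<close>)
  have o1: "outer_le (\<Union>x\<in>A. E (insert x X) x \<union> (\<Union>y\<in>B x. E (insert y (insert x X)) y))
      (\<Sum>x\<in>A. wt h x * W * lam ^ l + (\<Sum>y\<in>B x. wt h y * (wt h x * W) * lam ^ l))"
  proof (intro outer_le_UN outer_le_Un fin)
    fix x assume x: "x \<in> A"
    have "outer_le (E (insert x X) x) ((\<Prod>x\<in>insert x X. wt h x) * lam ^ l)"
      unfolding E_def lam_def by (rule Suc.IH) (use Suc.prems in auto)
    moreover have "(\<Prod>x\<in>insert x X. wt h x) = wt h x * W"
      using x Suc.prems by (simp add: A_def W_def)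
    ultimately show "outer_le (E (insert x X) x) (wt h x * W * lam ^ l)" by simp
    fix y assume y: "y \<in> B x"
    have "outer_le (E (insert y (insert x X)) y) ((\<Prod>x\<in>insert y (insert x X). wt h x) * lam ^ l)"
      unfolding E_def lam_def by (rule Suc.IH) (use Suc.prems in auto)
    moreover have "(\<Prod>x\<in>insert y (insert x X). wt h x) = wt h y * (wt h x * W)"
    proof -
      have "y \<notin> insert x X" "x \<notin> X" using x y by (auto simp: A_def B_def)
      then show ?thesis using Suc.prems by (simp add: W_def)
    qed
    ultimately show "outer_le (E (insert y (insert x X)) y) (wt h y * (wt h x * W) * lam ^ l)" by simp
  qed
  have o2: "(\<Sum>x\<in>A. wt h x * W * lam ^ l + (\<Sum>y\<in>B x. wt h y * (wt h x * W) * lam ^ l)) \<le> W * lam ^ Suc l"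
  proof -
    have "(\<Sum>y\<in>B x. wt h y * (wt h x * W) * lam ^ l) \<le> \<beta> * (wt h x * W * lam ^ l)" for x
    proof -
      have "(\<Sum>y\<in>B x. wt h y * (wt h x * W) * lam ^ l) = (\<Sum>y\<in>B x. wt h y) * (wt h x * W * lam ^ l)"
        by (simp only: sum_distrib_right mult.assoc)
      also have "\<dots> \<le> \<beta> * (wt h x * W * lam ^ l)"
        using sB W lam wt_nonneg by (intro mult_right_mono) auto
      finally show ?thesis .
    qed
    then have "(\<Sum>x\<in>A. wt h x * W * lam ^ l + (\<Sum>y\<in>B x. wt h y * (wt h x * W) * lam ^ l)) \<le>
        (\<Sum>x\<in>A. wt h x * W * lam ^ l + \<beta> * (wt h x * W * lam ^ l))" by (intro sum_mono) simp
    also have "\<dots> = (\<Sum>x\<in>A. wt h x) * ((1 + \<beta>) * W * lam ^ l)"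
      unfolding sum_distrib_right by (intro sum.cong) (simp_all add: algebra_simps)
    also have "\<dots> \<le> \<alpha> * ((1 + \<beta>) * W * lam ^ l)"
      using sA W lam pos by (intro mult_right_mono) auto
    finally show ?thesis by (simp add: lam_def mult_ac)
  qed
  have o3: "{\<omega>. X \<subseteq> occ h \<omega> \<and> cell_path h L a b m \<omega> (Suc l) z X} \<inter> space M
      \<subseteq> (\<Union>x\<in>A. E (insert x X) x \<union> (\<Union>y\<in>B x. E (insert y (insert x X)) y))"
    unfolding E_def A_def B_def by auto
  show ?case using outer_le_mono[OF o1 o3 o2] unfolding W_def lam_def .
qed

lemma run_set_eventually_cell_path:
  assumes "\<omega> \<in> run_set m a b l R"
  shows "eventually (\<lambda>n. \<exists>z\<in>lat (mesh n) (R + 1). {z} \<subseteq> occ (mesh n) \<omega> \<and>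
      cell_path (mesh n) (lat (mesh n) (R + 1)) (a - 2 * real DIM('a) * mesh n) (b + 2 * real DIM('a) * mesh n)
        (m + 2 * real DIM('a) * mesh n) \<omega> l z {z}) sequentially"
proof -
  let ?d = "real DIM('a)"
  obtain u v where H:
    "\<forall>i\<le>l. u i \<in> Phi \<omega> \<and> v i \<in> Phi \<omega> \<and> norm (u i) \<le> R \<and> norm (v i) \<le> R \<and> dist (u i) (v i) \<le> m"
    "\<forall>i<l. a \<le> dist (v i) (u (Suc i)) \<and> dist (v i) (u (Suc i)) \<le> b"
    "\<forall>i\<le>l. \<forall>j\<le>l. i \<noteq> j \<longrightarrow> {u i, v i} \<inter> {u j, v j} = {}"
    using assms unfolding run_set_def by (elim CollectE exE conjE) (rule that)
  note P = H(1)[rule_format] and st = H(2)[rule_format] and dj = H(3)[rule_format]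
  define Q where "Q = u ` {..l} \<union> v ` {..l}"
  define D where "D = {dist p q | p q. p \<in> Q \<and> q \<in> Q \<and> p \<noteq> q}"
  have "D = (\<lambda>(p, q). dist p q) ` {(p, q) \<in> Q \<times> Q. p \<noteq> q}" by (auto simp: D_def)
  moreover have "finite {(p, q) \<in> Q \<times> Q. p \<noteq> q}" by (rule finite_subset[of _ "Q \<times> Q"]) (auto simp: Q_def)
  ultimately have finD: "finite D" by simp
  define r where "r = Min (insert 1 D)"
  have r: "r > 0" using finD by (auto simp: r_def D_def)
  have rle: "r \<le> dist p q" if "p \<in> Q" "q \<in> Q" "p \<noteq> q" for p q
    unfolding r_def using finD that by (intro Min_le) (auto simp: D_def)
  have "eventually (\<lambda>n. 2 * ?d * mesh n < r \<and> ?d * mesh n < 1) sequentially"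
    by (intro eventually_conj eventually_mesh r) auto
  then show ?thesis
  proof eventually_elim
    fix n assume n: "2 * ?d * mesh n < r \<and> ?d * mesh n < 1"
    let ?h = "mesh n" and ?g = "grid (mesh n)"
    let ?L = "lat ?h (R + 1)"
    let ?cell_path = "cell_path ?h ?L (a - 2 * ?d * ?h) (b + 2 * ?d * ?h) (m + 2 * ?d * ?h) \<omega>"
    note h = mesh_pos[of n]
    have inj: "p = q" if "p \<in> Q" "q \<in> Q" "?g p = ?g q" for p q
    proof (rule ccontr)
      assume ne: "p \<noteq> q"
      have "2 * ?d * ?h < dist p q" using n rle[OF that(1,2) ne] by linarith
      then show False using grid_neq[OF h] that(3) by blast
    qed
    have Q: "u i \<in> Q" "v i \<in> Q" if "i \<le> l" for i using that by (auto simp: Q_def)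
    have inL: "?g (u i) \<in> ?L" "?g (v i) \<in> ?L" if "i \<le> l" for i
      using P[OF that] norm_grid_le[OF h, of "u i"] norm_grid_le[OF h, of "v i"] n by (auto simp: lat_def)
    have oc: "?g (u i) \<in> occ ?h \<omega>" "?g (v i) \<in> occ ?h \<omega>" if "i \<le> l" for i
      using P[OF that] by (auto simp: occ_def)
    define Y where "Y i = {v 0} \<union> (\<Union>j\<in>{1..i}. {u j, v j})" for i
    have YQ: "Y i \<subseteq> Q" if "i \<le> l" for i using that Q by (auto simp: Y_def)
    have YS: "Y (Suc i) = insert (v (Suc i)) (insert (u (Suc i)) (Y i))" for i
      by (auto simp: Y_def atLeastAtMostSuc_conv)
    have nY: "u (Suc i) \<notin> Y i" "v (Suc i) \<notin> Y i" if "Suc i \<le> l" for i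
    proof -
      have "{u (Suc i), v (Suc i)} \<inter> {u j, v j} = {}" if "j \<le> i" for j
        using dj[of "Suc i" j] that \<open>Suc i \<le> l\<close> by auto
      then show "u (Suc i) \<notin> Y i" "v (Suc i) \<notin> Y i" by (fastforce simp: Y_def)+
    qed
    have main: "?cell_path k (?g (v i)) (?g ` Y i)" if "i + k = l" for i k
      using that
    proof (induction k arbitrary: i)
      case (Suc k)
      let ?x = "?g (u (Suc i))" and ?y = "?g (v (Suc i))"
      have il: "Suc i \<le> l" "i < l" "i \<le> l" using Suc.prems by auto
      have xn: "?x \<notin> ?g ` Y i"
        using inj[OF Q(1)[OF il(1)]] YQ[OF il(3)] nY(1)[OF il(1)] by blast
      have xs: "?x \<in> {x \<in> ?L - ?g ` Y i. a - 2 * ?d * ?h \<le> dist (?g (v i)) x \<and> dist (?g (v i)) x \<le> b + 2 * ?d * ?h}"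
        using xn inL(1)[OF il(1)] st[OF il(2)] dist_grid_diff[OF h, of "v i" "u (Suc i)"] by auto
      have IH: "?cell_path k ?y (?g ` Y (Suc i))" using Suc.IH[of "Suc i"] Suc.prems by simp
      show ?case
      proof (cases "u (Suc i) = v (Suc i)")
        case True
        then have "?cell_path k ?x (insert ?x (?g ` Y i))" using IH by (simp add: YS)
        then show ?thesis unfolding cell_path.simps using xs oc(1)[OF il(1)] by blast
      next
        case False
        have "?y \<noteq> ?x" using inj[OF Q(2)[OF il(1)] Q(1)[OF il(1)]] False by metis
        moreover have "?y \<notin> ?g ` Y i" using inj[OF Q(2)[OF il(1)]] YQ[OF il(3)] nY(2)[OF il(1)] by blast
        ultimately have "?y \<in> {y \<in> ?L - insert ?x (?g ` Y i). dist ?x y \<le> m + 2 * ?d * ?h}"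
          using inL(2)[OF il(1)] P[OF il(1)] dist_grid_diff[OF h, of "u (Suc i)" "v (Suc i)"] by auto
        moreover have "?cell_path k ?y (insert ?y (insert ?x (?g ` Y i)))" using IH by (simp add: YS)
        ultimately show ?thesis unfolding cell_path.simps using xs oc(1)[OF il(1)] oc(2)[OF il(1)] by blast
      qed
    qed simp
    have "?cell_path l (?g (v 0)) {?g (v 0)}" using main[of 0 l] by (simp add: Y_def)
    then show "\<exists>z\<in>?L. {z} \<subseteq> occ ?h \<omega> \<and> ?cell_path l z {z}" using inL(2)[of 0] oc(2)[of 0] by blast
  qed
qed

lemma outer_le_run_set:
  assumes ab: "0 \<le> a" "a < b" "b \<le> m + 1" and m: "1 \<le> m" and R: "0 \<le> R"
    and small: "c * unit_ball_vol (DIM('a)) * DIM('a) * (m + 2) ^ DIM('a) * (2 * (b - a)) *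
        (1 + c * unit_ball_vol (DIM('a)) * (m + 2) ^ DIM('a)) \<le> 1 / 2"
  shows "outer_le (run_set m a b l R) (c * unit_ball_vol (DIM('a)) * (R + 2) ^ DIM('a) * (1 / 2) ^ l)"
proof -
  let ?d = "real DIM('a)" and ?V = "unit_ball_vol (DIM('a))"
  let ?cell_path = "\<lambda>n. cell_path (mesh n) (lat (mesh n) (R + 1)) (a - 2 * ?d * mesh n) (b + 2 * ?d * mesh n) (m + 2 * ?d * mesh n)"
  let ?E = "\<lambda>n. \<Union>z\<in>lat (mesh n) (R + 1). {\<omega>. {z} \<subseteq> occ (mesh n) \<omega> \<and> ?cell_path n \<omega> l z {z}}"
  have "eventually (\<lambda>n. (6 * ?d) * mesh n < b - a \<and> (3 * ?d) * mesh n < 1) sequentially"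
    by (intro eventually_conj eventually_mesh) (use ab in auto)
  then obtain s0 where s0: "\<And>n. n \<ge> s0 \<Longrightarrow> (6 * ?d) * mesh n < b - a \<and> (3 * ?d) * mesh n < 1"
    unfolding eventually_sequentially by blast
  define \<alpha> \<beta> where "\<alpha> = c * ?V * ?d * (m + 2) ^ DIM('a) * (2 * (b - a))"
    and "\<beta> = c * ?V * (m + 2) ^ DIM('a)"
  have pos: "0 \<le> \<alpha>" "0 \<le> \<beta>" using c_pos ab m by (auto simp: \<alpha>_def \<beta>_def)
  have lam: "0 \<le> \<alpha> * (1 + \<beta>)" "\<alpha> * (1 + \<beta>) \<le> 1 / 2" using small pos by (auto simp: \<alpha>_def \<beta>_def)
  show ?thesis
  proof (rule outer_le_liminf[where k = s0 and E = ?E])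
    fix n assume "s0 \<le> n"
    then have n: "(6 * ?d) * mesh n < b - a" "(3 * ?d) * mesh n < 1" using s0 by auto
    let ?h = "mesh n"
    note h = mesh_pos[of n]
    have dh: "0 \<le> ?d * ?h" using h by simp
    have fL: "finite (lat ?h (R + 1))" by (rule finite_lat[OF h])
    have 1: "(\<Sum>x\<in>{x \<in> lat ?h (R + 1). a - 2 * ?d * ?h \<le> dist z x \<and> dist z x \<le> b + 2 * ?d * ?h}. wt ?h x) \<le> \<alpha>" for z
    proof -
      have "(\<Sum>x\<in>{x \<in> lat ?h (R + 1). a - 2 * ?d * ?h \<le> dist z x \<and> dist z x \<le> b + 2 * ?d * ?h}. wt ?h x)
          \<le> c * ?V * ?d * (m + 2) ^ DIM('a) * ((b + 2 * ?d * ?h) - (a - 2 * ?d * ?h) + 2 * ?d * ?h)"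
      proof (rule sum_wt_shell[where p = z])
        show "b + 2 * ?d * ?h + ?d * ?h \<le> m + 2" "1 \<le> m + 2" "0 \<le> b + 2 * ?d * ?h"
          "a - 2 * ?d * ?h \<le> b + 2 * ?d * ?h" using ab m n dh by linarith+
      qed (use fL h in auto)
      also have "\<dots> \<le> \<alpha>"
      proof -
        have "(b + 2 * ?d * ?h) - (a - 2 * ?d * ?h) + 2 * ?d * ?h = b - a + (6 * ?d) * ?h" by (simp add: algebra_simps)
        also have "\<dots> \<le> (b - a) + (b - a)" using n(1) by (intro add_left_mono less_imp_le)
        finally have "(b + 2 * ?d * ?h) - (a - 2 * ?d * ?h) + 2 * ?d * ?h \<le> 2 * (b - a)" by (simp only: mult_2)
        then show ?thesis unfolding \<alpha>_def using c_pos m by (intro mult_left_mono) auto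
      qed
      finally show ?thesis .
    qed
    have 2: "(\<Sum>y\<in>{y \<in> lat ?h (R + 1). dist x y \<le> m + 2 * ?d * ?h}. wt ?h y) \<le> \<beta>" for x
      unfolding \<beta>_def
    proof (rule sum_wt_ball[where p = x])
      show "m + 2 * ?d * ?h + ?d * ?h \<le> m + 2" "0 \<le> m + 2 * ?d * ?h" using m n dh by linarith+
    qed (use fL h in auto)
    have "outer_le (?E n) (\<Sum>z\<in>lat ?h (R + 1). wt ?h z * (1 / 2) ^ l)"
    proof (rule outer_le_UN[OF fL])
      fix z
      have "outer_le {\<omega>. {z} \<subseteq> occ ?h \<omega> \<and> ?cell_path n \<omega> l z {z}} ((\<Prod>x\<in>{z}. wt ?h x) * (\<alpha> * (1 + \<beta>)) ^ l)"
        by (rule outer_le_cell_path[OF fL h 1 2]) simp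
      moreover have "(\<Prod>x\<in>{z}. wt ?h x) * (\<alpha> * (1 + \<beta>)) ^ l \<le> wt ?h z * (1 / 2) ^ l"
        using wt_nonneg lam by (simp add: mult_left_mono power_mono)
      ultimately show "outer_le {\<omega>. {z} \<subseteq> occ ?h \<omega> \<and> ?cell_path n \<omega> l z {z}} (wt ?h z * (1 / 2) ^ l)"
        by (rule outer_le_mono[OF _ Int_lower1])
    qed
    moreover have "(\<Sum>z\<in>lat ?h (R + 1). wt ?h z * (1 / 2) ^ l) \<le> c * ?V * (R + 2) ^ DIM('a) * (1 / 2) ^ l"
    proof -
      have "(\<Sum>z\<in>lat ?h (R + 1). wt ?h z) \<le> c * ?V * (R + 1 + 1) ^ DIM('a)"
        by (rule sum_wt_lat[OF h]) (use R n dh in linarith)+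
      then show ?thesis unfolding sum_distrib_right[symmetric] by (intro mult_right_mono) (auto simp: add.assoc)
    qed
    ultimately show "outer_le (?E n) (c * ?V * (R + 2) ^ DIM('a) * (1 / 2) ^ l)"
      by (elim outer_le_mono) auto
  next
    fix \<omega> assume "\<omega> \<in> run_set m a b l R"
    from run_set_eventually_cell_path[OF this]
    show "\<forall>\<^sub>F n in sequentially. \<omega> \<in> ?E n" by eventually_elim blast
  qed
qed

text \<open>
  Pigeonhole: the step lengths increase and fall into \<open>k + 1\<close> classes of width \<open>1 / w\<close>.
\<close>

lemma chain_in_run_set:
  assumes ch: "increasing_chain (Phi \<omega>) m R (l * (k + 2)) u v" and w: "w > 0" "m * w \<le> real k" and l: "l > 0"
  shows "\<exists>i\<le>k. \<omega> \<in> run_set m (real i / w) ((real i + 1) / w) l R"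
proof -
  let ?N = "l * (k + 2)"
  define d where "d i = dist (v i) (u (Suc i))" for i
  define g where "g t = nat \<lfloor>d (t * l) * w\<rfloor>" for t
  have P: "\<And>i. i \<le> ?N \<Longrightarrow> u i \<in> Phi \<omega> \<and> v i \<in> Phi \<omega> \<and> norm (u i) \<le> R \<and> norm (v i) \<le> R \<and> dist (u i) (v i) \<le> m"
    and dm: "\<And>i. i < ?N \<Longrightarrow> d i \<le> m" and mono: "\<And>i j. j < ?N \<Longrightarrow> i \<le> j \<Longrightarrow> d i \<le> d j"
    and dj: "\<And>i j. i \<le> ?N \<Longrightarrow> j \<le> ?N \<Longrightarrow> i \<noteq> j \<Longrightarrow> {u i, v i} \<inter> {u j, v j} = {}"
    using ch unfolding increasing_chain_def d_def by blast+
  have d0: "0 \<le> d i" for i by (simp add: d_def)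
  have lt: "t * l < ?N" if "t \<le> Suc k" for t
  proof -
    have "t * l \<le> Suc k * l" using that by (rule mult_le_mono1)
    then show ?thesis using l by (simp add: algebra_simps)
  qed
  have gk: "g t \<le> k" if "t \<le> Suc k" for t
  proof -
    have "d (t * l) * w \<le> m * w" using dm[OF lt[OF that]] w by (intro mult_right_mono) auto
    then have "d (t * l) * w \<le> real k" using w by linarith
    then show ?thesis unfolding g_def by linarith
  qed
  have "\<exists>t\<le>k. g (Suc t) \<le> g t"
  proof (rule ccontr)
    assume "\<not> ?thesis"
    then have inc: "g t < g (Suc t)" if "t \<le> k" for t using that by (metis not_le)
    have "t \<le> g t" if "t \<le> Suc k" for t
      using that by (induction t) (use inc in \<open>auto simp: Suc_le_eq less_Suc_eq_le intro: le_less_trans\<close>)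
    then have "Suc k \<le> g (Suc k)" by simp
    then show False using gk[of "Suc k"] by simp
  qed
  then obtain t where t: "t \<le> k" "g (Suc t) \<le> g t" by blast
  have tl: "t * l + l = Suc t * l" "Suc t * l < ?N" using lt[of "Suc t"] t by auto
  have in_class: "real (g t) / w \<le> d (t * l + j) \<and> d (t * l + j) \<le> (real (g t) + 1) / w" if "j < l" for j
  proof -
    have "d (t * l) \<le> d (t * l + j)" "d (t * l + j) \<le> d (Suc t * l)" using mono that tl by auto
    then have "d (t * l) * w \<le> d (t * l + j) * w" "d (t * l + j) * w \<le> d (Suc t * l) * w"
      using w by (auto intro: mult_right_mono)
    moreover have "0 \<le> d (t * l) * w" "0 \<le> d (Suc t * l) * w" using d0 w by auto
    then have "real (g t) \<le> d (t * l) * w" "d (Suc t * l) * w \<le> real (g (Suc t)) + 1"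
      unfolding g_def by linarith+
    ultimately have "real (g t) \<le> d (t * l + j) * w" "d (t * l + j) * w \<le> real (g t) + 1" using t(2) by linarith+
    then show ?thesis using w by (simp add: field_simps)
  qed
  have "\<omega> \<in> run_set m (real (g t) / w) ((real (g t) + 1) / w) l R"
    unfolding run_set_def mem_Collect_eq
  proof (rule exI[of _ "\<lambda>j. u (t * l + j)"], rule exI[of _ "\<lambda>j. v (t * l + j)"], intro conjI allI impI)
    fix i j assume "i \<le> l" "j \<le> l" "i \<noteq> j"
    then show "{u (t * l + i), v (t * l + i)} \<inter> {u (t * l + j), v (t * l + j)} = {}"
      using tl by (intro dj) auto
  next
    fix j assume j: "j < l"
    show "real (g t) / w \<le> dist (v (t * l + j)) (u (t * l + Suc j))"
      "dist (v (t * l + j)) (u (t * l + Suc j)) \<le> (real (g t) + 1) / w"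
      using in_class[OF j] by (auto simp: d_def)
  next
    fix j assume "j \<le> l"
    then have "t * l + j \<le> ?N" using tl by linarith
    from P[OF this] show "u (t * l + j) \<in> Phi \<omega>" "v (t * l + j) \<in> Phi \<omega>" "norm (u (t * l + j)) \<le> R"
      "norm (v (t * l + j)) \<le> R" "dist (u (t * l + j)) (v (t * l + j)) \<le> m" by auto
  qed
  then show ?thesis using gk[of t] t by auto
qed

lemma outer_le_chain:
  assumes m: "1 \<le> m" and w: "1 \<le> w" and R: "0 \<le> R"
    and small: "c * unit_ball_vol (DIM('a)) * DIM('a) * (real m + 2) ^ DIM('a) * (2 * (1 / real w)) *
        (1 + c * unit_ball_vol (DIM('a)) * (real m + 2) ^ DIM('a)) \<le> 1 / 2"
  shows "outer_le {\<omega>. \<exists>u v. increasing_chain (Phi \<omega>) (real m) R (m * (m * w + 2)) u v}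
     ((real (m * w) + 1) * (c * unit_ball_vol (DIM('a)) * (R + 2) ^ DIM('a) * (1 / 2) ^ m))"
proof (rule outer_le_mono)
  let ?b = "c * unit_ball_vol (DIM('a)) * (R + 2) ^ DIM('a) * (1 / 2) ^ m"
  let ?E = "\<lambda>i. run_set (real m) (real i / real w) ((real i + 1) / real w) m R"
  show "outer_le (\<Union>i\<in>{..m * w}. ?E i) (\<Sum>i\<in>{..m * w}. ?b)"
  proof (rule outer_le_UN)
    fix i assume i: "i \<in> {..m * w}"
    have diff: "(real i + 1) / real w - real i / real w = 1 / real w" by (simp add: diff_divide_distrib[symmetric])
    show "outer_le (?E i) ?b"
    proof (rule outer_le_run_set)
      have "real i \<le> real m * real w" using i by (metis atMost_iff of_nat_le_iff of_nat_mult)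
      then have "real i + 1 \<le> (real m + 1) * real w" using w by (simp add: algebra_simps)
      then show "(real i + 1) / real w \<le> real m + 1" using w by (simp add: field_simps)
      show "real i / real w < (real i + 1) / real w" using w by (simp add: divide_strict_right_mono)
    qed (use small m R w in \<open>auto simp: diff\<close>)
  qed simp
  show "{\<omega>. \<exists>u v. increasing_chain (Phi \<omega>) (real m) R (m * (m * w + 2)) u v} \<inter> space M \<subseteq> (\<Union>i\<in>{..m * w}. ?E i)"
  proof
    fix \<omega> assume "\<omega> \<in> {\<omega>. \<exists>u v. increasing_chain (Phi \<omega>) (real m) R (m * (m * w + 2)) u v} \<inter> space M"
    then obtain u v where "increasing_chain (Phi \<omega>) (real m) R (m * (m * w + 2)) u v" by blast
    then have "\<exists>i\<le>m * w. \<omega> \<in> ?E i" by (rule chain_in_run_set) (use m w in auto)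
    then show "\<omega> \<in> (\<Union>i\<in>{..m * w}. ?E i)" by auto
  qed
qed (simp add: add.commute)

end

lemma increasing_chain_avoiding:
  assumes ch: "increasing_chain P m R (2 * N + 1) u v" and P: "P \<subseteq> Q \<union> {p}"
  shows "\<exists>u v. increasing_chain Q m R N u v"
proof -
  obtain s where s: "s \<in> {0, Suc N}" and av: "\<And>i. i \<le> N \<Longrightarrow> p \<notin> {u (s + i), v (s + i)}"
  proof (cases "\<exists>i\<le>N. p \<in> {u i, v i}")
    case True
    then obtain i where i: "i \<le> N" "p \<in> {u i, v i}" by blast
    have "p \<notin> {u (Suc N + j), v (Suc N + j)}" if "j \<le> N" for j
    proof -
      have "\<forall>i\<le>2 * N + 1. \<forall>j\<le>2 * N + 1. i \<noteq> j \<longrightarrow> {u i, v i} \<inter> {u j, v j} = {}"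
        using ch unfolding increasing_chain_def by blast
      from this[rule_format, of i "Suc N + j"] show ?thesis using i that by auto
    qed
    then show ?thesis using that[of "Suc N"] by blast
  next
    case False
    then show ?thesis using that[of 0] by auto
  qed
  have le: "s + i \<le> 2 * N + 1" if "i \<le> N" for i using that s by auto
  have lt: "s + i < 2 * N + 1" if "i < N" for i using that s by auto
  have "increasing_chain Q m R N (\<lambda>i. u (s + i)) (\<lambda>i. v (s + i))"
    unfolding increasing_chain_def
  proof (intro conjI allI impI)
    fix i assume i: "i \<le> N"
    have "u (s + i) \<in> P \<and> v (s + i) \<in> P \<and> norm (u (s + i)) \<le> R \<and> norm (v (s + i)) \<le> R \<and> dist (u (s + i)) (v (s + i)) \<le> m"
      using ch le[OF i] unfolding increasing_chain_def by blast
    then show "u (s + i) \<in> Q" "v (s + i) \<in> Q" "norm (u (s + i)) \<le> R" "norm (v (s + i)) \<le> R"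
      "dist (u (s + i)) (v (s + i)) \<le> m" using P av[OF i] by auto
  next
    fix i assume "i < N"
    then show "dist (v (s + i)) (u (s + Suc i)) \<le> m" using ch lt unfolding increasing_chain_def by simp
  next
    fix i j assume "j < N" "i \<le> j"
    then show "dist (v (s + i)) (u (s + Suc i)) \<le> dist (v (s + j)) (u (s + Suc j))"
      using ch lt[of j] unfolding increasing_chain_def by simp
  next
    fix i j assume "i \<le> N" "j \<le> N" "i \<noteq> j"
    then show "{u (s + i), v (s + i)} \<inter> {u (s + j), v (s + j)} = {}"
      using ch le[of i] le[of j] unfolding increasing_chain_def by simp
  qed
  then show ?thesis by blast
qed

section \<open>Frequency of patterns\<close>

context poisson_process begin

definition site :: "nat \<Rightarrow> 'a \<times> 'a option \<Rightarrow> 'a set" where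
  "site k = (\<lambda>(z, q). case q of Some q \<Rightarrow> ball (z + q) 1 | None \<Rightarrow> ball z (20 ^ k) - (\<Union>q\<in>centers k. ball (z + q) 1))"

definition slots :: "nat \<Rightarrow> 'a option set" where "slots k = insert None (Some ` centers k)"

definition demand :: "'a option \<Rightarrow> nat set" where "demand q = (if q = None then {0} else {1})"

definition p0 :: "nat \<Rightarrow> real" where
  "p0 k = (c * unit_ball_vol (DIM('a)) * exp (- (c * unit_ball_vol (DIM('a))))) ^ card (centers k :: 'a set) *
     exp (- (c * (unit_ball_vol (DIM('a)) * (20 ^ k) ^ DIM('a))))"

lemma site_sets: "site k i \<in> sets lborel \<and> bounded (site k i)"
proof -
  obtain z q where i: "i = (z, q)" by (cases i)
  have "(\<Union>q\<in>centers k. ball (z + q) 1) \<in> sets borel" by (rule borel_open) auto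
  moreover have "bounded (ball z (20 ^ k) - (\<Union>q\<in>centers k. ball (z + q) 1))"
    by (rule bounded_subset[OF bounded_ball]) auto
  ultimately show ?thesis unfolding i site_def by (auto split: option.split)
qed

lemma site_subset: "q \<in> slots k \<Longrightarrow> site k (z, q) \<subseteq> ball z (20 ^ k)"
proof -
  assume "q \<in> slots k"
  then consider "q = None" | q' where "q' \<in> centers k" "q = Some q'" by (auto simp: slots_def)
  then show ?thesis using ball_centers_subset by cases (auto simp: site_def)
qed

lemma disjoint_sites:
  assumes "\<And>z z'. z \<in> J \<Longrightarrow> z' \<in> J \<Longrightarrow> z \<noteq> z' \<Longrightarrow> ball z (20 ^ k) \<inter> ball z' (20 ^ k) = {}"
  shows "disjoint_family_on (site k) (J \<times> slots k)"
  unfolding disjoint_family_on_def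
proof (intro ballI impI)
  fix i j assume i: "i \<in> J \<times> slots k" and j: "j \<in> J \<times> slots k" and ne: "i \<noteq> j"
  obtain z q z' q' where ij: "i = (z, q)" "j = (z', q')" by (cases i, cases j)
  show "site k i \<inter> site k j = {}"
  proof (cases "z = z'")
    case False
    then have "ball z (20 ^ k) \<inter> ball z' (20 ^ k) = {}" using assms i j ij by auto
    then show ?thesis using site_subset[of q k z] site_subset[of q' k z'] i j ij by auto
  next
    case True
    then have "q \<noteq> q'" using ne ij by simp
    moreover have "q \<in> slots k" "q' \<in> slots k" using i j ij by auto
    ultimately consider a where "q = None" "q' = Some a" "a \<in> centers k" | a where "q' = None" "q = Some a" "a \<in> centers k"
      | a b where "q = Some a" "q' = Some b" "a \<in> centers k" "b \<in> centers k" "a \<noteq> b"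
      by (auto simp: slots_def)
    then show ?thesis
    proof cases
      case 3
      then show ?thesis using disjoint_centers[of a k b z] ij True by (simp add: site_def)
    qed (use ij True in \<open>auto simp: site_def\<close>)
  qed
qed

lemma pattern_iff_site:
  assumes "\<omega> \<in> space M"
  shows "pattern k z (Phi \<omega>) \<longleftrightarrow> (\<forall>q\<in>slots k. card (Phi \<omega> \<inter> site k (z, q)) \<in> demand q)"
proof -
  have "finite (Phi \<omega> \<inter> site k (z, None))" using locally_finite assms site_sets by blast
  then have "card (Phi \<omega> \<inter> site k (z, None)) = 0 \<longleftrightarrow> Phi \<omega> \<inter> site k (z, None) = {}" by simp
  then show ?thesis unfolding pattern_def slots_def demand_def by (auto simp: site_def)
qed

lemma finite_slots: "finite (slots k)" by (simp add: slots_def finite_centers)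

lemma prob_pattern_ge:
  "p0 k \<le> prob {\<omega>\<in>space M. \<forall>q\<in>slots k. card (Phi \<omega> \<inter> site k (z, q)) \<in> demand q}"
proof -
  let ?V = "unit_ball_vol (DIM('a))"
  let ?pr = "\<lambda>q. prob {\<omega>\<in>space M. card (Phi \<omega> \<inter> site k (z, q)) \<in> demand q}"
  have dis: "disjoint_family_on (\<lambda>q. site k (z, q)) (slots k)"
    using disjoint_sites[of "{z}" k] unfolding disjoint_family_on_def by auto
  have "prob {\<omega>\<in>space M. \<forall>q\<in>slots k. card (Phi \<omega> \<inter> site k (z, q)) \<in> demand q} = (\<Prod>q\<in>slots k. ?pr q)"
    by (rule prob_counts_eq[OF finite_slots site_sets dis])
  also have "\<dots> = ?pr None * (\<Prod>q\<in>Some ` centers k. ?pr q)"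
    unfolding slots_def by (rule prod.insert) (auto simp: finite_centers)
  also have "(\<Prod>q\<in>Some ` centers k. ?pr q) = (\<Prod>q\<in>centers k. ?pr (Some q))"
    by (subst prod.reindex) auto
  also have "\<dots> = (\<Prod>q\<in>(centers k :: 'a set). c * ?V * exp (- (c * ?V)))"
  proof (rule prod.cong)
    fix q :: 'a assume "q \<in> centers k"
    have "?pr (Some q) = prob {\<omega>\<in>space M. card (Phi \<omega> \<inter> ball (z + q) 1) = 1}"
      by (simp add: site_def demand_def)
    also have "\<dots> = c * ?V * exp (- (c * ?V))"
      using prob_count[of "ball (z + q) 1" 1] by (simp add: content_ball)
    finally show "?pr (Some q) = c * ?V * exp (- (c * ?V))" .
  qed simp
  also have "\<dots> = (c * ?V * exp (- (c * ?V))) ^ card (centers k :: 'a set)" by simp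
  finally have eq: "prob {\<omega>\<in>space M. \<forall>q\<in>slots k. card (Phi \<omega> \<inter> site k (z, q)) \<in> demand q} =
      ?pr None * (c * ?V * exp (- (c * ?V))) ^ card (centers k :: 'a set)" .
  have "?pr None = exp (- (c * measure lborel (site k (z, None))))"
    using prob_count[of "site k (z, None)" 0] site_sets by (simp add: demand_def)
  moreover have "measure lborel (site k (z, None)) \<le> measure lborel (ball z (20 ^ k))"
    by (rule measure_mono_fmeasurable)
      (use site_sets[of k "(z, None)"] site_subset[of None k z] emeasure_bounded_finite[OF bounded_ball, of z "20 ^ k"]
        in \<open>auto simp: slots_def fmeasurable_def\<close>)
  then have "measure lborel (site k (z, None)) \<le> ?V * (20 ^ k) ^ DIM('a)" by (simp add: content_ball)
  then have "c * measure lborel (site k (z, None)) \<le> c * (?V * (20 ^ k) ^ DIM('a))" using c_pos by simp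
  ultimately have "exp (- (c * (?V * (20 ^ k) ^ DIM('a)))) \<le> ?pr None" by simp
  then show ?thesis unfolding eq p0_def using c_pos
    by (subst mult.commute) (intro mult_right_mono zero_le_power, auto)
qed

lemma p0_bounds: "0 < p0 k" "p0 k \<le> 1"
proof -
  show "0 < p0 k" unfolding p0_def using c_pos by (intro mult_pos_pos zero_less_power) auto
  show "p0 k \<le> 1" using prob_pattern_ge[of k 0] prob_le_1 order_trans by blast
qed

lemma outer_le_no_pattern:
  assumes J: "finite J"
    and dis: "\<And>z z'. z \<in> J \<Longrightarrow> z' \<in> J \<Longrightarrow> z \<noteq> z' \<Longrightarrow> ball z (20 ^ k) \<inter> ball z' (20 ^ k) = {}"
  shows "outer_le {\<omega>. \<forall>z\<in>J. \<not> pattern k z (Phi \<omega>)} ((1 - p0 k) ^ card J)"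
proof (cases "J = {}")
  case True
  then show ?thesis unfolding outer_le_def by (intro bexI[of _ "space M"]) (auto simp: prob_space)
next
  case False
  let ?Y = "\<lambda>z f. \<forall>q\<in>slots k. f (z, q) \<in> demand q"
  let ?X = "\<lambda>z \<omega>. ?Y z (restrict (\<lambda>i. card (Phi \<omega> \<inter> site k i)) ({z} \<times> slots k))"
  have "indep_vars (\<lambda>_. count_space UNIV) (\<lambda>i \<omega>. card (Phi \<omega> \<inter> site k i)) (J \<times> slots k)"
    by (rule indep_counts) (use J finite_slots site_sets disjoint_sites[OF dis] in auto)
  then have "indep_vars (\<lambda>z. PiM ({z} \<times> slots k) (\<lambda>_. count_space UNIV))
      (\<lambda>z \<omega>. restrict (\<lambda>i. card (Phi \<omega> \<inter> site k i)) ({z} \<times> slots k)) J"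
    by (rule indep_vars_restrict) (auto simp: disjoint_family_on_def)
  then have ind: "indep_vars (\<lambda>_. count_space UNIV) ?X J"
  proof (rule indep_vars_compose2)
    fix z
    have "(\<lambda>f. f (z, q) \<in> demand q) \<in> measurable (PiM ({z} \<times> slots k) (\<lambda>_. count_space UNIV)) (count_space UNIV)"
      if "q \<in> slots k" for q
      by (rule measurable_compose[OF measurable_component_singleton]) (use that in auto)
    then show "?Y z \<in> measurable (PiM ({z} \<times> slots k) (\<lambda>_. count_space UNIV)) (count_space UNIV)"
      by (rule pred_intros_finite(3)[OF finite_slots])
  qed
  have X: "?X z \<omega> \<longleftrightarrow> (\<forall>q\<in>slots k. card (Phi \<omega> \<inter> site k (z, q)) \<in> demand q)" for z \<omega> by simp
  have meas: "?X z -` {False} \<inter> space M \<in> events" if "z \<in> J" for z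
    using ind that unfolding indep_vars_def by (intro measurable_sets[of _ _ "count_space UNIV"]) auto
  have one: "prob (?X z -` {False} \<inter> space M) \<le> 1 - p0 k" if "z \<in> J" for z
  proof -
    let ?A = "{\<omega>\<in>space M. \<forall>q\<in>slots k. card (Phi \<omega> \<inter> site k (z, q)) \<in> demand q}"
    have "?A = space M - (?X z -` {False} \<inter> space M)" by (auto simp: X)
    then have "prob ?A = 1 - prob (?X z -` {False} \<inter> space M)" using prob_compl[OF meas[OF that]] by simp
    then show ?thesis using prob_pattern_ge[of k z] by linarith
  qed
  have "prob (\<Inter>z\<in>J. ?X z -` {False} \<inter> space M) = (\<Prod>z\<in>J. prob (?X z -` {False} \<inter> space M))"
    by (rule indep_varsD_finite[OF ind]) (use False J in auto)
  also have "\<dots> \<le> (\<Prod>z\<in>J. 1 - p0 k)" by (rule prod_mono) (use one in auto)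
  finally have "prob (\<Inter>z\<in>J. ?X z -` {False} \<inter> space M) \<le> (1 - p0 k) ^ card J" by simp
  moreover have "(\<Inter>z\<in>J. ?X z -` {False} \<inter> space M) \<in> events" using False J meas by (intro sets.finite_INT) auto
  moreover have "{\<omega>. \<forall>z\<in>J. \<not> pattern k z (Phi \<omega>)} \<inter> space M \<subseteq> (\<Inter>z\<in>J. ?X z -` {False} \<inter> space M)"
    using pattern_iff_site by (auto simp: X)
  ultimately show ?thesis unfolding outer_le_def by blast
qed

lemma outer_le_void:
  fixes k n R :: nat
  defines "m \<equiv> 2 * 20 ^ k * (real n + 1) + DIM('a)"
  shows "outer_le {\<omega>. \<exists>x. norm x \<le> real R \<and>
      (\<forall>z. ball z (20 ^ k) \<subseteq> ball x m \<and> 0 \<notin> ball z (20 ^ k) \<longrightarrow> \<not> pattern k z (Phi \<omega>))}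
    (real ((2 * (R + DIM('a)) + 1) ^ DIM('a)) * (1 - p0 k) ^ n)"
proof -
  let ?\<rho> = "20 ^ k :: real"
  define pt where "pt g j = g + (2 * ?\<rho> * real j) *\<^sub>R axis" for g :: 'a and j :: nat
  define J where "J g = {z \<in> pt g ` {..n}. 0 \<notin> ball z ?\<rho>}" for g
  let ?L = "lat 1 (real R + DIM('a))"
  have dpt: "dist (pt g i) (pt g j) = 2 * ?\<rho> * \<bar>real i - real j\<bar>" for g i j
  proof -
    have "pt g i - pt g j = (2 * ?\<rho> * (real i - real j)) *\<^sub>R axis"
      by (simp add: pt_def algebra_simps)
    then show ?thesis by (simp add: dist_norm abs_mult)
  qed
  have dis: "ball (pt g i) ?\<rho> \<inter> ball (pt g j) ?\<rho> = {}" if "i \<noteq> j" for g i j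
  proof (rule ccontr)
    assume "\<not> ?thesis"
    then obtain x where "dist (pt g i) x < ?\<rho>" "dist (pt g j) x < ?\<rho>" by auto
    then have lt: "dist (pt g i) (pt g j) < 2 * ?\<rho>" using dist_triangle2[of "pt g i" "pt g j" x] by linarith
    have "1 \<le> \<bar>real i - real j\<bar>" using that by linarith
    then have "2 * ?\<rho> * 1 \<le> 2 * ?\<rho> * \<bar>real i - real j\<bar>" by (intro mult_left_mono) auto
    then show False using lt dpt[of g i j] by linarith
  qed
  have inj: "inj (pt g)" for g
  proof (rule injI, rule ccontr)
    fix i j assume "pt g i = pt g j" "i \<noteq> j"
    moreover have "\<not> ?\<rho> \<le> 0" by (simp add: not_le)
    ultimately show False using dis[of i j g] by simp
  qed
  have fJ: "finite (J g)" for g by (simp add: J_def)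
  have cJ: "n \<le> card (J g)" for g
  proof -
    have "i = j" if "0 \<in> ball (pt g i) ?\<rho>" "0 \<in> ball (pt g j) ?\<rho>" for i j
      using dis[of i j g] that by (metis IntI empty_iff)
    then obtain i0 where i0: "\<And>i. 0 \<in> ball (pt g i) ?\<rho> \<Longrightarrow> i = i0" by metis
    have "pt g ` ({..n} - {i0}) \<subseteq> J g" using i0 by (auto simp: J_def)
    then have "card (pt g ` ({..n} - {i0})) \<le> card (J g)" using fJ by (rule card_mono[rotated])
    moreover have "card (pt g ` ({..n} - {i0})) = card ({..n} - {i0})"
      using inj by (intro card_image) (auto intro: inj_on_subset)
    moreover have "n \<le> card ({..n} - {i0})" using card_Diff1_le[of "{..n}" i0] by (cases "i0 \<in> {..n}") auto
    ultimately show ?thesis by linarith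
  qed
  have o1: "outer_le (\<Union>g\<in>?L. {\<omega>. \<forall>z\<in>J g. \<not> pattern k z (Phi \<omega>)}) (\<Sum>g\<in>?L. (1 - p0 k) ^ n)"
  proof (rule outer_le_UN)
    fix g
    have "outer_le {\<omega>. \<forall>z\<in>J g. \<not> pattern k z (Phi \<omega>)} ((1 - p0 k) ^ card (J g))"
    proof (rule outer_le_no_pattern[OF fJ])
      fix z z' assume "z \<in> J g" "z' \<in> J g" and ne: "z \<noteq> z'"
      then obtain i j where "z = pt g i" "z' = pt g j" by (auto simp: J_def)
      then show "ball z ?\<rho> \<inter> ball z' ?\<rho> = {}" using ne dis[of i j g] by metis
    qed
    moreover have "(1 - p0 k) ^ card (J g) \<le> (1 - p0 k) ^ n"
      using p0_bounds[of k] cJ by (intro power_decreasing) auto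
    ultimately show "outer_le {\<omega>. \<forall>z\<in>J g. \<not> pattern k z (Phi \<omega>)} ((1 - p0 k) ^ n)"
      by (rule outer_le_mono[OF _ Int_lower1])
  qed (simp add: finite_lat)
  have o2: "(\<Sum>g\<in>?L. (1 - p0 k) ^ n) \<le> real ((2 * (R + DIM('a)) + 1) ^ DIM('a)) * (1 - p0 k) ^ n"
  proof -
    have "card ?L \<le> (2 * (R + DIM('a)) + 1) ^ DIM('a)"
      unfolding lat_def by (rule grid_points(2)) auto
    then have "real (card ?L) \<le> real ((2 * (R + DIM('a)) + 1) ^ DIM('a))" by (rule of_nat_mono)
    then have "real (card ?L) * (1 - p0 k) ^ n \<le> real ((2 * (R + DIM('a)) + 1) ^ DIM('a)) * (1 - p0 k) ^ n"
      using p0_bounds[of k] by (intro mult_right_mono) auto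
    then show ?thesis by simp
  qed
  have o3: "{\<omega>. \<exists>x. norm x \<le> real R \<and>
      (\<forall>z. ball z (20 ^ k) \<subseteq> ball x m \<and> 0 \<notin> ball z (20 ^ k) \<longrightarrow> \<not> pattern k z (Phi \<omega>))} \<inter> space M
      \<subseteq> (\<Union>g\<in>?L. {\<omega>. \<forall>z\<in>J g. \<not> pattern k z (Phi \<omega>)})"
  proof
    fix \<omega> assume "\<omega> \<in> {\<omega>. \<exists>x. norm x \<le> real R \<and>
      (\<forall>z. ball z (20 ^ k) \<subseteq> ball x m \<and> 0 \<notin> ball z (20 ^ k) \<longrightarrow> \<not> pattern k z (Phi \<omega>))} \<inter> space M"
    then obtain x where x: "norm x \<le> real R"
      and np: "\<And>z. ball z ?\<rho> \<subseteq> ball x m \<Longrightarrow> 0 \<notin> ball z ?\<rho> \<Longrightarrow> \<not> pattern k z (Phi \<omega>)" by blast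
    let ?g = "grid 1 x"
    have gL: "?g \<in> ?L" using norm_grid_le[of 1 x] x by (auto simp: lat_def)
    have "\<not> pattern k z (Phi \<omega>)" if z: "z \<in> J ?g" for z
    proof -
      obtain j where j: "j \<le> n" "z = pt ?g j" "0 \<notin> ball z ?\<rho>" using z by (auto simp: J_def)
      have "dist ?g z = 2 * ?\<rho> * real j" using dpt[of ?g 0 j] j(2) by (simp add: pt_def)
      also have "\<dots> \<le> 2 * ?\<rho> * real n" using j(1) by (intro mult_left_mono) auto
      finally have "dist x z \<le> DIM('a) + 2 * ?\<rho> * real n"
        using dist_grid[of 1 x] dist_triangle[of x z ?g] by (simp add: dist_commute)
      moreover have "m = DIM('a) + 2 * ?\<rho> * real n + 2 * ?\<rho>" by (simp add: m_def algebra_simps)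
      moreover have "0 < ?\<rho>" by simp
      ultimately have "dist x z + ?\<rho> \<le> m" by linarith
      then have "ball z ?\<rho> \<subseteq> ball x m" by (simp add: ball_subset_ball_iff dist_commute)
      then show ?thesis using np j(3) by blast
    qed
    then show "\<omega> \<in> (\<Union>g\<in>?L. {\<omega>. \<forall>z\<in>J g. \<not> pattern k z (Phi \<omega>)})" using gL by blast
  qed
  show ?thesis by (rule outer_le_mono[OF o1 o3 o2])
qed

end

section \<open>Good scales\<close>

definition poly_bounded :: "(nat \<Rightarrow> real) \<Rightarrow> bool" where
  "poly_bounded f \<longleftrightarrow> (\<forall>n. 0 \<le> f n) \<and> (\<exists>C q. 0 \<le> C \<and> (\<forall>n\<ge>1. f n \<le> C * real n ^ q))"

lemma poly_bounded_const: "0 \<le> a \<Longrightarrow> poly_bounded (\<lambda>_. a)"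
  unfolding poly_bounded_def by (intro conjI allI exI[of _ a] exI[of _ 0]) auto

lemma poly_bounded_of_nat: "poly_bounded real"
  unfolding poly_bounded_def by (intro conjI allI exI[of _ 1] exI[of _ 1]) auto

lemma poly_bounded_add:
  assumes "poly_bounded f" "poly_bounded g"
  shows "poly_bounded (\<lambda>n. f n + g n)"
proof -
  obtain C p where f: "\<And>n. 0 \<le> f n" "0 \<le> C" "\<And>n. n \<ge> 1 \<Longrightarrow> f n \<le> C * real n ^ p"
    using assms(1) unfolding poly_bounded_def by blast
  obtain D q where g: "\<And>n. 0 \<le> g n" "0 \<le> D" "\<And>n. n \<ge> 1 \<Longrightarrow> g n \<le> D * real n ^ q"
    using assms(2) unfolding poly_bounded_def by blast
  have "f n + g n \<le> (C + D) * real n ^ (p + q)" if n: "n \<ge> 1" for n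
  proof -
    have "C * real n ^ p \<le> C * real n ^ (p + q)" "D * real n ^ q \<le> D * real n ^ (p + q)"
      using n f(2) g(2) by (auto intro!: mult_left_mono power_increasing)
    then show ?thesis using f(3)[OF n] g(3)[OF n] by (simp add: distrib_right)
  qed
  then show ?thesis unfolding poly_bounded_def using f(1,2) g(1,2)
    by (intro conjI allI exI[of _ "C + D"] exI[of _ "p + q"]) auto
qed

lemma poly_bounded_mult:
  assumes "poly_bounded f" "poly_bounded g"
  shows "poly_bounded (\<lambda>n. f n * g n)"
proof -
  obtain C p where f: "\<And>n. 0 \<le> f n" "0 \<le> C" "\<And>n. n \<ge> 1 \<Longrightarrow> f n \<le> C * real n ^ p"
    using assms(1) unfolding poly_bounded_def by blast
  obtain D q where g: "\<And>n. 0 \<le> g n" "0 \<le> D" "\<And>n. n \<ge> 1 \<Longrightarrow> g n \<le> D * real n ^ q"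
    using assms(2) unfolding poly_bounded_def by blast
  have "f n * g n \<le> (C * D) * real n ^ (p + q)" if n: "n \<ge> 1" for n
  proof -
    have "f n * g n \<le> (C * real n ^ p) * (D * real n ^ q)"
      using f g n by (intro mult_mono) auto
    then show ?thesis by (simp add: power_add mult_ac)
  qed
  then show ?thesis unfolding poly_bounded_def using f(1,2) g(1,2)
    by (intro conjI allI exI[of _ "C * D"] exI[of _ "p + q"]) auto
qed

lemma poly_bounded_power: "poly_bounded f \<Longrightarrow> poly_bounded (\<lambda>n. f n ^ k)"
  by (induction k) (auto intro: poly_bounded_const poly_bounded_mult)

lemma power_times_geometric_tendsto_0:
  fixes \<theta> :: real
  assumes "0 \<le> \<theta>" "\<theta> < 1"
  shows "(\<lambda>n. real n ^ q * \<theta> ^ n) \<longlonglongrightarrow> 0"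
proof -
  define s where "s = root (Suc q) \<theta>"
  have s: "0 \<le> s" "s < 1" "s ^ Suc q = \<theta>" using assms by (auto simp: s_def simp del: power_Suc)
  have "(\<lambda>n. real n * s ^ n) \<longlonglongrightarrow> 0" by (rule powser_times_n_limit_0) (use s in simp)
  then have "(\<lambda>n. (real n * s ^ n) ^ Suc q) \<longlonglongrightarrow> 0 ^ Suc q" by (rule tendsto_power)
  moreover have "(real n * s ^ n) ^ Suc q = real n ^ Suc q * \<theta> ^ n" for n
    by (simp only: power_mult_distrib s(3)[symmetric] power_mult[symmetric] mult.commute)
  ultimately have lim: "(\<lambda>n. real n ^ Suc q * \<theta> ^ n) \<longlonglongrightarrow> 0" by (simp only: power_0_Suc)
  show ?thesis
  proof (rule tendsto_sandwich[OF _ _ tendsto_const lim])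
    show "\<forall>\<^sub>F n in sequentially. real n ^ q * \<theta> ^ n \<le> real n ^ Suc q * \<theta> ^ n"
      using eventually_ge_at_top[of 1]
      by eventually_elim (use assms in \<open>auto intro!: mult_right_mono power_increasing simp del: power_Suc\<close>)
  qed (use assms in auto)
qed

lemma poly_bounded_times_geometric:
  assumes "poly_bounded f" "0 \<le> \<theta>" "\<theta> < 1"
  shows "(\<lambda>n. f n * \<theta> ^ n) \<longlonglongrightarrow> 0"
proof -
  obtain C q where f: "\<And>n. 0 \<le> f n" "\<And>n. n \<ge> 1 \<Longrightarrow> f n \<le> C * real n ^ q"
    using assms(1) unfolding poly_bounded_def by blast
  have lim: "(\<lambda>n. C * (real n ^ q * \<theta> ^ n)) \<longlonglongrightarrow> 0"
    using tendsto_mult_right_zero[OF power_times_geometric_tendsto_0[OF assms(2,3), of q]] by simp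
  show ?thesis
  proof (rule tendsto_sandwich[OF _ _ tendsto_const lim])
    show "\<forall>\<^sub>F n in sequentially. f n * \<theta> ^ n \<le> C * (real n ^ q * \<theta> ^ n)"
      using eventually_ge_at_top[of 1]
    proof eventually_elim
      fix n :: nat assume "1 \<le> n"
      then have "f n * \<theta> ^ n \<le> (C * real n ^ q) * \<theta> ^ n" using f assms by (intro mult_right_mono) auto
      then show "f n * \<theta> ^ n \<le> C * (real n ^ q * \<theta> ^ n)" by (simp add: mult.assoc)
    qed
  qed (use f(1) assms in auto)
qed

lemma pattern_extend:
  assumes "pattern k z Q" "Q \<subseteq> P" "P \<subseteq> Q \<union> {p}" "p \<notin> ball z (20 ^ k)"
  shows "pattern k z P"
proof -
  have eq: "P \<inter> B = Q \<inter> B" if "B \<subseteq> ball z (20 ^ k)" for B using that assms(2-4) by blast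
  have "P \<inter> ball (z + q) 1 = Q \<inter> ball (z + q) 1" if "q \<in> centers k" for q
    by (rule eq[OF ball_centers_subset[OF that]])
  moreover have "P \<inter> (ball z (20 ^ k) - (\<Union>q\<in>centers k. ball (z + q) 1)) =
      Q \<inter> (ball z (20 ^ k) - (\<Union>q\<in>centers k. ball (z + q) 1))" by (rule eq) blast
  ultimately show ?thesis using assms(1) unfolding pattern_def by simp
qed

context poisson_process begin

lemma AE_scales:
  "AE \<omega> in M. \<forall>r. \<exists>m R N. r \<le> m \<and> 0 < m \<and> r + 2 * m * (real N + 2) \<le> R \<and>
     (\<forall>P. Phi \<omega> \<subseteq> P \<and> P \<subseteq> Phi \<omega> \<union> {0} \<longrightarrow> (\<nexists>u v. increasing_chain P m R N u v) \<and>
        (\<forall>x. norm x \<le> R \<longrightarrow> (\<exists>z. ball z (20 ^ k) \<subseteq> ball x m \<and> pattern k z P)))"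
proof -
  let ?d = "DIM('a)" and ?V = "unit_ball_vol (DIM('a))"
  define W :: nat where "W = nat \<lceil>4 * c * ?V * ?d * 9 ^ ?d * (1 + c * ?V)\<rceil> + 1"
  define m :: "nat \<Rightarrow> nat" where "m n = 2 * 20 ^ k * (n + 1) + ?d" for n
  define w where "w n = W * m n ^ (2 * ?d)" for n
  define N where "N n = m n * (m n * w n + 2)" for n
  define R where "R n = m n + 2 * m n * (2 * N n + 1 + 2)" for n
  have m1: "1 \<le> m n" "n \<le> m n" for n
  proof -
    have "1 * (n + 1) \<le> (2 * 20 ^ k) * (n + 1)" by (rule mult_le_mono1) simp
    then show "n \<le> m n" "1 \<le> m n" by (auto simp: m_def)
  qed
  have w1: "1 \<le> w n" for n 
  proof -
    have "1 \<le> W" by (simp add: W_def)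
    moreover have "1 \<le> m n ^ (2 * ?d)" by (rule one_le_power[OF m1(1)])
    ultimately show ?thesis using mult_le_mono[of 1 W 1 "m n ^ (2 * ?d)"] by (simp only: w_def mult_1)
  qed
  have small: "c * ?V * ?d * (real (m n) + 2) ^ ?d * (2 * (1 / real (w n))) * (1 + c * ?V * (real (m n) + 2) ^ ?d) \<le> 1 / 2" for n
  proof -
    let ?x = "real (m n)"
    have x: "1 \<le> ?x" using m1(1)[of n] by linarith
    have a: "(?x + 2) ^ ?d \<le> (3 * ?x) ^ ?d" using x by (intro power_mono) auto
    have b: "1 + c * ?V * (?x + 2) ^ ?d \<le> (1 + c * ?V) * (3 * ?x) ^ ?d"
    proof -
      have "1 \<le> (3 * ?x) ^ ?d" using x by (intro one_le_power) auto
      moreover have "c * ?V * (?x + 2) ^ ?d \<le> c * ?V * (3 * ?x) ^ ?d" using a c_pos by (intro mult_left_mono) auto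
      ultimately show ?thesis by (simp add: distrib_right)
    qed
    have W: "4 * c * ?V * ?d * 9 ^ ?d * (1 + c * ?V) \<le> real W" unfolding W_def by linarith
    have "c * ?V * ?d * (?x + 2) ^ ?d * (1 + c * ?V * (?x + 2) ^ ?d) \<le>
        c * ?V * ?d * (3 * ?x) ^ ?d * ((1 + c * ?V) * (3 * ?x) ^ ?d)"
      using a b c_pos x by (intro mult_mono) (auto intro!: mult_left_mono mult_nonneg_nonneg add_nonneg_nonneg)
    also have "\<dots> = c * ?V * ?d * 9 ^ ?d * (1 + c * ?V) * ?x ^ (2 * ?d)"
    proof -
      have "(3 * ?x) ^ ?d * (3 * ?x) ^ ?d = ((3 * ?x) * (3 * ?x)) ^ ?d" by (rule power_mult_distrib[symmetric])
      also have "(3 * ?x) * (3 * ?x) = 9 * ?x\<^sup>2" by (simp add: power2_eq_square)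
      also have "(9 * ?x\<^sup>2) ^ ?d = 9 ^ ?d * ?x ^ (2 * ?d)" by (simp only: power_mult_distrib power_mult)
      finally have sq: "(3 * ?x) ^ ?d * (3 * ?x) ^ ?d = 9 ^ ?d * ?x ^ (2 * ?d)" .
      have "c * ?V * ?d * (3 * ?x) ^ ?d * ((1 + c * ?V) * (3 * ?x) ^ ?d) =
          c * ?V * ?d * (1 + c * ?V) * ((3 * ?x) ^ ?d * (3 * ?x) ^ ?d)" by (simp only: mult_ac)
      also have "\<dots> = c * ?V * ?d * 9 ^ ?d * (1 + c * ?V) * ?x ^ (2 * ?d)" unfolding sq by (simp only: mult_ac)
      finally show ?thesis .
    qed
    also have "\<dots> \<le> (real W / 4) * ?x ^ (2 * ?d)" using W by (intro mult_right_mono) auto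
    finally have main: "c * ?V * ?d * (?x + 2) ^ ?d * (1 + c * ?V * (?x + 2) ^ ?d) \<le> real (w n) / 4"
      by (simp add: w_def)
    have "c * ?V * ?d * (?x + 2) ^ ?d * (2 * (1 / real (w n))) * (1 + c * ?V * (?x + 2) ^ ?d) =
        c * ?V * ?d * (?x + 2) ^ ?d * (1 + c * ?V * (?x + 2) ^ ?d) * (2 / real (w n))" by (simp add: mult_ac)
    also have "\<dots> \<le> real (w n) / 4 * (2 / real (w n))" using main by (intro mult_right_mono) auto
    also have "\<dots> = 1 / 2" using w1[of n] by simp
    finally show ?thesis .
  qed
  define E1 where "E1 n = {\<omega>. \<exists>u v. increasing_chain (Phi \<omega>) (real (m n)) (real (R n)) (N n) u v}" for n
  define E2 where "E2 n = {\<omega>. \<exists>x. norm x \<le> real (R n) \<and>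
      (\<forall>z. ball z (20 ^ k) \<subseteq> ball x (real (m n)) \<and> 0 \<notin> ball z (20 ^ k) \<longrightarrow> \<not> pattern k z (Phi \<omega>))}" for n
  define f1 where "f1 n = (real (m n * w n) + 1) * (c * ?V * (real (R n) + 2) ^ ?d)" for n
  define f2 where "f2 n = real ((2 * (R n + ?d) + 1) ^ ?d)" for n
  have f1_nonneg: "0 \<le> f1 n" for n using c_pos by (simp add: f1_def)
  have o1: "outer_le (E1 n) (f1 n * (1 / 2) ^ n)" for n
  proof (rule outer_le_mono[OF _ Int_lower1])
    show "outer_le (E1 n) ((real (m n * w n) + 1) * (c * ?V * (real (R n) + 2) ^ ?d * (1 / 2) ^ m n))"
      unfolding E1_def N_def by (rule outer_le_chain[OF m1(1) w1 _ small]) simp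
    have "(real (m n * w n) + 1) * (c * ?V * (real (R n) + 2) ^ ?d * (1 / 2) ^ m n) = f1 n * (1 / 2) ^ m n"
      by (simp add: f1_def mult.assoc)
    also have "\<dots> \<le> f1 n * (1 / 2) ^ n"
      using f1_nonneg m1(2) by (intro mult_left_mono power_decreasing) auto
    finally show "(real (m n * w n) + 1) * (c * ?V * (real (R n) + 2) ^ ?d * (1 / 2) ^ m n) \<le> f1 n * (1 / 2) ^ n" .
  qed
  have m_real: "2 * 20 ^ k * (real n + 1) + ?d = real (m n)" for n by (simp add: m_def algebra_simps)
  have o2: "outer_le (E2 n) (f2 n * (1 - p0 k) ^ n)" for n
    using outer_le_void[where k = k and n = n and R = "R n"] unfolding E2_def f2_def m_real .
  have pm: "poly_bounded (\<lambda>n. real (m n))"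
    unfolding m_real[symmetric]
    by (intro poly_bounded_add poly_bounded_mult poly_bounded_const poly_bounded_of_nat) auto
  have pw: "poly_bounded (\<lambda>n. real (w n))"
    unfolding w_def of_nat_mult of_nat_power
    by (intro poly_bounded_mult poly_bounded_const poly_bounded_power pm) auto
  have pN: "poly_bounded (\<lambda>n. real (N n))"
    unfolding N_def of_nat_mult of_nat_add
    by (intro poly_bounded_mult poly_bounded_add poly_bounded_const pm pw) auto
  have pR: "poly_bounded (\<lambda>n. real (R n))"
    unfolding R_def of_nat_mult of_nat_add
    by (intro poly_bounded_mult poly_bounded_add poly_bounded_const pm pN) auto
  have pf1: "poly_bounded f1"
    unfolding f1_def of_nat_mult using c_pos
    by (intro poly_bounded_mult poly_bounded_add poly_bounded_const poly_bounded_power pm pw pR) auto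
  have pf2: "poly_bounded f2"
    unfolding f2_def of_nat_mult of_nat_add of_nat_power
    by (intro poly_bounded_mult poly_bounded_add poly_bounded_const poly_bounded_power pR) auto
  have "AE \<omega> in M. \<forall>n. \<exists>s\<ge>n. \<omega> \<notin> E1 s \<union> E2 s"
  proof (rule AE_frequently_not)
    show "outer_le (E1 s \<union> E2 s) (f1 s * (1 / 2) ^ s + f2 s * (1 - p0 k) ^ s)" for s
      by (rule outer_le_Un[OF o1 o2])
    have l1: "(\<lambda>s. f1 s * (1 / 2) ^ s) \<longlonglongrightarrow> 0" by (rule poly_bounded_times_geometric[OF pf1]) auto
    have l2: "(\<lambda>s. f2 s * (1 - p0 k) ^ s) \<longlonglongrightarrow> 0"
      by (rule poly_bounded_times_geometric[OF pf2]) (use p0_bounds[of k] in auto)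
    show "(\<lambda>s. f1 s * (1 / 2) ^ s + f2 s * (1 - p0 k) ^ s) \<longlonglongrightarrow> 0"
      using tendsto_add[OF l1 l2] by simp
  qed
  then show ?thesis
  proof eventually_elim
    fix \<omega> assume fr: "\<forall>n. \<exists>s\<ge>n. \<omega> \<notin> E1 s \<union> E2 s"
    show "\<forall>r. \<exists>m R N. r \<le> m \<and> 0 < m \<and> r + 2 * m * (real N + 2) \<le> R \<and>
     (\<forall>P. Phi \<omega> \<subseteq> P \<and> P \<subseteq> Phi \<omega> \<union> {0} \<longrightarrow> (\<nexists>u v. increasing_chain P m R N u v) \<and>
        (\<forall>x. norm x \<le> R \<longrightarrow> (\<exists>z. ball z (20 ^ k) \<subseteq> ball x m \<and> pattern k z P)))"
    proof
      fix r :: real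
      obtain s where s: "s \<ge> nat \<lceil>r\<rceil>" "\<omega> \<notin> E1 s" "\<omega> \<notin> E2 s" using fr by blast
      have rm: "r \<le> real (m s)" using s(1) m1(2)[of s] by linarith
      have no_chain: "\<nexists>u v. increasing_chain P (real (m s)) (real (R s)) (2 * N s + 1) u v"
        if "P \<subseteq> Phi \<omega> \<union> {0}" for P
        using increasing_chain_avoiding[OF _ that] s(2) unfolding E1_def by blast
      have pat: "\<exists>z. ball z (20 ^ k) \<subseteq> ball x (real (m s)) \<and> pattern k z P"
        if P: "Phi \<omega> \<subseteq> P" "P \<subseteq> Phi \<omega> \<union> {0}" and x: "norm x \<le> real (R s)" for P x
      proof -
        obtain z where "ball z (20 ^ k) \<subseteq> ball x (real (m s))" "0 \<notin> ball z (20 ^ k)" "pattern k z (Phi \<omega>)"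
          using s(3) x unfolding E2_def by blast
        then show ?thesis using pattern_extend[OF _ P] by blast
      qed
      have "r + 2 * real (m s) * (real (2 * N s + 1) + 2) \<le> real (R s)"
        using rm by (simp add: R_def algebra_simps)
      moreover have "0 < real (m s)" using m1(1)[of s] by simp
      ultimately have good: "r \<le> real (m s) \<and> 0 < real (m s) \<and> r + 2 * real (m s) * (real (2 * N s + 1) + 2) \<le> real (R s) \<and>
         (\<forall>P. Phi \<omega> \<subseteq> P \<and> P \<subseteq> Phi \<omega> \<union> {0} \<longrightarrow>
            (\<nexists>u v. increasing_chain P (real (m s)) (real (R s)) (2 * N s + 1) u v) \<and>
            (\<forall>x. norm x \<le> real (R s) \<longrightarrow> (\<exists>z. ball z (20 ^ k) \<subseteq> ball x (real (m s)) \<and> pattern k z P)))"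
        using rm no_chain pat by blast
      show "\<exists>m R N. r \<le> m \<and> 0 < m \<and> r + 2 * m * (real N + 2) \<le> R \<and>
         (\<forall>P. Phi \<omega> \<subseteq> P \<and> P \<subseteq> Phi \<omega> \<union> {0} \<longrightarrow> (\<nexists>u v. increasing_chain P m R N u v) \<and>
            (\<forall>x. norm x \<le> R \<longrightarrow> (\<exists>z. ball z (20 ^ k) \<subseteq> ball x m \<and> pattern k z P)))"
        by (rule exI[of _ "real (m s)"], rule exI[of _ "real (R s)"], rule exI[of _ "2 * N s + 1"], rule good)
    qed
  qed
qed

lemma AE_chn_well_defined:
  "AE \<omega> in M. \<forall>P n. Phi \<omega> \<subseteq> P \<and> P \<subseteq> Phi \<omega> \<union> {0} \<longrightarrow>
     chn_wd P n \<and> (\<forall>x\<in>P. class_FF P (chn P n) (component P (chn P n) x) \<and>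
       unique_cycle_length_2 (chn P n) (component P (chn P n) x))"
proof -
  have "AE \<omega> in M. \<forall>K. \<forall>r. \<exists>m R N. r \<le> m \<and> 0 < m \<and> r + 2 * m * (real N + 2) \<le> R \<and>
     (\<forall>P. Phi \<omega> \<subseteq> P \<and> P \<subseteq> Phi \<omega> \<union> {0} \<longrightarrow> (\<nexists>u v. increasing_chain P m R N u v) \<and>
        (\<forall>x. norm x \<le> R \<longrightarrow> (\<exists>z. ball z (20 ^ Suc K) \<subseteq> ball x m \<and> pattern (Suc K) z P)))"
    by (subst AE_all_countable) (intro allI AE_scales)
  with AE_no_ties AE_space show ?thesis
  proof eventually_elim
    fix \<omega> assume nt: "no_ties (Phi \<omega> \<union> {0})" and sp: "\<omega> \<in> space M"
      and sc: "\<forall>K. \<forall>r. \<exists>m R N. r \<le> m \<and> 0 < m \<and> r + 2 * m * (real N + 2) \<le> R \<and>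
     (\<forall>P. Phi \<omega> \<subseteq> P \<and> P \<subseteq> Phi \<omega> \<union> {0} \<longrightarrow> (\<nexists>u v. increasing_chain P m R N u v) \<and>
        (\<forall>x. norm x \<le> R \<longrightarrow> (\<exists>z. ball z (20 ^ Suc K) \<subseteq> ball x m \<and> pattern (Suc K) z P)))"
    show "\<forall>P n. Phi \<omega> \<subseteq> P \<and> P \<subseteq> Phi \<omega> \<union> {0} \<longrightarrow>
     chn_wd P n \<and> (\<forall>x\<in>P. class_FF P (chn P n) (component P (chn P n) x) \<and>
       unique_cycle_length_2 (chn P n) (component P (chn P n) x))"
    proof (intro allI impI)
      fix P n assume P: "Phi \<omega> \<subseteq> P \<and> P \<subseteq> Phi \<omega> \<union> {0}"
      show "chn_wd P n \<and> (\<forall>x\<in>P. class_FF P (chn P n) (component P (chn P n) x) \<and>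
          unique_cycle_length_2 (chn P n) (component P (chn P n) x))"
      proof (rule chn_well_defined)
        show "finite (P \<inter> cball 0 R)" for R
          by (rule finite_subset[of _ "insert 0 (Phi \<omega> \<inter> cball 0 R)"]) (use P locally_finite[OF sp] in auto)
        show "no_ties P" using nt P unfolding no_ties_def by (meson subsetD)
        show "\<exists>m R N. r \<le> m \<and> 0 < m \<and> r + 2 * m * (real N + 2) \<le> R \<and> (\<nexists>u v. increasing_chain P m R N u v) \<and>
            (\<forall>x. norm x \<le> R \<longrightarrow> (\<exists>z. ball z (20 ^ Suc K) \<subseteq> ball x m \<and> pattern (Suc K) z P))" for K r
          using sc[rule_format, of r K] P by (elim exE conjE) blast
      qed
    qed
  qed
qed

end

theorem mainTheorem3:
  fixes M :: "'b measure" and Phi :: "'b \<Rightarrow> 'a::euclidean_space set" and c :: real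
  assumes "homogeneous_PPP M Phi c"
  shows "(AE \<omega> in M. \<forall>n. chn_wd (Phi \<omega>) n) \<and>
         (AE \<omega> in M. \<forall>n. chn_wd (Phi \<omega> \<union> {0}) n \<and>
            (\<forall>x\<in>Phi \<omega> \<union> {0}.
               class_FF (Phi \<omega> \<union> {0}) (chn (Phi \<omega> \<union> {0}) n)
                        (component (Phi \<omega> \<union> {0}) (chn (Phi \<omega> \<union> {0}) n) x) \<and>
               unique_cycle_length_2 (chn (Phi \<omega> \<union> {0}) n)
                        (component (Phi \<omega> \<union> {0}) (chn (Phi \<omega> \<union> {0}) n) x)))"
proof -
  interpret prob_space M using assms by (simp add: homogeneous_PPP_def)
  interpret poisson_process M Phi c by unfold_locales (rule assms)
  note * = AE_chn_well_defined
  show ?thesis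
  proof
    show "AE \<omega> in M. \<forall>n. chn_wd (Phi \<omega>) n" using * by eventually_elim blast
    show "AE \<omega> in M. \<forall>n. chn_wd (Phi \<omega> \<union> {0}) n \<and>
            (\<forall>x\<in>Phi \<omega> \<union> {0}.
               class_FF (Phi \<omega> \<union> {0}) (chn (Phi \<omega> \<union> {0}) n)
                        (component (Phi \<omega> \<union> {0}) (chn (Phi \<omega> \<union> {0}) n) x) \<and>
               unique_cycle_length_2 (chn (Phi \<omega> \<union> {0}) n)
                        (component (Phi \<omega> \<union> {0}) (chn (Phi \<omega> \<union> {0}) n) x))"
      using * by eventually_elim blast
  qed
qed

end
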